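(* Let $H$ be a complex Hilbert space, let $T=\begin{pmatrix}A&B\\ C&-A^*\end{pmatrix}$ be a nonnegative diagonally $p$-dominant Hamiltonian in $H\times H$ with $p<1$, and let $A$ be sectorially dichotomous with angle $\theta\in[0,\pi/2[$. Then $T$ is dichotomous, the spectral projections $P_+,P_-$ satisfy \[\frac1{\pi\mathrm i}\int_{\mathrm i\mathbb R}'(T-z)^{-1}x\,dz=P_+x-P_-x,\qquad x\in H\times H,\] and there exist $h>0$, $\theta''\in\,]\theta,\pi/2[$ and for every $\theta'\in\,]\theta,\pi/2[$ an $r'>0$ such that \[\{z\in\mathbb C:|\operatorname{Re}z|<h\}\cup\Omega_{\theta'',0}\cup\Omega_{\theta',r'}\subset\varrho(T).\]
   Context: $\mathcal D(\cdot)$ is the domain, $\varrho(\cdot)$ the resolvent set, $\sigma(\cdot)$ the spectrum; $\mathbb C_\pm$ are the open right/left half-planes. $\int'_{\mathrm i\mathbb R}$ denotes the Cauchy principal value at infinity, $\lim_{\rho\to\infty}\int_{-\mathrm i\rho}^{\mathrm i\rho}$. Subordination: $R$ is $p$-subordinate to $S$, $p\in[0,1]$, if $\mathcal D(S)\subset\mathcal D(R)$ and there is $c\ge0$ with $\|Rx\|\le c\|x\|^{1-p}\|Sx\|^p$ for all $x\in\mathcal D(S)$. Hamiltonian: $T=\begin{pmatrix}A&B\\ C&-A^*\end{pmatrix}$ in $H\times H$ with $A,B,C$ densely defined linear operators in $H$, $A$ closed, and $B,C$ symmetric. It is nonnegative if $B$ and $C$ are nonnegative. It is diagonally $p$-dominant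 if $C$ is $p$-subordinate to $A$ and $B$ is $p$-subordinate to $A^*$; then $\mathcal D(T)=\mathcal D(A)\times\mathcal D(A^* )$. Notation: $-\pi<\arg z\le\pi$, $\arg0=0$, $\Sigma_\theta=\{z\in\mathbb C:|\arg z|\le\theta\}$, $\Omega_{\theta',r}=\{z\in\mathbb C:\theta'\le|\arg z|\le\pi-\theta',\ |z|>r\}$. Sectorial: a densely defined linear operator $S$ is sectorial with angle $\theta\in[0,\pi[$ if $\sigma(S)\subset\Sigma_\theta$ and for every $\theta'\in\,]\theta,\pi]$ there is $M>0$ with $\|(S-z)^{-1}\|\le M/|z|$ for $|\arg z|\ge\theta'$, $|z|>0$. Dichotomous: a densely defined linear operator $S$ on a Banach space $V$ is dichotomous if there exist $h>0$ and complementary closed subspaces $V=V_+\oplus V_-$ (spectral subspaces) with (a) $\{z:|\operatorname{Re}z|<h\}\subset\varrho(S)$; (b) $S(\mathcal D(S)\cap V_\pm)\subset V_\pm$; (c) $\sigma(S|_{V_+})\subset\mathbb C_+$, $\sigma(S|_{V_-})\subset\mathbb C_-$. The spectral projections $P_\pm$ are the projections onto $V_\pm$ along $V_\mp$; $S_\pm=S|_{V_\pm}$. $S$ is sectorially dichotomous with angle $\theta\in[0,\pi/2[$ if it is dichotomous and $S_+$ and $-S_-$ are sectorial with angle $\theta$. *)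

theory Defs
  imports "HOL-Analysis.Analysis"
begin

section \<open>Complex Banach and Hilbert spaces\<close>

class scaleC =
  fixes scaleC :: "complex \<Rightarrow> 'a \<Rightarrow> 'a"  (infixr \<open>*\<^sub>C\<close> 75)

class complex_vector = real_vector + scaleC +
  assumes scaleC_add_right: "a *\<^sub>C (x + y) = a *\<^sub>C x + a *\<^sub>C y"
    and scaleC_add_left: "(a + b) *\<^sub>C x = a *\<^sub>C x + b *\<^sub>C x"
    and scaleC_scaleC: "a *\<^sub>C (b *\<^sub>C x) = (a * b) *\<^sub>C x"
    and scaleC_of_real: "complex_of_real r *\<^sub>C x = r *\<^sub>R x"

class complex_normed_vector = complex_vector + real_normed_vector +
  assumes norm_scaleC: "norm (a *\<^sub>C x) = cmod a * norm x"

class complex_banach = complex_normed_vector + banach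

text \<open>
  The complex inner product is linear in its first argument; its real part is the inner product of
  the underlying real space, so that norm and topology are those of \<^class>\<open>real_inner\<close>.
\<close>
class complex_inner = complex_normed_vector + real_inner +
  fixes cinner :: "'a \<Rightarrow> 'a \<Rightarrow> complex"
  assumes cinner_commute: "cinner x y = cnj (cinner y x)"
    and cinner_add_left: "cinner (x + y) z = cinner x z + cinner y z"
    and cinner_scaleC_left: "cinner (a *\<^sub>C x) y = a * cinner x y"
    and inner_eq_Re_cinner: "inner x y = Re (cinner x y)"

class complex_hilbert = complex_inner + complex_banach

instantiation complex :: complex_hilbert
begin
definition scaleC_complex :: "complex \<Rightarrow> complex \<Rightarrow> complex" where "scaleC_complex a x = a * x"
definition cinner_complex :: "complex \<Rightarrow> complex \<Rightarrow> complex" where "cinner_complex x y = x * cnj y"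
instance
  by standard
    (auto simp: scaleC_complex_def cinner_complex_def algebra_simps scaleR_conv_of_real
      norm_mult inner_complex_def)
end

instantiation prod :: (complex_vector, complex_vector) complex_vector
begin
definition scaleC_prod :: "complex \<Rightarrow> 'a \<times> 'b \<Rightarrow> 'a \<times> 'b"
  where "scaleC_prod a x = (a *\<^sub>C fst x, a *\<^sub>C snd x)"
instance
  by standard
    (auto simp: scaleC_prod_def prod_eq_iff scaleC_add_right scaleC_add_left scaleC_scaleC
      scaleC_of_real)
end

instance prod :: (complex_normed_vector, complex_normed_vector) complex_normed_vector
proof
  fix a and x :: "'a \<times> 'b"
  have "(cmod a * norm (fst x))\<^sup>2 + (cmod a * norm (snd x))\<^sup>2
      = (cmod a)\<^sup>2 * ((norm (fst x))\<^sup>2 + (norm (snd x))\<^sup>2)"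
    by (simp add: power_mult_distrib distrib_left)
  then show "norm (a *\<^sub>C x) = cmod a * norm x"
    by (simp add: scaleC_prod_def norm_prod_def norm_scaleC real_sqrt_mult)
qed

instance prod :: (complex_banach, complex_banach) complex_banach ..

instantiation prod :: (complex_inner, complex_inner) complex_inner
begin
definition cinner_prod :: "'a \<times> 'b \<Rightarrow> 'a \<times> 'b \<Rightarrow> complex"
  where "cinner_prod x y = cinner (fst x) (fst y) + cinner (snd x) (snd y)"
instance
proof
  fix x y :: "'a \<times> 'b"
  show "cinner x y = cnj (cinner y x)"
    unfolding cinner_prod_def complex_cnj_add
    by (metis cinner_commute)
qed (auto simp: cinner_prod_def scaleC_prod_def cinner_add_left cinner_scaleC_left
      inner_eq_Re_cinner inner_prod_def algebra_simps)
end

instance prod :: (complex_hilbert, complex_hilbert) complex_hilbert ..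

definition csubspace :: "'a::complex_vector set \<Rightarrow> bool" where
  "csubspace V \<longleftrightarrow> 0 \<in> V \<and> (\<forall>x\<in>V. \<forall>y\<in>V. x + y \<in> V) \<and> (\<forall>a. \<forall>x\<in>V. a *\<^sub>C x \<in> V)"


section \<open>Unbounded operators\<close>

text \<open>
  An operator is a domain together with a map, whose values outside the domain are irrelevant.
  Operators act in a closed subspace \<open>V\<close> of the ambient type; \<open>V\<close> is an explicit argument
  wherever a notion depends on it, so that restrictions to spectral subspaces stay within the same
  type. For operators in the whole space, \<open>V = UNIV\<close>.
\<close>
datatype 'a operator = Operator (op_dom: "'a set") (op_app: "'a \<Rightarrow> 'a")

definition linear_operator_on :: "'a::complex_vector set \<Rightarrow> 'a operator \<Rightarrow> bool" where
  "linear_operator_on V S \<longleftrightarrow>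
     op_dom S \<subseteq> V \<and> csubspace (op_dom S) \<and> op_app S ` op_dom S \<subseteq> V \<and>
     (\<forall>x\<in>op_dom S. \<forall>y\<in>op_dom S. op_app S (x + y) = op_app S x + op_app S y) \<and>
     (\<forall>a. \<forall>x\<in>op_dom S. op_app S (a *\<^sub>C x) = a *\<^sub>C op_app S x)"

definition densely_defined_on :: "'a::complex_normed_vector set \<Rightarrow> 'a operator \<Rightarrow> bool" where
  "densely_defined_on V S \<longleftrightarrow> linear_operator_on V S \<and> V \<subseteq> closure (op_dom S)"

definition closed_operator :: "'a::complex_normed_vector operator \<Rightarrow> bool" where
  "closed_operator S \<longleftrightarrow> closed ((\<lambda>x. (x, op_app S x)) ` op_dom S)"

definition op_restrict :: "'a operator \<Rightarrow> 'a set \<Rightarrow> 'a operator" where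
  "op_restrict S V = Operator (op_dom S \<inter> V) (op_app S)"

definition op_uminus :: "'a::uminus operator \<Rightarrow> 'a operator" where
  "op_uminus S = Operator (op_dom S) (\<lambda>x. - op_app S x)"

text \<open>The map of the adjoint is well defined when \<open>S\<close> is densely defined.\<close>
definition adjoint_op :: "'a::complex_inner operator \<Rightarrow> 'a operator" where
  "adjoint_op S = Operator
     {y. \<exists>z. \<forall>x\<in>op_dom S. cinner (op_app S x) y = cinner x z}
     (\<lambda>y. THE z. \<forall>x\<in>op_dom S. cinner (op_app S x) y = cinner x z)"

definition symmetric_operator :: "'a::complex_inner operator \<Rightarrow> bool" where
  "symmetric_operator S \<longleftrightarrow>
     (\<forall>x\<in>op_dom S. \<forall>y\<in>op_dom S. cinner (op_app S x) y = cinner x (op_app S y))"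

definition nonnegative_operator :: "'a::complex_inner operator \<Rightarrow> bool" where
  "nonnegative_operator S \<longleftrightarrow> (\<forall>x\<in>op_dom S. cinner (op_app S x) x \<in> \<real>\<^sub>\<ge>\<^sub>0)"

text \<open>\<open>z\<close> is in the resolvent set iff \<open>S - z\<close> maps its domain bijectively onto \<open>V\<close> with bounded inverse.\<close>
definition resolvent_set_on :: "'a::complex_normed_vector set \<Rightarrow> 'a operator \<Rightarrow> complex set" where
  "resolvent_set_on V S =
     {z. bij_betw (\<lambda>x. op_app S x - z *\<^sub>C x) (op_dom S) V \<and>
         (\<exists>K. \<forall>x\<in>op_dom S. norm x \<le> K * norm (op_app S x - z *\<^sub>C x))}"

definition spectrum_on :: "'a::complex_normed_vector set \<Rightarrow> 'a operator \<Rightarrow> complex set" where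
  "spectrum_on V S = - resolvent_set_on V S"

definition resolvent :: "'a::complex_normed_vector operator \<Rightarrow> complex \<Rightarrow> 'a \<Rightarrow> 'a" where
  "resolvent S z = inv_into (op_dom S) (\<lambda>x. op_app S x - z *\<^sub>C x)"


section \<open>Sectorial and dichotomous operators\<close>

definition sector :: "real \<Rightarrow> complex set" where
  "sector \<theta> = {z. \<bar>Arg z\<bar> \<le> \<theta>}"

definition double_sector :: "real \<Rightarrow> real \<Rightarrow> complex set" where
  "double_sector \<theta> r = {z. \<theta> \<le> \<bar>Arg z\<bar> \<and> \<bar>Arg z\<bar> \<le> pi - \<theta> \<and> r < cmod z}"

definition sectorial_on :: "'a::complex_normed_vector set \<Rightarrow> 'a operator \<Rightarrow> real \<Rightarrow> bool" where
  "sectorial_on V S \<theta> \<longleftrightarrow>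
     0 \<le> \<theta> \<and> \<theta> < pi \<and> densely_defined_on V S \<and> spectrum_on V S \<subseteq> sector \<theta> \<and>
     (\<forall>\<theta>'. \<theta> < \<theta>' \<and> \<theta>' \<le> pi \<longrightarrow>
       (\<exists>M>0. \<forall>z. \<theta>' \<le> \<bar>Arg z\<bar> \<and> 0 < cmod z \<longrightarrow>
         (\<forall>y\<in>V. norm (resolvent S z y) \<le> M / cmod z * norm y)))"

definition complementary :: "'a::complex_vector set \<Rightarrow> 'a set \<Rightarrow> bool" where
  "complementary V W \<longleftrightarrow> csubspace V \<and> csubspace W \<and> V \<inter> W = {0} \<and> (\<forall>x. \<exists>v\<in>V. \<exists>w\<in>W. x = v + w)"

text \<open>
  In general an operator can be dichotomous with respect to more than one pair of subspaces
  (for example when its spectrum is empty), so the pair of spectral subspaces is kept explicit.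
\<close>
definition dichotomous_wrt :: "'a::complex_banach operator \<Rightarrow> 'a set \<Rightarrow> 'a set \<Rightarrow> bool" where
  "dichotomous_wrt S Vp Vm \<longleftrightarrow>
     densely_defined_on UNIV S \<and>
     closed Vp \<and> closed Vm \<and> complementary Vp Vm \<and>
     (\<exists>h>0. {z. \<bar>Re z\<bar> < h} \<subseteq> resolvent_set_on UNIV S) \<and>
     op_app S ` (op_dom S \<inter> Vp) \<subseteq> Vp \<and>
     op_app S ` (op_dom S \<inter> Vm) \<subseteq> Vm \<and>
     spectrum_on Vp (op_restrict S Vp) \<subseteq> {z. 0 < Re z} \<and>
     spectrum_on Vm (op_restrict S Vm) \<subseteq> {z. Re z < 0}"

definition dichotomous :: "'a::complex_banach operator \<Rightarrow> bool" where
  "dichotomous S \<longleftrightarrow> (\<exists>Vp Vm. dichotomous_wrt S Vp Vm)"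

definition sectorially_dichotomous :: "'a::complex_banach operator \<Rightarrow> real \<Rightarrow> bool" where
  "sectorially_dichotomous S \<theta> \<longleftrightarrow>
     0 \<le> \<theta> \<and> \<theta> < pi / 2 \<and>
     (\<exists>Vp Vm. dichotomous_wrt S Vp Vm \<and>
       sectorial_on Vp (op_restrict S Vp) \<theta> \<and>
       sectorial_on Vm (op_uminus (op_restrict S Vm)) \<theta>)"

text \<open>The projection onto \<open>V\<close> along \<open>W\<close>, for complementary \<open>V\<close> and \<open>W\<close>.\<close>
definition projection_along :: "'a::ab_group_add set \<Rightarrow> 'a set \<Rightarrow> 'a \<Rightarrow> 'a" where
  "projection_along V W x = (THE v. v \<in> V \<and> x - v \<in> W)"

text \<open>
  The integral over the imaginary axis as a principal value at infinity, with the
  parametrisation \<open>z = \<i> t\<close>, \<open>dz = \<i> dt\<close>.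
\<close>
definition has_pv_integral_imag_axis :: "(complex \<Rightarrow> 'a::complex_banach) \<Rightarrow> 'a \<Rightarrow> bool" where
  "has_pv_integral_imag_axis f I \<longleftrightarrow>
     (\<forall>\<rho>>0. (\<lambda>t. \<i> *\<^sub>C f (\<i> * complex_of_real t)) integrable_on {-\<rho>..\<rho>}) \<and>
     ((\<lambda>\<rho>. integral {-\<rho>..\<rho>} (\<lambda>t. \<i> *\<^sub>C f (\<i> * complex_of_real t))) \<longlongrightarrow> I) at_top"


section \<open>Hamiltonians\<close>

text \<open>\<^const>\<open>powr\<close> satisfies \<open>0 powr 0 = 0\<close>; subordination uses the convention \<open>0\<^sup>0 = 1\<close>.\<close>
definition rpow :: "real \<Rightarrow> real \<Rightarrow> real" where
  "rpow a p = (if p = 0 then 1 else a powr p)"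

definition subordinate ::
  "real \<Rightarrow> 'a::complex_normed_vector operator \<Rightarrow> 'a operator \<Rightarrow> bool" where
  "subordinate p R S \<longleftrightarrow>
     0 \<le> p \<and> p \<le> 1 \<and> op_dom S \<subseteq> op_dom R \<and>
     (\<exists>c\<ge>0. \<forall>x\<in>op_dom S.
        norm (op_app R x) \<le> c * rpow (norm x) (1 - p) * rpow (norm (op_app S x)) p)"

definition hamiltonian_entries ::
  "'a::complex_hilbert operator \<Rightarrow> 'a operator \<Rightarrow> 'a operator \<Rightarrow> bool" where
  "hamiltonian_entries A B C \<longleftrightarrow>
     densely_defined_on UNIV A \<and> densely_defined_on UNIV B \<and> densely_defined_on UNIV C \<and>
     closed_operator A \<and> symmetric_operator B \<and> symmetric_operator C"

text \<open>
  The block operator matrix with rows \<open>(A, B)\<close> and \<open>(C, -A\<^sup>*)\<close> on its natural domain.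
\<close>
definition hamiltonian ::
  "'a::complex_hilbert operator \<Rightarrow> 'a operator \<Rightarrow> 'a operator \<Rightarrow> ('a \<times> 'a) operator" where
  "hamiltonian A B C = Operator
     ((op_dom A \<inter> op_dom C) \<times> (op_dom B \<inter> op_dom (adjoint_op A)))
     (\<lambda>(x, y). (op_app A x + op_app B y, op_app C x - op_app (adjoint_op A) y))"

definition nonnegative_hamiltonian ::
  "'a::complex_hilbert operator \<Rightarrow> 'a operator \<Rightarrow> 'a operator \<Rightarrow> bool" where
  "nonnegative_hamiltonian A B C \<longleftrightarrow>
     hamiltonian_entries A B C \<and> nonnegative_operator B \<and> nonnegative_operator C"

definition diagonally_dominant ::
  "real \<Rightarrow> 'a::complex_hilbert operator \<Rightarrow> 'a operator \<Rightarrow> 'a operator \<Rightarrow> bool" where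
  "diagonally_dominant p A B C \<longleftrightarrow> subordinate p C A \<and> subordinate p B (adjoint_op A)"

lemma op_dom_hamiltonian_diagonally_dominant:
  "diagonally_dominant p A B C \<Longrightarrow>
     op_dom (hamiltonian A B C) = op_dom A \<times> op_dom (adjoint_op A)"
  by (auto simp: diagonally_dominant_def subordinate_def hamiltonian_def)

end

theory Submission
  imports Defs "HOL-Complex_Analysis.Complex_Analysis"
begin

text \<open>
  Write \<open>T = D + R\<close> with the diagonal part \<open>D = diag (A, - A\<^sup>*)\<close> and the off-diagonal part \<open>R\<close>. The
  proof compares the resolvents of \<open>T\<close> and \<open>D\<close> on the imaginary axis and reads the dichotomy of \<open>T\<close>
  off from the behaviour of its resolvent there.

  A sectorially dichotomous \<open>A\<close> has \<open>\<parallel>(A - z)\<inverse>\<parallel> \<le> M / \<bar>z\<bar>\<close> on every bisector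
  \<open>\<theta>' \<le> \<bar>arg z\<bar> \<le> \<pi> - \<theta>'\<close> with \<open>\<theta>' > \<theta>\<close>, and the truncated integrals of \<open>(A - z)\<inverse>\<close> over \<open>[- \<i>\<rho>, \<i>\<rho>]\<close> are bounded uniformly in \<open>\<rho>\<close>
  (\<open>sectorially_dichotomousD\<close>): on each spectral subspace the segment can be deformed into a half
  circle of radius \<open>\<rho>\<close> on which the resolvent is \<open>O(1 / \<rho>)\<close>. Both properties pass to \<open>- A\<^sup>*\<close> by
  duality (\<open>adjoint_resolvent\<close>, \<open>imag_integral_adjoint_resolvent_le\<close>), hence to \<open>D\<close>.

  Subordination with \<open>p < 1\<close> turns \<open>\<parallel>(D - z)\<inverse>\<parallel> \<le> M / \<bar>z\<bar>\<close> into \<open>\<parallel>R (D - z)\<inverse>\<parallel> = O(\<bar>z\<bar> powr (p - 1))\<close>.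
  So far out in a bisector \<open>T - z\<close> is invertible by a contraction argument (\<open>resolvent_set_T\<close>). Near
  the origin, nonnegativity takes over. If \<open>Re z = 0\<close> and \<open>(T - z) (x, y) = (f, g)\<close>, the contributions
  of the diagonal cancel in
  \<open>\<langle>B y, y\<rangle> + \<langle>C x, x\<rangle> = \<langle>f, y\<rangle> + \<langle>x, g\<rangle>\<close>, and the Cauchy-Schwarz inequality for the forms of \<open>B\<close> and
  \<open>C\<close> yields a lower bound for \<open>T - z\<close> (\<open>lower_bound_T\<close>) of the same order as for \<open>D - z\<close>. Since it is
  uniform, the resolvent set spreads from far out along the whole axis and to a strip around it
  (\<open>imag_axis_estimates\<close>). The union of a strip with the outer part of one bisector contains a thinner
  full bisector, which gives the claim on \<open>\<Omega>\<close>.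

  On the axis \<open>(T - z)\<inverse> - (D - z)\<inverse> = - (T - z)\<inverse> R (D - z)\<inverse>\<close> is \<open>O(\<bar>z\<bar> powr (p - 2))\<close>, which is
  integrable. Hence the truncated integrals of \<open>(T - z)\<inverse>\<close> are uniformly bounded as well. This and the
  decay of the resolvent suffice for dichotomy (\<open>dichotomous_V\<close>). The principal value exists on the
  domain of \<open>T\<close>, hence everywhere; divided by \<open>\<pi> \<i>\<close> it is a bounded operator \<open>J\<close>, the sign of \<open>T\<close>.
  For \<open>P\<^sub>\<plusminus> = (1 \<plusminus> J) / 2\<close> the absolutely convergent integrals
  \<open>\<plusminus> 1 / (2 \<pi> \<i>) \<integral> (T - z)\<inverse> / (z - \<mu>) dz\<close> solve \<open>(T - \<mu>) H = P\<^sub>\<plusminus>\<close> for \<open>\<mu>\<close> in the left and right half-plane,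
  respectively. On \<open>P\<^sub>+ P\<^sub>- x\<close> they continue the resolvent to a bounded entire function that vanishes
  at infinity along the axis, so \<open>P\<^sub>+ P\<^sub>- = 0\<close> by Liouville's theorem (\<open>P_disjoint\<close>). Thus \<open>P\<^sub>\<plusminus>\<close> are
  complementary projections, and the integrals provide the resolvents of the restrictions of \<open>T\<close>.
\<close>

section \<open>Complex scalars and the complex inner product\<close>

lemma scaleC_zero_left [simp]: "0 *\<^sub>C (x::'a::complex_vector) = 0"
  using scaleC_of_real[of 0 x] by simp

lemma scaleC_one [simp]: "1 *\<^sub>C (x::'a::complex_vector) = x"
  using scaleC_of_real[of 1 x] by simp

lemma scaleC_zero_right [simp]: "a *\<^sub>C (0::'a::complex_vector) = 0"
  using scaleC_scaleC[of a 0 "0::'a"] by simp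

lemma scaleC_minus_right [simp]: "a *\<^sub>C (- x) = - (a *\<^sub>C (x::'a::complex_vector))"
  using scaleC_add_right[of a x "- x"] by (simp add: add_eq_0_iff)

lemma scaleC_minus_left [simp]: "(- a) *\<^sub>C x = - (a *\<^sub>C (x::'a::complex_vector))"
  using scaleC_add_left[of a "- a" x] by (simp add: add_eq_0_iff)

lemma scaleC_diff_right: "a *\<^sub>C (x - y) = a *\<^sub>C x - a *\<^sub>C (y::'a::complex_vector)"
  using scaleC_add_right[of a x "- y"] by simp

lemma scaleC_diff_left: "(a - b) *\<^sub>C x = a *\<^sub>C x - b *\<^sub>C (x::'a::complex_vector)"
  using scaleC_add_left[of a "- b" x] by simp

lemma scaleC_scaleR: "a *\<^sub>C (r *\<^sub>R x) = r *\<^sub>R (a *\<^sub>C (x::'a::complex_vector))"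
  by (metis scaleC_of_real scaleC_scaleC mult.commute)

lemma scaleR_scaleC: "(r *\<^sub>R a) *\<^sub>C x = r *\<^sub>R (a *\<^sub>C (x::'a::complex_vector))"
  by (metis scaleC_of_real scaleC_scaleC scaleR_conv_of_real)

lemma scaleC_left_commute: "a *\<^sub>C b *\<^sub>C x = b *\<^sub>C a *\<^sub>C (x::'a::complex_vector)"
  by (simp add: scaleC_scaleC mult.commute)

lemma scaleC_complex [simp]: "a *\<^sub>C (x::complex) = a * x"
  by (simp add: scaleC_complex_def)

lemma fst_scaleC [simp]: "fst (a *\<^sub>C x) = a *\<^sub>C fst x"
  and snd_scaleC [simp]: "snd (a *\<^sub>C x) = a *\<^sub>C snd x"
  by (simp_all add: scaleC_prod_def)

lemma bounded_bilinear_scaleC: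
  "bounded_bilinear (\<lambda>a (x::'a::complex_normed_vector). a *\<^sub>C x)"
  by (rule bounded_bilinear.intro)
    (auto simp: scaleC_add_left scaleC_add_right scaleR_scaleC scaleC_scaleR norm_scaleC
      intro!: exI[of _ 1])

lemmas bounded_linear_scaleC_right = bounded_bilinear.bounded_linear_right[OF bounded_bilinear_scaleC]
lemmas continuous_on_scaleC [continuous_intros] =
  bounded_bilinear.continuous_on[OF bounded_bilinear_scaleC]

lemma cinner_add_right: "cinner x (y + z) = cinner x y + cinner x (z::'a::complex_inner)"
  by (metis cinner_add_left cinner_commute complex_cnj_add)

lemma cinner_scaleC_right: "cinner x (a *\<^sub>C y) = cnj a * cinner x (y::'a::complex_inner)"
  by (metis cinner_scaleC_left cinner_commute complex_cnj_mult)

lemma cinner_zero_left [simp]: "cinner 0 (x::'a::complex_inner) = 0"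
  using cinner_scaleC_left[of 0 "0::'a" x] by simp

lemma cinner_zero_right [simp]: "cinner (x::'a::complex_inner) 0 = 0"
  using cinner_scaleC_right[of x 0 "0::'a"] by simp

lemma cinner_minus_left [simp]: "cinner (- x) y = - cinner x (y::'a::complex_inner)"
  using cinner_add_left[of x "- x" y] by (simp add: add_eq_0_iff)

lemma cinner_minus_right [simp]: "cinner x (- y) = - cinner x (y::'a::complex_inner)"
  using cinner_add_right[of x y "- y"] by (simp add: add_eq_0_iff)

lemma cinner_diff_left: "cinner (x - y) z = cinner x z - cinner y (z::'a::complex_inner)"
  using cinner_add_left[of x "- y" z] by simp

lemma cinner_diff_right: "cinner x (y - z) = cinner x y - cinner x (z::'a::complex_inner)"
  using cinner_add_right[of x y "- z"] by simp

lemma cinner_self: "cinner x x = complex_of_real ((norm (x::'a::complex_inner))\<^sup>2)"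
proof -
  have "Im (cinner x x) = 0"
    using arg_cong[OF cinner_commute[of x x], of Im] by simp
  moreover have "Re (cinner x x) = (norm x)\<^sup>2"
    by (simp add: inner_eq_Re_cinner[symmetric] power2_norm_eq_inner)
  ultimately show ?thesis by (simp add: complex_eq_iff)
qed

lemma norm_cinner_le: "cmod (cinner x y) \<le> norm x * norm (y::'a::complex_inner)"
proof (cases "cinner x y = 0")
  case False
  \<comment> \<open>Rotating \<open>x\<close> makes the product real and reduces the claim to the real inner product.\<close>
  define a where "a = cnj (sgn (cinner x y))"
  have na: "cmod a = 1" using False by (simp add: a_def norm_sgn)
  have "a * cinner x y = complex_of_real (cmod (cinner x y))"
    using complex_norm_square[of "cinner x y"] False
    by (simp add: a_def sgn_div_norm scaleR_conv_of_real power2_eq_square field_simps)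
  then have "cmod (cinner x y) = inner (a *\<^sub>C x) y"
    by (simp add: inner_eq_Re_cinner cinner_scaleC_left)
  also have "\<dots> \<le> norm (a *\<^sub>C x) * norm y" by (rule norm_cauchy_schwarz)
  finally show ?thesis by (simp add: norm_scaleC na)
qed simp

lemma scaleR_eq_scaleC: "r *\<^sub>R x = complex_of_real r *\<^sub>C (x::'a::complex_vector)"
  by (simp add: scaleC_of_real)

lemma bounded_linear_cinner_left: "bounded_linear (\<lambda>x. cinner x (y::'a::complex_inner))"
  by (rule bounded_linear_intro[of _ "norm y"])
    (simp_all add: cinner_add_left scaleR_eq_scaleC cinner_scaleC_left norm_cinner_le)

lemma bounded_linear_cinner_right: "bounded_linear (\<lambda>x. cinner (y::'a::complex_inner) x)"
  by (rule bounded_linear_intro[of _ "norm y"])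
    (auto simp: cinner_add_right scaleR_eq_scaleC cinner_scaleC_right mult.commute[of _ "norm y"] norm_cinner_le)

lemma cinner_eq_zeroI: "x = (0::'a::complex_inner)" if "\<And>y. cinner x y = 0"
  using that[of x] by (simp add: cinner_self)

lemma norm_le_if_cinner_le:
  fixes x :: "'a::complex_inner"
  assumes "0 \<le> c" "\<And>y. cmod (cinner x y) \<le> c * norm y"
  shows "norm x \<le> c"
proof (cases "x = 0")
  case False
  have "norm x * norm x \<le> c * norm x"
    using assms(2)[of x] by (simp add: cinner_self power2_eq_square norm_mult)
  then show ?thesis using False by simp
qed (use assms in simp)

section \<open>Riesz representation and bounded projections\<close>

text \<open>
  The representing vector minimises \<open>\<parallel>x\<parallel>\<^sup>2 - 2 f x\<close> over \<open>M\<close>: minimising sequences are Cauchy by the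
  parallelogram law, and the first variation at the minimiser in direction \<open>h\<close> is \<open>2 (\<langle>h, z\<rangle> - f h)\<close>.
  On \<open>M = UNIV\<close> this provides adjoints; on a proper closed subspace, applied to \<open>\<langle>-, x\<rangle>\<close>, it provides
  orthogonal projections.
\<close>

lemma riesz_representation:
  fixes f :: "'a::{real_inner,banach} \<Rightarrow> real"
  assumes M: "closed M" "subspace M"
    and add: "\<And>x y. x \<in> M \<Longrightarrow> y \<in> M \<Longrightarrow> f (x + y) = f x + f y"
    and scale: "\<And>r x. x \<in> M \<Longrightarrow> f (r *\<^sub>R x) = r * f x"
    and bound: "\<And>x. x \<in> M \<Longrightarrow> \<bar>f x\<bar> \<le> K * norm x"
  obtains y where "y \<in> M" "\<And>x. x \<in> M \<Longrightarrow> f x = inner x y"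
proof -
  define \<Phi> where "\<Phi> x = (norm x)\<^sup>2 - 2 * f x" for x
  have K: "- (K\<^sup>2) \<le> \<Phi> x" if "x \<in> M" for x
  proof -
    have "0 \<le> (norm x - K)\<^sup>2" by simp
    then show ?thesis using bound[OF that] by (simp add: \<Phi>_def power2_eq_square algebra_simps)
  qed
  define m where "m = Inf (\<Phi> ` M)"
  have "0 \<in> M" using M subspace_0 by blast
  have bdd: "bdd_below (\<Phi> ` M)" using K by (auto intro!: bdd_belowI)
  have m: "m \<le> \<Phi> x" if "x \<in> M" for x
    unfolding m_def using bdd that by (auto intro: cInf_lower)
  have "\<exists>x\<in>M. \<Phi> x < m + 1 / Suc n" for n
    using cInf_lessD[of "\<Phi> ` M" "m + 1 / Suc n"] \<open>0 \<in> M\<close> by (auto simp: m_def)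
  then obtain y where yM: "\<And>n. y n \<in> M" and y: "\<And>n::nat. \<Phi> (y n) < m + 1 / Suc n"
    by metis
  \<comment> \<open>Parallelogram law: near-minimisers are close to each other.\<close>
  have close: "(norm (u - v))\<^sup>2 \<le> 2 * (a + b)"
    if uv: "u \<in> M" "v \<in> M" and ab: "\<Phi> u \<le> m + a" "\<Phi> v \<le> m + b" for u v a b
  proof -
    let ?w = "(1/2) *\<^sub>R (u + v)"
    have w: "?w \<in> M" using M(2) uv by (simp add: subspace_add subspace_scale)
    have "2 * \<Phi> ?w + (norm (u - v))\<^sup>2 / 2 = \<Phi> u + \<Phi> v"
    proof -
      have "f ?w = (f u + f v) / 2"
        using uv M(2) add[OF uv] scale[of "u + v" "1/2"] by (simp add: subspace_add)
      moreover have "(norm ?w)\<^sup>2 = (norm (u + v))\<^sup>2 / 4"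
        by (simp add: power_divide)
      moreover have "(norm (u + v))\<^sup>2 + (norm (u - v))\<^sup>2 = 2 * (norm u)\<^sup>2 + 2 * (norm v)\<^sup>2"
        by (simp add: power2_norm_eq_inner inner_add inner_diff inner_commute)
      ultimately show ?thesis unfolding \<Phi>_def by argo
    qed
    then show ?thesis using m[OF w] ab by simp
  qed
  have "Cauchy y"
  proof (rule metric_CauchyI)
    fix e :: real assume e: "0 < e"
    obtain N :: nat where N: "4 / e\<^sup>2 < N" using reals_Archimedean2 by blast
    have "dist (y i) (y j) < e" if "i \<ge> N" "j \<ge> N" for i j
    proof -
      have "1 / Suc i \<le> 1 / Suc N" "1 / Suc j \<le> 1 / Suc N"
        using that by (auto simp: frac_le)
      then have "(norm (y i - y j))\<^sup>2 \<le> 4 / Suc N"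
        using close[OF yM yM less_imp_le[OF y] less_imp_le[OF y], of i j] by simp
      also have "\<dots> < e\<^sup>2" using N e by (simp add: field_simps add_strict_increasing)
      finally show ?thesis using e by (simp add: dist_norm power2_less_imp_less)
    qed
    then show "\<exists>N. \<forall>i\<ge>N. \<forall>j\<ge>N. dist (y i) (y j) < e" by blast
  qed
  then obtain z where lim: "y \<longlonglongrightarrow> z" using convergent_eq_Cauchy by (metis convergent_def)
  have zM: "z \<in> M" using closed_sequentially[OF M(1)] yM lim by blast
  have "(\<lambda>n. f (y n - z)) \<longlonglongrightarrow> 0"
  proof (rule Lim_null_comparison)
    show "\<forall>\<^sub>F n in sequentially. norm (f (y n - z)) \<le> K * norm (y n - z)"
      using bound yM zM M(2) by (simp add: subspace_diff)
    show "(\<lambda>n. K * norm (y n - z)) \<longlonglongrightarrow> 0"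
      using tendsto_mult[OF tendsto_const[of K] tendsto_norm[OF LIM_zero[OF lim]]] by simp
  qed
  moreover have "f (y n - z) = f (y n) - f z" for n
    using add[OF yM[of n], of "-1 *\<^sub>R z"] scale[OF zM, of "-1"] zM M(2) by (simp add: subspace_neg)
  ultimately have "(\<lambda>n. f (y n)) \<longlonglongrightarrow> f z" by (simp add: LIM_zero_iff)
  then have "(\<lambda>n. \<Phi> (y n)) \<longlonglongrightarrow> \<Phi> z" unfolding \<Phi>_def
    by (intro tendsto_intros lim)
  moreover have "(\<lambda>n. m + 1 / Suc n) \<longlonglongrightarrow> m + 0"
    by (intro tendsto_intros LIMSEQ_Suc[OF lim_1_over_n])
  ultimately have "\<Phi> z \<le> m + 0"
    by (intro LIMSEQ_le) (use y less_imp_le in blast)+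
  then have zmin: "\<Phi> z \<le> \<Phi> (z + r *\<^sub>R h)" if "h \<in> M" for h r
    using m[of "z + r *\<^sub>R h"] that zM M(2) by (simp add: subspace_add subspace_scale)
  have "f h = inner h z" if h: "h \<in> M" for h
  proof -
    have q: "0 \<le> 2 * r * (inner h z - f h) + r\<^sup>2 * (norm h)\<^sup>2" for r
    proof -
      have "(norm (z + r *\<^sub>R h))\<^sup>2 = (norm z)\<^sup>2 + 2 * r * inner h z + r\<^sup>2 * (norm h)\<^sup>2"
        unfolding power2_norm_eq_inner
        by (simp add: inner_add inner_commute power2_eq_square algebra_simps)
      moreover have "f (z + r *\<^sub>R h) = f z + r * f h"
        using add[OF zM, of "r *\<^sub>R h"] scale[OF h, of r] h M(2) by (simp add: subspace_scale)
      ultimately show ?thesis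
        using zmin[OF h, of r] by (simp add: \<Phi>_def algebra_simps)
    qed
    \<comment> \<open>A quadratic polynomial without constant term is nonnegative, so its linear coefficient vanishes.\<close>
    define d where "d = inner h z - f h"
    define s where "s = (norm h)\<^sup>2 + 1"
    have s: "s > 0" by (simp add: s_def add_nonneg_pos)
    have "0 \<le> 2 * (- d / s) * d + (- d / s)\<^sup>2 * (norm h)\<^sup>2" using q d_def by blast
    also have "\<dots> \<le> 2 * (- d / s) * d + (- d / s)\<^sup>2 * s"
      by (simp add: s_def mult_left_mono)
    also have "\<dots> = - (d\<^sup>2 / s)" using s by (simp add: power2_eq_square field_simps)
    finally have "d\<^sup>2 \<le> 0" using s by (simp add: divide_le_0_iff)
    then show ?thesis by (simp add: d_def)
  qed
  then show ?thesis using that zM by blast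
qed

text \<open>
  Zabreiko's lemma: a countably subadditive seminorm on a Banach space is continuous. By Baire's
  theorem some set \<open>{x. q x \<le> n}\<close> is dense in a ball. So every \<open>x\<close> can be approximated up to half its
  norm by some \<open>e\<close> with \<open>q e \<le> c \<parallel>x\<parallel>\<close>, and iterating this expands \<open>x\<close> into a series whose \<open>q\<close>-values
  form a geometric series.
\<close>

lemma zabreiko:
  fixes q :: "'a::banach \<Rightarrow> real"
  assumes tri: "\<And>x y. q (x + y) \<le> q x + q y"
    and hom: "\<And>r x. q (r *\<^sub>R x) = \<bar>r\<bar> * q x"
    and sub: "\<And>e. summable (\<lambda>n. norm (e n)) \<Longrightarrow> summable (\<lambda>n. q (e n)) \<Longrightarrow>
      q (suminf e) \<le> (\<Sum>n. q (e n))"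
  shows "\<exists>c\<ge>0. \<forall>x. q x \<le> c * norm x"
proof -
  have q0: "q 0 = 0" using hom[of 0 0] by simp
  have qneg: "q (- x) = q x" for x using hom[of "-1" x] by simp
  have qpos: "0 \<le> q x" for x using tri[of x "- x"] by (simp add: q0 qneg)
  define E where "E n = closure {x. q x \<le> real n}" for n :: nat
  have "\<exists>n. interior (E n) \<noteq> {}"
  proof (rule ccontr)
    assume "\<not> ?thesis"
    then have int: "euclidean interior_of (E n) = {}" for n
      by (simp add: euclidean_interior_of)
    have "euclidean interior_of \<Union>(range E) = {}"
    proof (rule Baire_category_alt)
      show "closedin euclidean T \<and> euclidean interior_of T = {}" if "T \<in> range E" for T
        using that int closed_closure by (auto simp: E_def)
    qed (auto simp: completely_metrizable_space_euclidean)
    moreover have "\<Union>(range E) = UNIV"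
    proof -
      have "x \<in> E (nat \<lceil>q x\<rceil>)" for x
        unfolding E_def by (rule subsetD[OF closure_subset]) (simp add: real_nat_ceiling_ge)
      then show ?thesis by auto
    qed
    ultimately show False by (simp add: euclidean_interior_of)
  qed
  then obtain n x0 r where r: "r > 0" and ball: "ball x0 r \<subseteq> E n"
    by (metis all_not_in_conv mem_interior)
  \<comment> \<open>The closure of a sublevel set is convex and symmetric, so the ball may be centred at the origin.\<close>
  have apx0: "\<exists>e. q e \<le> n \<and> norm (y - e) < d" if y: "norm y < r" and d: "d > 0" for y d
  proof -
    have "x0 + y \<in> E n" "x0 - y \<in> E n" using ball y by (auto simp: subset_iff dist_norm)
    then have "\<exists>a. q a \<le> n \<and> dist a (x0 + y) < d" "\<exists>b. q b \<le> n \<and> dist b (x0 - y) < d"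
      unfolding E_def closure_approachable using d by simp_all
    then obtain a b where a: "q a \<le> n" "dist a (x0 + y) < d" and b: "q b \<le> n" "dist b (x0 - y) < d"
      by (elim exE conjE)
    let ?e = "(1/2) *\<^sub>R (a + (- b))"
    have "q ?e = \<bar>1/2\<bar> * q (a + - b)" by (rule hom)
    moreover have "q (a + - b) \<le> q a + q b" using tri[of a "- b"] by (simp only: qneg)
    ultimately have "q ?e \<le> n" using a(1) b(1) by linarith
    moreover have "norm (y - ?e) < d"
    proof -
      have "y - ?e = (1/2) *\<^sub>R (2 *\<^sub>R y - (a + - b))"
        by (simp only: scaleR_diff_right scaleR_scaleR) simp
      also have "2 *\<^sub>R y - (a + - b) = (x0 + y - a) + (b - (x0 - y))"
        by (simp add: scaleR_2)
      finally have "y - ?e = (1/2) *\<^sub>R ((x0 + y - a) + (b - (x0 - y)))" .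
      then have "norm (y - ?e) \<le> (1/2) * (norm (x0 + y - a) + norm (b - (x0 - y)))"
        using norm_triangle_ineq[of "x0 + y - a" "b - (x0 - y)"] by (simp only: norm_scaleR) simp
      also have "\<dots> < d" using a b by (simp add: dist_norm norm_minus_commute)
      finally show ?thesis .
    qed
    ultimately show ?thesis by blast
  qed
  define c where "c = 2 * real n / r"
  have c0: "c \<ge> 0" using r by (simp add: c_def)
  have "\<exists>e. q e \<le> c * norm y \<and> norm (y - e) \<le> norm y / 2" for y
  proof (cases "y = 0")
    case True then show ?thesis by (intro exI[of _ 0]) (simp add: q0)
  next
    case False
    \<comment> \<open>Scaled by \<open>t\<close>, the vector \<open>y\<close> has norm \<open>r / 2\<close> and is approximated up to \<open>r / 4\<close>.\<close>
    define t where "t = r / (2 * norm y)"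
    have t: "t > 0" using r False by (simp add: t_def)
    have "norm (t *\<^sub>R y) < r" using t False r by (simp add: t_def)
    from apx0[OF this, of "r / 4"] r obtain e where e: "q e \<le> n" "norm (t *\<^sub>R y - e) < r / 4"
      by auto
    let ?e = "(1 / t) *\<^sub>R e"
    have "q ?e \<le> c * norm y"
      unfolding hom using e(1) t False r by (simp add: t_def c_def field_simps)
    moreover have "norm (y - ?e) \<le> norm y / 2"
    proof -
      have "y - ?e = (1 / t) *\<^sub>R (t *\<^sub>R y - e)" using t by (simp add: scaleR_diff_right)
      then have "norm (y - ?e) = norm (t *\<^sub>R y - e) / t" using t by simp
      also have "\<dots> \<le> (r / 4) / t" using e(2) t by (intro divide_right_mono) auto
      also have "\<dots> = norm y / 2" using r by (simp add: t_def)
      finally show ?thesis .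
    qed
    ultimately show ?thesis by blast
  qed
  then obtain \<phi> where \<phi>: "\<And>y. q (\<phi> y) \<le> c * norm y" "\<And>y. norm (y - \<phi> y) \<le> norm y / 2"
    by metis
  have "q x \<le> 2 * c * norm x" for x
  proof -
    define u where "u = rec_nat x (\<lambda>_ y. y - \<phi> y)"
    have u: "u 0 = x" "\<And>k. u (Suc k) = u k - \<phi> (u k)" by (simp_all add: u_def)
    have nu: "norm (u k) \<le> norm x * (1/2) ^ k" for k
    proof (induction k)
      case (Suc k) then show ?case using \<phi>(2)[of "u k"] by (simp add: u)
    qed (simp add: u)
    define e where "e k = \<phi> (u k)" for k
    have geo: "summable (\<lambda>k. a * (1/2::real) ^ k)" for a
      by (intro summable_mult summable_geometric) simp
    have ne: "norm (e k) \<le> 2 * norm x * (1/2) ^ k" for k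
    proof -
      have "norm (e k) \<le> norm (u k) + norm (u k - e k)"
        using norm_triangle_sub[of "e k" "u k"] by (simp add: norm_minus_commute)
      then show ?thesis using nu[of k] \<phi>(2)[of "u k"] norm_ge_zero[of "u k"]
        unfolding e_def by argo
    qed
    have qe: "q (e k) \<le> c * norm x * (1/2) ^ k" for k
      using \<phi>(1)[of "u k"] mult_left_mono[OF nu[of k] c0] by (simp add: e_def)
    have se: "summable (\<lambda>k. norm (e k))"
      by (rule summable_comparison_test'[OF geo]) (use ne in auto)
    have sq: "summable (\<lambda>k. q (e k))"
      by (rule summable_comparison_test'[OF geo]) (use qe qpos in auto)
    have part: "(\<Sum>k<j. e k) = x - u j" for j
      by (induction j) (auto simp: u e_def)
    have "u \<longlonglongrightarrow> 0"
    proof (rule Lim_null_comparison)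
      show "\<forall>\<^sub>F k in sequentially. norm (u k) \<le> norm x * (1/2) ^ k" using nu by simp
      show "(\<lambda>k. norm x * (1/2) ^ k) \<longlonglongrightarrow> 0"
        by (rule summable_LIMSEQ_zero[OF geo])
    qed
    then have "(\<lambda>j. x - u j) \<longlonglongrightarrow> x - 0" by (intro tendsto_intros)
    then have "e sums x" by (simp add: sums_def part)
    then have "q x \<le> (\<Sum>k. q (e k))" using sub[OF se sq] by (simp only: sums_unique[symmetric])
    also have "\<dots> \<le> (\<Sum>k. c * norm x * (1/2) ^ k)" by (rule suminf_le[OF qe sq geo])
    also have "\<dots> = 2 * c * norm x"
      by (subst suminf_mult) (auto simp: suminf_geometric intro!: summable_geometric)
    finally show ?thesis .
  qed
  then show ?thesis using c0 by (intro exI[of _ "2 * c"]) auto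
qed

lemma csubspace_imp_subspace: "csubspace V \<Longrightarrow> subspace V"
  unfolding csubspace_def subspace_def by (metis scaleC_of_real)

lemma csubspace_scaleC: "csubspace V \<Longrightarrow> x \<in> V \<Longrightarrow> a *\<^sub>C x \<in> V"
  by (simp add: csubspace_def)

text \<open>
  The projection \<open>P\<close> onto \<open>V\<close> along \<open>W\<close> is bounded by Zabreiko's lemma for \<open>\<parallel>P x\<parallel>\<close>: if
  \<open>\<Sum>e\<^sub>n\<close> and \<open>\<Sum>P e\<^sub>n\<close> converge absolutely, then \<open>\<Sum>P e\<^sub>n \<in> V\<close> and \<open>\<Sum>(e\<^sub>n - P e\<^sub>n) \<in> W\<close> by closedness.
\<close>

lemma complementary_bounded:
  fixes V W :: "'a::complex_banach set"
  assumes cl: "closed V" "closed W" and comp: "complementary V W"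
  obtains c where "c \<ge> 0" "\<And>v w. v \<in> V \<Longrightarrow> w \<in> W \<Longrightarrow> norm v \<le> c * norm (v + w)"
proof -
  have sV: "subspace V" and sW: "subspace W" and VW: "V \<inter> W = {0}"
    using comp by (auto simp: complementary_def csubspace_imp_subspace)
  have ex: "\<exists>v. v \<in> V \<and> x - v \<in> W" for x
    using comp unfolding complementary_def by (metis add_diff_cancel_left')
  have uniq: "v = v'" if "v \<in> V" "x - v \<in> W" "v' \<in> V" "x - v' \<in> W" for v v' x
  proof -
    have "v - v' \<in> V" using that sV by (simp add: subspace_diff)
    moreover have "(x - v') - (x - v) \<in> W" using subspace_diff[OF sW] that by blast
    then have "v - v' \<in> W" by simp
    ultimately have "v - v' \<in> V \<inter> W" by blast
    then show ?thesis unfolding VW by simp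
  qed
  define P where "P x = (SOME v. v \<in> V \<and> x - v \<in> W)" for x
  have P: "P x \<in> V" "x - P x \<in> W" for x
    using someI_ex[OF ex[of x]] by (auto simp: P_def)
  have Padd: "P (x + y) = P x + P y" for x y
  proof (rule uniq[OF P])
    have "x + y - (P x + P y) = (x - P x) + (y - P y)" by simp
    then show "x + y - (P x + P y) \<in> W" using subspace_add[OF sW P(2) P(2)] by metis
  qed (simp add: P subspace_add[OF sV])
  have Pscale: "P (r *\<^sub>R x) = r *\<^sub>R P x" for r x
  proof (rule uniq[OF P])
    show "r *\<^sub>R x - r *\<^sub>R P x \<in> W"
      using subspace_scale[OF sW P(2)] by (metis scaleR_diff_right)
  qed (simp add: P subspace_scale[OF sV])
  have "\<exists>c\<ge>0. \<forall>x. norm (P x) \<le> c * norm x"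
  proof (rule zabreiko)
    show "norm (P (x + y)) \<le> norm (P x) + norm (P y)" for x y
      by (simp add: Padd norm_triangle_ineq)
    show "norm (P (r *\<^sub>R x)) = \<bar>r\<bar> * norm (P x)" for r x by (simp add: Pscale)
    fix e :: "nat \<Rightarrow> 'a"
    assume e: "summable (\<lambda>n. norm (e n))" and Pe: "summable (\<lambda>n. norm (P (e n)))"
    have se: "e sums suminf e" and sP: "(\<lambda>n. P (e n)) sums (\<Sum>n. P (e n))"
      using summable_norm_cancel[OF e] summable_norm_cancel[OF Pe] by (simp_all add: summable_sums)
    have "(\<Sum>n. P (e n)) \<in> V"
      by (rule closed_sequentially[OF cl(1) _ sP[unfolded sums_def]])
        (auto intro!: subspace_sum[OF sV] P)
    moreover have "suminf e - (\<Sum>n. P (e n)) \<in> W"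
      by (rule closed_sequentially[OF cl(2) _ sums_diff[OF se sP, unfolded sums_def]])
        (auto intro!: subspace_sum[OF sW] P)
    ultimately have "P (suminf e) = (\<Sum>n. P (e n))"
      using uniq P by blast
    then show "norm (P (suminf e)) \<le> (\<Sum>n. norm (P (e n)))"
      using summable_norm[OF Pe] by simp
  qed
  then obtain c where c: "c \<ge> 0" "\<And>x. norm (P x) \<le> c * norm x" by blast
  have "norm v \<le> c * norm (v + w)" if "v \<in> V" "w \<in> W" for v w
    using c(2)[of "v + w"] uniq[of v "v + w" "P (v + w)"] P that by simp
  then show ?thesis by (rule that[OF c(1)])
qed

section \<open>Resolvents\<close>

lemma linear_operator_onD:
  assumes "linear_operator_on V S"
  shows "csubspace (op_dom S)" "op_dom S \<subseteq> V" "x \<in> op_dom S \<Longrightarrow> op_app S x \<in> V"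
    "x \<in> op_dom S \<Longrightarrow> y \<in> op_dom S \<Longrightarrow> op_app S (x + y) = op_app S x + op_app S y"
    "x \<in> op_dom S \<Longrightarrow> op_app S (a *\<^sub>C x) = a *\<^sub>C op_app S x"
  using assms by (auto simp: linear_operator_on_def)

lemma csubspace_diff: "csubspace V \<Longrightarrow> x \<in> V \<Longrightarrow> y \<in> V \<Longrightarrow> x - y \<in> V"
  using csubspace_imp_subspace subspace_diff by blast

lemma csubspace_add: "csubspace V \<Longrightarrow> x \<in> V \<Longrightarrow> y \<in> V \<Longrightarrow> x + y \<in> V"
  by (simp add: csubspace_def)

lemma csubspace_zero: "csubspace V \<Longrightarrow> 0 \<in> V"
  by (simp add: csubspace_def)

lemma linear_operator_on_diff:
  assumes "linear_operator_on V S" "x \<in> op_dom S" "y \<in> op_dom S"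
  shows "op_app S (x - y) = op_app S x - op_app S y"
proof -
  have "x - y \<in> op_dom S" using assms linear_operator_onD(1) csubspace_diff by blast
  then have "op_app S (x - y + y) = op_app S (x - y) + op_app S y"
    using linear_operator_onD(4)[OF assms(1)] assms(3) by blast
  then show ?thesis by simp
qed

lemma resolvent_in_dom:
  "z \<in> resolvent_set_on V S \<Longrightarrow> y \<in> V \<Longrightarrow> resolvent S z y \<in> op_dom S"
  unfolding resolvent_def by (rule inv_into_into) (auto simp: resolvent_set_on_def bij_betw_def)

lemma resolvent_right:
  assumes "z \<in> resolvent_set_on V S" "y \<in> V"
  shows "op_app S (resolvent S z y) - z *\<^sub>C resolvent S z y = y"
proof -
  have "y \<in> (\<lambda>x. op_app S x - z *\<^sub>C x) ` op_dom S"
    using assms by (auto simp: resolvent_set_on_def bij_betw_def)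
  from f_inv_into_f[OF this] show ?thesis unfolding resolvent_def .
qed

lemma resolvent_left:
  "z \<in> resolvent_set_on V S \<Longrightarrow> x \<in> op_dom S \<Longrightarrow> resolvent S z (op_app S x - z *\<^sub>C x) = x"
  unfolding resolvent_def resolvent_set_on_def bij_betw_def
  by (auto intro!: inv_into_f_eq)

lemma resolvent_eqI:
  "z \<in> resolvent_set_on V S \<Longrightarrow> x \<in> op_dom S \<Longrightarrow> op_app S x - z *\<^sub>C x = y \<Longrightarrow>
    resolvent S z y = x"
  using resolvent_left by blast

lemma op_app_resolvent:
  "z \<in> resolvent_set_on V S \<Longrightarrow> y \<in> V \<Longrightarrow> op_app S (resolvent S z y) = y + z *\<^sub>C resolvent S z y"
  using resolvent_right[of z V S y] by (simp add: algebra_simps)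

lemma resolvent_add:
  assumes S: "linear_operator_on V S" and z: "z \<in> resolvent_set_on V S" and y: "x \<in> V" "y \<in> V"
  shows "resolvent S z (x + y) = resolvent S z x + resolvent S z y"
  using y resolvent_in_dom[OF z] linear_operator_onD[OF S]
  by (intro resolvent_eqI[OF z])
    (auto simp: csubspace_add op_app_resolvent[OF z] scaleC_add_right)

lemma resolvent_scaleC:
  assumes S: "linear_operator_on V S" and z: "z \<in> resolvent_set_on V S" and y: "y \<in> V"
  shows "resolvent S z (a *\<^sub>C y) = a *\<^sub>C resolvent S z y"
  using y resolvent_in_dom[OF z] linear_operator_onD[OF S]
  by (intro resolvent_eqI[OF z])
    (auto simp: csubspace_scaleC op_app_resolvent[OF z] scaleC_add_right scaleC_left_commute)

lemma resolvent_diff: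
  assumes S: "linear_operator_on V S" and z: "z \<in> resolvent_set_on V S" and y: "x \<in> V" "y \<in> V"
  shows "resolvent S z (x - y) = resolvent S z x - resolvent S z y"
  using y resolvent_in_dom[OF z] linear_operator_onD[OF S]
  by (intro resolvent_eqI[OF z])
    (auto simp: csubspace_diff op_app_resolvent[OF z] scaleC_diff_right
      linear_operator_on_diff[OF S])

lemma resolvent_norm_le:
  assumes "z \<in> resolvent_set_on V S" "y \<in> V"
    and "\<And>x. x \<in> op_dom S \<Longrightarrow> norm x \<le> K * norm (op_app S x - z *\<^sub>C x)"
  shows "norm (resolvent S z y) \<le> K * norm y"
  using assms(3)[OF resolvent_in_dom[OF assms(1,2)]] by (simp add: resolvent_right[OF assms(1,2)])

lemma norm_le_of_resolvent:
  assumes "linear_operator_on V S" "z \<in> resolvent_set_on V S" "x \<in> op_dom S"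
    and "\<And>y. y \<in> V \<Longrightarrow> norm (resolvent S z y) \<le> K * norm y"
  shows "norm x \<le> K * norm (op_app S x - z *\<^sub>C x)"
proof -
  have "op_app S x - z *\<^sub>C x \<in> V"
    using assms(2,3) by (auto simp: resolvent_set_on_def bij_betw_def)
  from assms(4)[OF this] show ?thesis by (simp add: resolvent_left[OF assms(2,3)])
qed

lemma resolvent_identity:
  assumes S: "linear_operator_on V S" and z: "z \<in> resolvent_set_on V S"
    and w: "w \<in> resolvent_set_on V S" and y: "y \<in> V"
  shows "resolvent S z y - resolvent S w y = (z - w) *\<^sub>C resolvent S z (resolvent S w y)"
proof -
  let ?u = "resolvent S w y"
  have u: "?u \<in> op_dom S" by (rule resolvent_in_dom[OF w y])
  then have uV: "?u \<in> V" using linear_operator_onD(2)[OF S] by blast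
  have shift: "op_app S ?u - z *\<^sub>C ?u = y + (w - z) *\<^sub>C ?u"
    by (simp add: op_app_resolvent[OF w y] scaleC_diff_left)
  have u'V: "(w - z) *\<^sub>C ?u \<in> V"
    using csubspace_scaleC[OF linear_operator_onD(1)[OF S] u] linear_operator_onD(2)[OF S] by blast
  have "?u = resolvent S z (y + (w - z) *\<^sub>C ?u)"
    using resolvent_left[OF z u] by (simp add: shift)
  also have "\<dots> = resolvent S z y + (w - z) *\<^sub>C resolvent S z ?u"
    by (simp add: resolvent_add[OF S z y u'V] resolvent_scaleC[OF S z uV])
  finally show ?thesis by (simp add: scaleC_diff_left algebra_simps)
qed

lemma resolvent_commute:
  assumes S: "linear_operator_on V S" and z: "z \<in> resolvent_set_on V S"
    and w: "w \<in> resolvent_set_on V S" and y: "y \<in> V"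
  shows "resolvent S z (resolvent S w y) = resolvent S w (resolvent S z y)"
proof (cases "z = w")
  case False
  have "(z - w) *\<^sub>C resolvent S z (resolvent S w y) = (z - w) *\<^sub>C resolvent S w (resolvent S z y)"
    using resolvent_identity[OF S z w y] resolvent_identity[OF S w z y]
      scaleC_minus_left[of "z - w" "resolvent S w (resolvent S z y)"]
    by (metis minus_diff_eq minus_equation_iff)
  then have "(1 / (z - w)) *\<^sub>C (z - w) *\<^sub>C resolvent S z (resolvent S w y)
      = (1 / (z - w)) *\<^sub>C (z - w) *\<^sub>C resolvent S w (resolvent S z y)" by simp
  then show ?thesis using False by (simp add: scaleC_scaleC)
qed simp

lemma bounded_linear_resolvent:
  assumes S: "linear_operator_on UNIV S" and z: "z \<in> resolvent_set_on UNIV S"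
  shows "bounded_linear (resolvent S z)"
proof -
  obtain K where "\<And>x. x \<in> op_dom S \<Longrightarrow> norm x \<le> K * norm (op_app S x - z *\<^sub>C x)"
    using z by (auto simp: resolvent_set_on_def)
  from resolvent_norm_le[OF z _ this] show ?thesis
    by (intro bounded_linear_intro[of _ K])
      (auto simp: resolvent_add[OF S z] scaleR_eq_scaleC resolvent_scaleC[OF S z] mult.commute
        simp del: scaleC_complex)
qed

lemma resolvent_lipschitz:
  assumes S: "linear_operator_on V S" and z: "z \<in> resolvent_set_on V S"
    and w: "w \<in> resolvent_set_on V S" and y: "y \<in> V" and K: "0 \<le> K"
    and Kz: "\<And>x. x \<in> op_dom S \<Longrightarrow> norm x \<le> K * norm (op_app S x - z *\<^sub>C x)"
    and Kw: "\<And>x. x \<in> op_dom S \<Longrightarrow> norm x \<le> K * norm (op_app S x - w *\<^sub>C x)"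
  shows "norm (resolvent S z y - resolvent S w y) \<le> K\<^sup>2 * norm y * cmod (z - w)"
proof -
  have "resolvent S w y \<in> V" using resolvent_in_dom[OF w y] linear_operator_onD(2)[OF S] by blast
  then have "norm (resolvent S z (resolvent S w y)) \<le> K * norm (resolvent S w y)"
    using resolvent_norm_le[OF z _ Kz] by blast
  also have "\<dots> \<le> K * (K * norm y)"
    using resolvent_norm_le[OF w y Kw] K by (simp add: mult_left_mono)
  finally have "norm (resolvent S z (resolvent S w y)) \<le> K\<^sup>2 * norm y"
    by (simp add: power2_eq_square mult.assoc)
  then show ?thesis
    by (simp add: resolvent_identity[OF S z w y] norm_scaleC mult.commute[of "cmod (z - w)"] mult_right_mono)
qed

lemma continuous_on_resolvent:
  assumes S: "linear_operator_on V S" and U: "U \<subseteq> resolvent_set_on V S" and y: "y \<in> V" and K: "0 \<le> K"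
    and bound: "\<And>z x. z \<in> U \<Longrightarrow> x \<in> op_dom S \<Longrightarrow> norm x \<le> K * norm (op_app S x - z *\<^sub>C x)"
  shows "continuous_on U (\<lambda>z. resolvent S z y)"
proof (rule lipschitz_on_continuous_on)
  show "lipschitz_on (K\<^sup>2 * norm y) U (\<lambda>z. resolvent S z y)"
    unfolding lipschitz_on_def dist_norm
    using resolvent_lipschitz[OF S _ _ y K bound bound] U by (auto simp: subset_iff)
qed

text \<open>
  Holomorphy is stated weakly, so that the theory of scalar holomorphic functions applies. The derivative
  is taken within \<open>U\<close> in order to cover boundary points of a closed half-plane.
\<close>

lemma has_field_derivative_cinner_resolvent:
  fixes S :: "'a::complex_inner operator"
  assumes S: "linear_operator_on V S" and U: "U \<subseteq> resolvent_set_on V S" and y: "y \<in> V" and K: "0 \<le> K"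
    and bound: "\<And>z x. z \<in> U \<Longrightarrow> x \<in> op_dom S \<Longrightarrow> norm x \<le> K * norm (op_app S x - z *\<^sub>C x)"
    and w: "w \<in> U"
  shows "((\<lambda>z. cinner (resolvent S z y) v) has_field_derivative
    cinner (resolvent S w (resolvent S w y)) v) (at w within U)"
proof -
  have wr: "w \<in> resolvent_set_on V S" using U w by blast
  have uV: "resolvent S w y \<in> V"
    using resolvent_in_dom[OF wr y] linear_operator_onD(2)[OF S] by blast
  have "((\<lambda>z. resolvent S z (resolvent S w y)) \<longlongrightarrow> resolvent S w (resolvent S w y)) (at w within U)"
    using continuous_on_resolvent[OF S U uV K bound] w by (auto simp: continuous_on_def)
  then have lim: "((\<lambda>z. cinner (resolvent S z (resolvent S w y)) v)
      \<longlongrightarrow> cinner (resolvent S w (resolvent S w y)) v) (at w within U)"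
    by (rule bounded_linear.tendsto[OF bounded_linear_cinner_left])
  show ?thesis unfolding has_field_derivative_iff
  proof (rule Lim_transform_eventually[OF lim])
    show "\<forall>\<^sub>F z in at w within U. cinner (resolvent S z (resolvent S w y)) v =
        (cinner (resolvent S z y) v - cinner (resolvent S w y) v) / (z - w)"
      unfolding eventually_at_filter
    proof (intro always_eventually allI impI)
      fix z assume "z \<noteq> w" "z \<in> U"
      then show "cinner (resolvent S z (resolvent S w y)) v =
          (cinner (resolvent S z y) v - cinner (resolvent S w y) v) / (z - w)"
        using U by (simp add: cinner_diff_left[symmetric] resolvent_identity[OF S _ wr y]
            cinner_scaleC_left subset_iff)
    qed
  qed
qed

text \<open>
  With \<open>g = L x\<close> the equation \<open>L' x = f\<close> becomes \<open>g = f - (L' - L) (L\<inverse> g)\<close>, a fixed point problem for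
  a contraction with constant \<open>q\<close>.
\<close>

lemma perturbed_bijection:
  fixes L L' :: "'a::real_vector \<Rightarrow> 'b::banach"
  assumes D: "subspace D"
    and L: "\<And>x y. x \<in> D \<Longrightarrow> y \<in> D \<Longrightarrow> L (x - y) = L x - L y"
    and L': "\<And>x y. x \<in> D \<Longrightarrow> y \<in> D \<Longrightarrow> L' (x - y) = L' x - L' y"
    and bij: "bij_betw L D UNIV"
    and q: "0 \<le> q" "q < 1" and le: "\<And>x. x \<in> D \<Longrightarrow> norm (L' x - L x) \<le> q * norm (L x)"
  shows "bij_betw L' D UNIV" and "\<And>x. x \<in> D \<Longrightarrow> norm (L x) \<le> norm (L' x) / (1 - q)"
proof -
  show bound: "norm (L x) \<le> norm (L' x) / (1 - q)" if x: "x \<in> D" for x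
  proof -
    have "norm (L x) \<le> norm (L' x) + norm (L' x - L x)"
      using norm_triangle_sub[of "L x" "L' x"] by (simp add: norm_minus_commute)
    then have "norm (L x) * (1 - q) \<le> norm (L' x)" using le[OF x] by (simp add: algebra_simps)
    then show ?thesis using q by (simp add: field_simps)
  qed
  have inj: "inj_on L' D"
  proof (rule inj_onI)
    fix x y assume xy: "x \<in> D" "y \<in> D" "L' x = L' y"
    have "norm (L (x - y)) \<le> norm (L' (x - y)) / (1 - q)"
      using bound D xy by (simp add: subspace_diff)
    then have "L x = L y" using xy by (simp add: L L')
    then show "x = y" using bij xy by (auto simp: bij_betw_def inj_on_def)
  qed
  have surj: "\<exists>x\<in>D. L' x = f" for f
  proof -
    define G where "G = inv_into D L"
    have GD: "G g \<in> D" and LG: "L (G g) = g" for g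
      using bij by (auto simp: G_def bij_betw_def inv_into_into f_inv_into_f)
    define \<Phi> where "\<Phi> g = f - (L' (G g) - L (G g))" for g
    have "dist (\<Phi> g) (\<Phi> g') \<le> q * dist g g'" for g g'
    proof -
      have "\<Phi> g - \<Phi> g' = - (L' (G g - G g') - L (G g - G g'))"
        using GD by (simp add: \<Phi>_def L L')
      then have "dist (\<Phi> g) (\<Phi> g') = norm (L' (G g - G g') - L (G g - G g'))"
        by (simp add: dist_norm norm_minus_commute)
      also have "\<dots> \<le> q * norm (L (G g - G g'))" using le GD D by (simp add: subspace_diff)
      finally show ?thesis using GD by (simp add: L LG dist_norm)
    qed
    then obtain g where "\<Phi> g = g" using banach_fix_type[OF q, of \<Phi>] by blast
    then have "L' (G g) = f" by (simp add: \<Phi>_def LG algebra_simps)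
    then show ?thesis using GD by blast
  qed
  show "bij_betw L' D UNIV" using inj surj by (auto simp: bij_betw_def) (metis image_eqI)
qed

text \<open>
  The resolvent set is open, with a radius that depends only on the norm of the resolvent. A uniform
  bound along a line therefore propagates along that line and to a strip around it.
\<close>

lemma resolvent_set_neighbour:
  fixes S :: "'a::complex_banach operator"
  assumes S: "linear_operator_on UNIV S" and w: "w \<in> resolvent_set_on UNIV S" and K: "0 \<le> K"
    and bound: "\<And>x. x \<in> op_dom S \<Longrightarrow> norm x \<le> K * norm (op_app S x - w *\<^sub>C x)"
    and z: "cmod (z - w) * K \<le> 1/2"
  shows "z \<in> resolvent_set_on UNIV S"
    and "x \<in> op_dom S \<Longrightarrow> norm x \<le> 2 * K * norm (op_app S x - z *\<^sub>C x)"
proof -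
  let ?L = "\<lambda>x. op_app S x - w *\<^sub>C x" and ?L' = "\<lambda>x. op_app S x - z *\<^sub>C x"
  have D: "subspace (op_dom S)" using csubspace_imp_subspace linear_operator_onD(1)[OF S] .
  have le: "norm (?L' x - ?L x) \<le> 1/2 * norm (?L x)" if "x \<in> op_dom S" for x
  proof -
    have "?L' x - ?L x = (w - z) *\<^sub>C x" by (simp add: scaleC_diff_left)
    then have "norm (?L' x - ?L x) = cmod (z - w) * norm x" by (simp add: norm_scaleC norm_minus_commute)
    also have "\<dots> \<le> cmod (z - w) * (K * norm (?L x))" using bound[OF that] by (simp add: mult_left_mono)
    also have "\<dots> \<le> 1/2 * norm (?L x)"
      using mult_right_mono[OF z, of "norm (?L x)"] by (simp add: mult.assoc)
    finally show ?thesis .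
  qed
  have lin: "op_app S (x - y) - v *\<^sub>C (x - y) = op_app S x - v *\<^sub>C x - (op_app S y - v *\<^sub>C y)"
    if "x \<in> op_dom S" "y \<in> op_dom S" for x y v
    using linear_operator_on_diff[OF S that] by (simp add: scaleC_diff_right)
  have bij: "bij_betw ?L (op_dom S) UNIV" using w by (simp add: resolvent_set_on_def)
  note P = perturbed_bijection[OF D lin lin bij _ _ le, simplified]
  have N: "norm x \<le> 2 * K * norm (?L' x)" if x: "x \<in> op_dom S" for x
    using order_trans[OF bound[OF x] mult_left_mono[OF P(2)[OF x] K]] by (simp add: mult_ac)
  then show "x \<in> op_dom S \<Longrightarrow> norm x \<le> 2 * K * norm (op_app S x - z *\<^sub>C x)" .
  show "z \<in> resolvent_set_on UNIV S"
    unfolding resolvent_set_on_def using P(1) N by blast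
qed

section \<open>Principal value integrals over the imaginary axis\<close>

abbreviation imag_integral :: "real \<Rightarrow> (complex \<Rightarrow> 'a::complex_banach) \<Rightarrow> 'a" where
  "imag_integral \<rho> f \<equiv> integral {-\<rho>..\<rho>} (\<lambda>t. \<i> *\<^sub>C f (\<i> * complex_of_real t))"

lemma pv_integral_unique:
  "has_pv_integral_imag_axis f I \<Longrightarrow> has_pv_integral_imag_axis f J \<Longrightarrow> I = J"
  unfolding has_pv_integral_imag_axis_def
  by (meson tendsto_unique trivial_limit_at_top_linorder)

lemma pv_integral_add:
  assumes "has_pv_integral_imag_axis f I" "has_pv_integral_imag_axis g J"
  shows "has_pv_integral_imag_axis (\<lambda>z. f z + g z) (I + J)"
proof -
  have f: "(\<lambda>t. \<i> *\<^sub>C f (\<i> * complex_of_real t)) integrable_on {-\<rho>..\<rho>}"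
    and g: "(\<lambda>t. \<i> *\<^sub>C g (\<i> * complex_of_real t)) integrable_on {-\<rho>..\<rho>}" if "\<rho> > 0" for \<rho>
    using assms that by (auto simp: has_pv_integral_imag_axis_def)
  have "imag_integral \<rho> f + imag_integral \<rho> g = imag_integral \<rho> (\<lambda>z. f z + g z)" if "\<rho> > 0" for \<rho>
    using integral_add[OF f g] that by (simp add: scaleC_add_right)
  then have "\<forall>\<^sub>F \<rho> in at_top. imag_integral \<rho> f + imag_integral \<rho> g = imag_integral \<rho> (\<lambda>z. f z + g z)"
    using eventually_gt_at_top[of "0::real"] by (rule eventually_mono[rotated])
  moreover have "((\<lambda>\<rho>. imag_integral \<rho> f + imag_integral \<rho> g) \<longlongrightarrow> I + J) at_top"
    using assms by (intro tendsto_add) (auto simp: has_pv_integral_imag_axis_def)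
  ultimately show ?thesis
    using integrable_add[OF f g] unfolding has_pv_integral_imag_axis_def
    by (auto simp: scaleC_add_right intro: Lim_transform_eventually)
qed

lemma pv_integral_bounded_linear:
  assumes f: "has_pv_integral_imag_axis f I"
    and h: "bounded_linear h" and hi: "\<And>x. h (\<i> *\<^sub>C x) = \<i> *\<^sub>C h x"
  shows "has_pv_integral_imag_axis (\<lambda>z. h (f z)) (h I)"
proof -
  have int: "(\<lambda>t. \<i> *\<^sub>C f (\<i> * complex_of_real t)) integrable_on {-\<rho>..\<rho>}" if "\<rho> > 0" for \<rho>
    using f that by (auto simp: has_pv_integral_imag_axis_def)
  have int': "(\<lambda>t. \<i> *\<^sub>C h (f (\<i> * complex_of_real t))) integrable_on {-\<rho>..\<rho>}"
    and eq: "h (imag_integral \<rho> f) = imag_integral \<rho> (\<lambda>z. h (f z))" if "\<rho> > 0" for \<rho>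
    using integrable_linear[OF int[OF that] h] integral_linear[OF int[OF that] h]
    by (simp_all add: o_def hi)
  have "\<forall>\<^sub>F \<rho> in at_top. h (imag_integral \<rho> f) = imag_integral \<rho> (\<lambda>z. h (f z))"
    using eventually_gt_at_top[of "0::real"] eq by (rule eventually_mono)
  moreover have "((\<lambda>\<rho>. h (imag_integral \<rho> f)) \<longlongrightarrow> h I) at_top"
    using f by (intro bounded_linear.tendsto[OF h]) (auto simp: has_pv_integral_imag_axis_def)
  ultimately show ?thesis
    using int' unfolding has_pv_integral_imag_axis_def by (auto intro: Lim_transform_eventually)
qed

lemma pv_integral_scaleC:
  "has_pv_integral_imag_axis f I \<Longrightarrow> has_pv_integral_imag_axis (\<lambda>z. a *\<^sub>C f z) (a *\<^sub>C I)"
  by (rule pv_integral_bounded_linear) (simp_all add: bounded_linear_scaleC_right scaleC_left_commute)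

lemma pv_integral_diff:
  assumes "has_pv_integral_imag_axis f I" "has_pv_integral_imag_axis g J"
  shows "has_pv_integral_imag_axis (\<lambda>z. f z - g z) (I - J)"
  using pv_integral_add[OF assms(1) pv_integral_scaleC[OF assms(2), of "- 1"]] by simp

lemma pv_integral_transform:
  assumes "has_pv_integral_imag_axis f I"
    and "\<And>t. f (\<i> * complex_of_real t) = g (\<i> * complex_of_real t)"
  shows "has_pv_integral_imag_axis g I"
  using assms by (simp add: has_pv_integral_imag_axis_def)

lemma pv_integral_norm_le:
  assumes f: "has_pv_integral_imag_axis f I" and B: "\<And>\<rho>. \<rho> > 0 \<Longrightarrow> norm (imag_integral \<rho> f) \<le> B"
  shows "norm I \<le> B"
proof (rule tendsto_upperbound)
  show "((\<lambda>\<rho>. norm (imag_integral \<rho> f)) \<longlongrightarrow> norm I) at_top"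
    using f by (intro tendsto_norm) (auto simp: has_pv_integral_imag_axis_def)
  show "\<forall>\<^sub>F \<rho> in at_top. norm (imag_integral \<rho> f) \<le> B"
    using eventually_gt_at_top[of "0::real"] B by (rule eventually_mono)
qed simp

lemma tendsto_at_top_if_Cauchy:
  fixes f :: "real \<Rightarrow> 'a::banach"
  assumes "\<And>e. e > 0 \<Longrightarrow> \<exists>r. \<forall>x\<ge>r. \<forall>y\<ge>x. dist (f x) (f y) < e"
  obtains l where "(f \<longlongrightarrow> l) at_top"
proof -
  have "cauchy_filter (filtermap f at_top)"
    unfolding cauchy_filter_metric_filtermap
  proof (intro allI impI)
    fix e :: real assume "e > 0"
    then obtain r where r: "\<And>x y. x \<ge> r \<Longrightarrow> y \<ge> x \<Longrightarrow> dist (f x) (f y) < e" using assms by blast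
    have "dist (f x) (f y) < e" if "x \<ge> r" "y \<ge> r" for x y
      using r[of x y] r[of y x] that by (cases "x \<le> y") (auto simp: dist_commute)
    then show "\<exists>P. eventually P at_top \<and> (\<forall>x y. P x \<and> P y \<longrightarrow> dist (f x) (f y) < e)"
      using eventually_ge_at_top[of r] by blast
  qed
  then have "\<exists>l\<in>UNIV. filtermap f at_top \<le> nhds l"
    using complete_UNIV[where 'a='a] unfolding complete_uniform
    by (auto simp: filtermap_bot_iff)
  then show ?thesis using that by (auto simp: filterlim_def)
qed

text \<open>
  The integrands below are products of a resolvent, which decays away from \<open>0\<close>, and a rational function,
  which decays away from the imaginary part of its pole; hence the two bumps. The bound on the integral
  does not depend on the distance of their centres.
\<close>

lemma pv_integral_exists_dominated:
  fixes f :: "complex \<Rightarrow> 'a::complex_banach"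
  assumes cont: "continuous_on UNIV (\<lambda>t. f (\<i> * complex_of_real t))"
    and le: "\<And>t. norm (f (\<i> * complex_of_real t)) \<le> a / (1 + t\<^sup>2) + b / (1 + (t - s)\<^sup>2)"
    and ab: "a \<ge> 0" "b \<ge> 0"
  obtains I where "has_pv_integral_imag_axis f I" "norm I \<le> (a + b) * pi"
proof -
  define F where "F t = \<i> *\<^sub>C f (\<i> * complex_of_real t)" for t
  define g where "g t = a / (1 + t\<^sup>2) + b / (1 + (t - s)\<^sup>2)" for t
  define \<gamma> where "\<gamma> t = a * arctan t + b * arctan (t - s)" for t
  have contF: "continuous_on X F" for X
    unfolding F_def by (intro continuous_intros continuous_on_subset[OF cont]) auto
  have intF: "F integrable_on {x..y}" for x y by (rule integrable_continuous_real[OF contF])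
  have g: "(g has_integral (\<gamma> y - \<gamma> x)) {x..y}" if "x \<le> y" for x y
  proof (rule fundamental_theorem_of_calculus[OF that])
    show "(\<gamma> has_vector_derivative g t) (at t within {x..y})" for t
      unfolding \<gamma>_def g_def has_real_derivative_iff_has_vector_derivative[symmetric]
      by (auto intro!: derivative_eq_intros simp: power2_eq_square add_nonneg_eq_0_iff inverse_eq_divide)
  qed
  have leF: "norm (integral {x..y} F) \<le> \<gamma> y - \<gamma> x" if "x \<le> y" for x y
    using integral_norm_bound_integral[OF intF has_integral_integrable[OF g[OF that]]]
      le integral_unique[OF g[OF that]] by (simp add: F_def g_def norm_scaleC)
  have ext: "norm (integral {-y..y} F - integral {-x..x} F) \<le> (\<gamma> y - \<gamma> x) + (\<gamma> (-x) - \<gamma> (-y))"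
    if xy: "0 \<le> x" "x \<le> y" for x y
  proof -
    have "integral {-y..-x} F + integral {-x..y} F = integral {-y..y} F"
      using xy intF by (intro Henstock_Kurzweil_Integration.integral_combine) auto
    moreover have "integral {-x..x} F + integral {x..y} F = integral {-x..y} F"
      using xy intF by (intro Henstock_Kurzweil_Integration.integral_combine) auto
    ultimately have "integral {-y..y} F - integral {-x..x} F = integral {-y..-x} F + integral {x..y} F"
      by (metis add.assoc add_diff_cancel_left' add_diff_eq diff_add_eq)
    then have "norm (integral {-y..y} F - integral {-x..x} F) \<le> (\<gamma> (-x) - \<gamma> (-y)) + (\<gamma> y - \<gamma> x)"
      using xy by (simp only:) (intro order_trans[OF norm_triangle_ineq] add_mono leF, auto)
    then show ?thesis by simp
  qed
  define \<Gamma> where "\<Gamma> x = \<gamma> x - \<gamma> (- x)" for x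
  have \<Gamma>_lim: "(\<Gamma> \<longlongrightarrow> (a * (pi/2) + b * (pi/2)) - (a * (- (pi/2)) + b * (- (pi/2)))) at_top"
  proof -
    have s1: "filterlim (\<lambda>x::real. x - s) at_top at_top"
      by (rule filterlim_at_top_at_top[where Q="\<lambda>_. True" and P="\<lambda>_. True" and g="\<lambda>x. x + s"]) auto
    have s2: "filterlim (\<lambda>x::real. - x - s) at_bot at_top"
      unfolding filterlim_uminus_at_top[symmetric, of "\<lambda>x. - x - s"] filterlim_uminus_at_bot
      by (simp, rule filterlim_at_top_at_top[where Q="\<lambda>_. True" and P="\<lambda>_. True" and g="\<lambda>x. x - s"]) auto
    show ?thesis unfolding \<Gamma>_def \<gamma>_def
      by (intro tendsto_intros tendsto_arctan_at_top filterlim_compose[OF tendsto_arctan_at_top s1]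
          filterlim_compose[OF tendsto_arctan_at_bot s2]
          filterlim_compose[OF tendsto_arctan_at_bot filterlim_uminus_at_bot_at_top])
  qed
  obtain I where I: "((\<lambda>x. integral {-x..x} F) \<longlongrightarrow> I) at_top"
  proof (rule tendsto_at_top_if_Cauchy)
    fix e :: real assume e: "e > 0"
    let ?L = "(a * (pi/2) + b * (pi/2)) - (a * (- (pi/2)) + b * (- (pi/2)))"
    obtain r where r: "\<And>x. x \<ge> r \<Longrightarrow> dist (\<Gamma> x) ?L < e / 2"
      using tendstoD[OF \<Gamma>_lim, of "e/2"] e unfolding eventually_at_top_linorder by auto
    have "dist (integral {-x..x} F) (integral {-y..y} F) < e" if "x \<ge> max r 0" "y \<ge> x" for x y
    proof -
      have "dist (integral {-x..x} F) (integral {-y..y} F) \<le> \<Gamma> y - \<Gamma> x"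
        using ext[of x y] that by (simp add: dist_norm norm_minus_commute \<Gamma>_def)
      also have "\<dots> < e"
      proof -
        have "\<bar>\<Gamma> x - ?L\<bar> < e / 2" "\<bar>\<Gamma> y - ?L\<bar> < e / 2"
          using r[of x] r[of y] that unfolding dist_real_def by auto
        then show ?thesis by linarith
      qed
      finally show ?thesis .
    qed
    then show "\<exists>r. \<forall>x\<ge>r. \<forall>y\<ge>x. dist (integral {-x..x} F) (integral {-y..y} F) < e" by blast
  qed
  have pv: "has_pv_integral_imag_axis f I"
    unfolding has_pv_integral_imag_axis_def using I intF unfolding F_def[abs_def] by blast
  have "norm I \<le> (a + b) * pi"
  proof (rule pv_integral_norm_le[OF pv])
    fix \<rho> :: real assume "\<rho> > 0"
    then have "norm (imag_integral \<rho> f) \<le> \<gamma> \<rho> - \<gamma> (- \<rho>)"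
      using leF[of "-\<rho>" \<rho>] unfolding F_def[abs_def] by simp
    also have "\<dots> \<le> (a * (pi/2) + b * (pi/2)) - (a * (- (pi/2)) + b * (- (pi/2)))"
      unfolding \<gamma>_def using ab arctan_ubound arctan_lbound
      by (intro diff_mono add_mono mult_left_mono) (auto intro: less_imp_le)
    finally show "norm (imag_integral \<rho> f) \<le> (a + b) * pi" by (simp add: algebra_simps)
  qed
  with pv show ?thesis by (rule that)
qed

text \<open>
  The sign \<open>s\<close> treats poles in the left (\<open>s = 1\<close>) and in the right half-plane (\<open>s = - 1\<close>) together:
  \<open>s (z - \<mu>)\<close> stays in the right half-plane, so the principal branch of \<open>Ln (s (z - \<mu>))\<close> is a primitive,
  and only its arguments at the two ends contribute in the limit.
\<close>

lemma pv_integral_simple_pole: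
  assumes s: "s = 1 \<or> s = -1" and \<mu>: "s * Re \<mu> < 0"
  shows "has_pv_integral_imag_axis (\<lambda>z. 1 / (z - \<mu>)) (complex_of_real s * pi * \<i>)"
proof -
  let ?s = "complex_of_real s"
  have s2: "?s * ?s = 1" using s by auto
  define F where "F t = Ln (?s * (\<i> * complex_of_real t - \<mu>))" for t
  have re: "Re (?s * (\<i> * complex_of_real t - \<mu>)) > 0" for t using \<mu> by simp
  have nz: "\<i> * complex_of_real t - \<mu> \<noteq> 0" for t using re[of t] by auto
  have int: "((\<lambda>t. \<i> * (1 / (\<i> * complex_of_real t - \<mu>))) has_integral (F y - F x)) {x..y}"
    if "x \<le> y" for x y
  proof (rule fundamental_theorem_of_calculus[OF that])
    fix t
    have "((\<lambda>w. Ln (?s * (\<i> * w - \<mu>))) has_field_derivative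
        (?s * \<i>) / (?s * (\<i> * complex_of_real t - \<mu>))) (at (complex_of_real t))"
      using re[of t] nz[of t] s
      by (auto intro!: derivative_eq_intros simp: complex_nonpos_Reals_iff field_simps)
    moreover have "(?s * \<i>) / (?s * (\<i> * complex_of_real t - \<mu>)) = \<i> * (1 / (\<i> * complex_of_real t - \<mu>))"
      using s by auto
    ultimately show "(F has_vector_derivative \<i> * (1 / (\<i> * complex_of_real t - \<mu>))) (at t within {x..y})"
      unfolding F_def by (auto intro: has_vector_derivative_real_field has_vector_derivative_at_within)
  qed
  have F: "F y - F (- y) = Ln (?s * (\<i> - \<mu> / y)) - Ln (?s * (- \<i> - \<mu> / y))" if y: "y > 0" for y
  proof -
    have e: "?s * (\<i> * complex_of_real y - \<mu>) = complex_of_real y * (?s * (\<i> - \<mu> / y))"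
      "?s * (\<i> * complex_of_real (- y) - \<mu>) = complex_of_real y * (?s * (- \<i> - \<mu> / y))"
      using y by (auto simp: field_simps)
    have n: "?s * (\<i> - \<mu> / y) \<noteq> 0" "?s * (- \<i> - \<mu> / y) \<noteq> 0"
      using e nz[of y] nz[of "-y"] s by auto
    show ?thesis unfolding F_def e Ln_times_of_real[OF y n(1)] Ln_times_of_real[OF y n(2)] by simp
  qed
  have l0: "((\<lambda>y. \<mu> / complex_of_real y) \<longlongrightarrow> 0) at_top"
    using tendsto_mult[OF tendsto_const[of \<mu>]
        tendsto_of_real[OF tendsto_inverse_0_at_top[OF filterlim_ident[of at_top]]]]
    by (simp add: divide_inverse)
  have "((\<lambda>y::real. Ln (?s * (\<i> - \<mu> / y)) - Ln (?s * (- \<i> - \<mu> / y))) \<longlongrightarrow>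
      Ln (?s * (\<i> - 0)) - Ln (?s * (- \<i> - 0))) at_top"
    using s by (intro tendsto_intros l0) (auto simp: complex_nonpos_Reals_iff)
  moreover have "Ln (?s * (\<i> - 0)) - Ln (?s * (- \<i> - 0)) = ?s * pi * \<i>"
    using s by (auto simp: field_simps)
  ultimately have "((\<lambda>y::real. Ln (?s * (\<i> - \<mu> / y)) - Ln (?s * (- \<i> - \<mu> / y))) \<longlongrightarrow> ?s * pi * \<i>) at_top"
    by simp
  moreover have "\<forall>\<^sub>F y in at_top. Ln (?s * (\<i> - \<mu> / y)) - Ln (?s * (- \<i> - \<mu> / y)) =
      imag_integral y (\<lambda>z. 1 / (z - \<mu>))"
    using eventually_gt_at_top[of "0::real"]
  proof (rule eventually_mono)
    fix y :: real assume "y > 0"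
    then show "Ln (?s * (\<i> - \<mu> / y)) - Ln (?s * (- \<i> - \<mu> / y)) = imag_integral y (\<lambda>z. 1 / (z - \<mu>))"
      using integral_unique[OF int[of "-y" y]] F[of y] by simp
  qed
  ultimately have "((\<lambda>y. imag_integral y (\<lambda>z. 1 / (z - \<mu>))) \<longlongrightarrow> ?s * pi * \<i>) at_top"
    by (rule Lim_transform_eventually)
  moreover have "(\<lambda>t. \<i> *\<^sub>C (1 / (\<i> * complex_of_real t - \<mu>))) integrable_on {-\<rho>..\<rho>}" if "\<rho> > 0" for \<rho>
    using has_integral_integrable[OF int[of "-\<rho>" \<rho>]] that by simp
  ultimately show ?thesis unfolding has_pv_integral_imag_axis_def by blast
qed

section \<open>A criterion for dichotomy\<close>

lemma field_differentiable_transform_within_open: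
  assumes "f field_differentiable at z" "open U" "z \<in> U" "\<And>w. w \<in> U \<Longrightarrow> f w = g w"
  shows "g field_differentiable at z"
  using assms has_field_derivative_transform_within_open unfolding field_differentiable_def by blast

lemma resolvent_setI:
  assumes "\<And>y. y \<in> V \<Longrightarrow> Q y \<in> op_dom S"
    and "\<And>y. y \<in> V \<Longrightarrow> op_app S (Q y) - z *\<^sub>C Q y = y"
    and "\<And>u. u \<in> op_dom S \<Longrightarrow> op_app S u - z *\<^sub>C u \<in> V"
    and "\<And>u. u \<in> op_dom S \<Longrightarrow> Q (op_app S u - z *\<^sub>C u) = u"
    and "\<And>y. y \<in> V \<Longrightarrow> norm (Q y) \<le> K * norm y"
  shows "z \<in> resolvent_set_on V S"
proof -
  have "bij_betw (\<lambda>u. op_app S u - z *\<^sub>C u) (op_dom S) V"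
    by (rule bij_betwI[of _ _ _ Q]) (use assms in auto)
  moreover have "norm u \<le> K * norm (op_app S u - z *\<^sub>C u)" if "u \<in> op_dom S" for u
    using assms(5)[OF assms(3)[OF that]] assms(4)[OF that] by simp
  ultimately show ?thesis unfolding resolvent_set_on_def by blast
qed

text \<open>
  The decay of the resolvent on the imaginary axis is not enough for integrability. The uniform bound
  \<open>C\<close> on the truncated integrals takes its place.
\<close>

locale bisectorial_resolvent =
  fixes S :: "'a::complex_hilbert operator" and h K C :: real
  assumes dense: "densely_defined_on UNIV S"
    and h: "0 < h" and strip: "{z. \<bar>Re z\<bar> < h} \<subseteq> resolvent_set_on UNIV S"
    and K: "0 \<le> K"
    and decay: "\<And>t x. (1 + \<bar>t\<bar>) * norm (resolvent S (\<i> * complex_of_real t) x) \<le> K * norm x"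
    and trunc: "\<And>\<rho> x. \<rho> > 0 \<Longrightarrow> norm (imag_integral \<rho> (\<lambda>z. resolvent S z x)) \<le> C * norm x"
begin

abbreviation "R \<equiv> resolvent S"

lemma lin: "linear_operator_on UNIV S"
  using dense by (simp add: densely_defined_on_def)

lemma strip_mem: "\<bar>Re z\<bar> < h \<Longrightarrow> z \<in> resolvent_set_on UNIV S"
  using strip by blast

lemma imag_mem: "\<i> * complex_of_real t \<in> resolvent_set_on UNIV S"
  by (rule strip_mem) (use h in simp)

lemma zero_mem: "0 \<in> resolvent_set_on UNIV S"
  by (rule strip_mem) (use h in simp)

lemma R_zero_eq_iff: "R 0 x = R 0 y \<longleftrightarrow> x = y"
proof
  assume "R 0 x = R 0 y"
  with resolvent_right[OF zero_mem UNIV_I, of x] resolvent_right[OF zero_mem UNIV_I, of y]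
  show "x = y" by simp
qed simp

lemma R_bound: "norm (R (\<i> * complex_of_real t) x) \<le> K * norm x"
  using decay[of t x] mult_right_mono[of 1 "1 + \<bar>t\<bar>" "norm (R (\<i> * complex_of_real t) x)"] by simp

text \<open>
  A width within which the bound \<open>K\<close> on the axis propagates sideways as \<open>2 K\<close>; the summand \<open>1\<close> guards
  against \<open>K = 0\<close>.
\<close>

definition h1 where "h1 = min h (1 / (2 * (K + 1)))"

lemma h1: "h1 > 0" "h1 \<le> h" using h K by (auto simp: h1_def)

lemma strip_bound:
  assumes z: "\<bar>Re z\<bar> < h1" and x: "x \<in> op_dom S"
  shows "norm x \<le> 2 * K * norm (op_app S x - z *\<^sub>C x)"
proof (rule resolvent_set_neighbour(2)[OF lin imag_mem[of "Im z"] K _ _ x])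
  show "norm y \<le> K * norm (op_app S y - (\<i> * complex_of_real (Im z)) *\<^sub>C y)" if "y \<in> op_dom S" for y
    by (rule norm_le_of_resolvent[OF lin imag_mem that R_bound])
  have eq: "cmod (z - \<i> * complex_of_real (Im z)) = \<bar>Re z\<bar>" by (simp add: cmod_def)
  have "\<bar>Re z\<bar> * K \<le> 1 / (2 * (K + 1)) * K"
    using z K by (intro mult_right_mono) (auto simp: h1_def)
  also have "1 / (2 * (K + 1)) * K \<le> 1/2" using K by (simp add: field_simps)
  finally show "cmod (z - \<i> * complex_of_real (Im z)) * K \<le> 1/2" unfolding eq .
qed

lemma continuous_on_R_imag: "continuous_on X (\<lambda>t. R (\<i> * complex_of_real t) x)"
proof (rule continuous_on_compose2[of "{z. \<bar>Re z\<bar> < h1}" "\<lambda>z. R z x"])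
  show "continuous_on {z. \<bar>Re z\<bar> < h1} (\<lambda>z. R z x)"
    by (rule continuous_on_resolvent[OF lin, of _ _ "2 * K"])
      (use strip_mem h1 K strip_bound in auto)
qed (use h1 in \<open>auto intro!: continuous_intros\<close>)

definition \<kappa> where "\<kappa> \<mu> = K / 2 * (1 + 1 / min 1 ((Re \<mu>)\<^sup>2)) * pi"

lemma \<kappa>_nonneg: "\<kappa> \<mu> \<ge> 0" using K by (simp add: \<kappa>_def)

text \<open>
  The product of the two factors of order \<open>1 / \<bar>t\<bar>\<close> is split by \<open>2 p q \<le> p\<^sup>2 + q\<^sup>2\<close> into a bump at \<open>0\<close>
  and a bump at \<open>Im \<mu>\<close>. The constant \<open>\<kappa> \<mu>\<close> depends on \<open>Re \<mu>\<close> only, which makes the integral bounded in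
  half-planes away from the axis.
\<close>

lemma weighted_integral:
  assumes \<mu>: "Re \<mu> \<noteq> 0" and B: "B \<ge> 0"
    and w: "continuous_on UNIV (\<lambda>t. w (\<i> * complex_of_real t))"
    and le: "\<And>t. cmod (w (\<i> * complex_of_real t)) * cmod (\<i> * complex_of_real t - \<mu>) \<le> B"
  obtains I where "has_pv_integral_imag_axis (\<lambda>z. w z *\<^sub>C R z x) I" "norm I \<le> B * \<kappa> \<mu> * norm x"
proof -
  define m where "m = min 1 ((Re \<mu>)\<^sup>2)"
  have m: "m > 0" "m \<le> 1" "m \<le> (Re \<mu>)\<^sup>2" using \<mu> by (auto simp: m_def)
  define a where "a = B * K * norm x / 2"
  have a: "a \<ge> 0" using B K by (simp add: a_def)
  have le': "norm (w (\<i> * complex_of_real t) *\<^sub>C R (\<i> * complex_of_real t) x)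
      \<le> a / (1 + t\<^sup>2) + (a / m) / (1 + (t - Im \<mu>)\<^sup>2)" for t
  proof -
    define d where "d = cmod (\<i> * complex_of_real t - \<mu>)"
    have d2: "d\<^sup>2 = (Re \<mu>)\<^sup>2 + (t - Im \<mu>)\<^sup>2" by (simp add: d_def cmod_power2)
    have "d \<noteq> 0" using d2 \<mu> by (auto simp: add_nonneg_eq_0_iff)
    then have d: "d > 0" by (simp add: d_def)
    define p where "p = 1 / (1 + \<bar>t\<bar>)"
    define q where "q = 1 / d"
    have w': "cmod (w (\<i> * complex_of_real t)) \<le> B * q"
      using le[of t] d by (simp add: d_def[symmetric] q_def field_simps)
    have R': "norm (R (\<i> * complex_of_real t) x) \<le> K * norm x * p"
      using decay[of t x] by (simp add: p_def field_simps)
    have "norm (w (\<i> * complex_of_real t) *\<^sub>C R (\<i> * complex_of_real t) x) \<le> (B * q) * (K * norm x * p)"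
      unfolding norm_scaleC using B d by (intro mult_mono w' R') (auto simp: q_def)
    also have "\<dots> = a * (2 * p * q)" by (simp add: a_def)
    also have "\<dots> \<le> a * (p\<^sup>2 + q\<^sup>2)"
      using sum_squares_bound[of p q] a by (intro mult_left_mono) auto
    also have "\<dots> \<le> a * (1 / (1 + t\<^sup>2) + (1 / m) / (1 + (t - Im \<mu>)\<^sup>2))"
    proof (intro mult_left_mono add_mono a)
      have "1 + t\<^sup>2 \<le> (1 + \<bar>t\<bar>)\<^sup>2" by (simp add: power2_sum)
      then show "p\<^sup>2 \<le> 1 / (1 + t\<^sup>2)"
        by (simp add: p_def power_one_over frac_le add_pos_nonneg)
      have "m * (1 + (t - Im \<mu>)\<^sup>2) \<le> d\<^sup>2"
        using m mult_right_mono[OF m(2), of "(t - Im \<mu>)\<^sup>2"] by (simp add: d2 distrib_left)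
      moreover have "m * (1 + (t - Im \<mu>)\<^sup>2) > 0" using m by (simp add: add_pos_nonneg)
      ultimately show "q\<^sup>2 \<le> (1 / m) / (1 + (t - Im \<mu>)\<^sup>2)"
        by (simp add: q_def power_one_over frac_le)
    qed
    finally show ?thesis by (simp add: distrib_left)
  qed
  obtain I where I: "has_pv_integral_imag_axis (\<lambda>z. w z *\<^sub>C R z x) I" "norm I \<le> (a + a / m) * pi"
    by (rule pv_integral_exists_dominated[of "\<lambda>z. w z *\<^sub>C R z x" a "a / m" "Im \<mu>"])
      (use le' a m continuous_on_R_imag w in \<open>auto intro!: continuous_intros\<close>)
  have "(a + a / m) * pi = B * \<kappa> \<mu> * norm x"
    by (simp add: a_def \<kappa>_def m_def field_simps)
  then show ?thesis using that I by simp
qed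

definition G where
  "G \<mu> x = (THE I. has_pv_integral_imag_axis (\<lambda>z. (1 / (z - \<mu>)) *\<^sub>C R z x) I)"

lemma imag_neq: "Re \<mu> \<noteq> 0 \<Longrightarrow> \<i> * complex_of_real t - \<mu> \<noteq> 0"
  by auto

lemma G:
  assumes "Re \<mu> \<noteq> 0"
  shows "has_pv_integral_imag_axis (\<lambda>z. (1 / (z - \<mu>)) *\<^sub>C R z x) (G \<mu> x)"
    and "norm (G \<mu> x) \<le> \<kappa> \<mu> * norm x"
proof -
  obtain I where I: "has_pv_integral_imag_axis (\<lambda>z. (1 / (z - \<mu>)) *\<^sub>C R z x) I"
    "norm I \<le> 1 * \<kappa> \<mu> * norm x"
    by (rule weighted_integral[of \<mu> 1 "\<lambda>z. 1 / (z - \<mu>)" x])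
      (use assms in \<open>auto intro!: continuous_intros simp: norm_divide imag_neq\<close>)
  have "G \<mu> x = I" unfolding G_def using I(1) by (rule the_equality) (rule pv_integral_unique[OF _ I(1)])
  then show "has_pv_integral_imag_axis (\<lambda>z. (1 / (z - \<mu>)) *\<^sub>C R z x) (G \<mu> x)"
    and "norm (G \<mu> x) \<le> \<kappa> \<mu> * norm x" using I by auto
qed

lemma R_imag_add: "R (\<i> * complex_of_real t) (x + y) = R (\<i> * complex_of_real t) x + R (\<i> * complex_of_real t) y"
  by (rule resolvent_add[OF lin imag_mem]) auto

lemma R_imag_scaleC: "R (\<i> * complex_of_real t) (a *\<^sub>C x) = a *\<^sub>C R (\<i> * complex_of_real t) x"
  by (rule resolvent_scaleC[OF lin imag_mem]) auto

lemma G_add: "G \<mu> (x + y) = G \<mu> x + G \<mu> y" if "Re \<mu> \<noteq> 0"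
proof (rule pv_integral_unique[OF G(1)[OF that]])
  show "has_pv_integral_imag_axis (\<lambda>z. (1 / (z - \<mu>)) *\<^sub>C R z (x + y)) (G \<mu> x + G \<mu> y)"
    by (rule pv_integral_transform[OF pv_integral_add[OF G(1)[OF that] G(1)[OF that], of x y]])
      (simp add: R_imag_add scaleC_add_right)
qed

lemma G_scaleC: "G \<mu> (a *\<^sub>C x) = a *\<^sub>C G \<mu> x" if "Re \<mu> \<noteq> 0"
proof (rule pv_integral_unique[OF G(1)[OF that]])
  show "has_pv_integral_imag_axis (\<lambda>z. (1 / (z - \<mu>)) *\<^sub>C R z (a *\<^sub>C x)) (a *\<^sub>C G \<mu> x)"
    by (rule pv_integral_transform[OF pv_integral_scaleC[OF G(1)[OF that], of a x]])
      (simp only: R_imag_scaleC scaleC_scaleC mult.commute)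
qed

lemma bounded_linear_G: "bounded_linear (G \<mu>)" if "Re \<mu> \<noteq> 0"
  by (rule bounded_linear_intro[of _ "\<kappa> \<mu>"])
    (use G(2)[OF that] in \<open>auto simp: G_add[OF that] G_scaleC[OF that] scaleR_eq_scaleC mult.commute
      simp del: scaleC_complex\<close>)

lemma commute_G:
  assumes "Re \<mu> \<noteq> 0" and B: "bounded_linear B" "\<And>a x. B (a *\<^sub>C x) = a *\<^sub>C B x"
    and comm: "\<And>t x. B (R (\<i> * complex_of_real t) x) = R (\<i> * complex_of_real t) (B x)"
  shows "B (G \<mu> x) = G \<mu> (B x)"
proof (rule pv_integral_unique[OF _ G(1)[OF assms(1)]])
  show "has_pv_integral_imag_axis (\<lambda>z. (1 / (z - \<mu>)) *\<^sub>C R z (B x)) (B (G \<mu> x))"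
    by (rule pv_integral_transform[OF pv_integral_bounded_linear[OF G(1)[OF assms(1)] B, of x]])
      (simp only: B(2) comm)
qed

lemma pv_simple_pole_scaleC:
  assumes "s = 1 \<or> s = -1" "s * Re \<mu> < 0"
  shows "has_pv_integral_imag_axis (\<lambda>z. (1 / (z - \<mu>)) *\<^sub>C (x::'a)) ((complex_of_real s * pi * \<i>) *\<^sub>C x)"
  using pv_integral_bounded_linear[OF pv_integral_simple_pole[OF assms]
      bounded_bilinear.bounded_linear_left[OF bounded_bilinear_scaleC, of x]]
  by (simp add: scaleC_scaleC)

lemma integrable_R: "(\<lambda>t. \<i> *\<^sub>C R (\<i> * complex_of_real t) x) integrable_on {a..b}"
  by (intro integrable_continuous_real continuous_intros continuous_on_R_imag)

lemma imag_integral_R_diff: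
  "imag_integral \<rho> (\<lambda>z. R z x) - imag_integral \<rho> (\<lambda>z. R z y) = imag_integral \<rho> (\<lambda>z. R z (x - y))"
  using integral_diff[OF integrable_R integrable_R, of "-\<rho>" \<rho> x y]
  by (simp add: resolvent_diff[OF lin imag_mem] scaleC_diff_right)

text \<open>
  For \<open>x\<close> in the domain, \<open>R z x = (R z y - x) / (z + 1)\<close> with \<open>y = S x + x\<close>: the first part is
  absolutely integrable and the second is a simple pole at \<open>- 1\<close>. The uniform bound on the truncated
  integrals carries convergence over to the closure of the domain.
\<close>

lemma pv_R_exists: "\<exists>I. has_pv_integral_imag_axis (\<lambda>z. R z x) I"
proof -
  have dom: "\<exists>I. has_pv_integral_imag_axis (\<lambda>z. R z x) I" if x: "x \<in> op_dom S" for x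
  proof -
    let ?y = "op_app S x + x"
    have eq: "R z x = (1 / (z + 1)) *\<^sub>C R z ?y - (1 / (z + 1)) *\<^sub>C x"
      if z: "z \<in> resolvent_set_on UNIV S" "z + 1 \<noteq> 0" for z
    proof -
      have shift: "op_app S x - z *\<^sub>C x = ?y - (z + 1) *\<^sub>C x" by (simp add: scaleC_add_left)
      have "x = R z (?y - (z + 1) *\<^sub>C x)" using resolvent_left[OF z(1) x] unfolding shift by (rule sym)
      also have "\<dots> = R z ?y - (z + 1) *\<^sub>C R z x"
        by (simp only: resolvent_diff[OF lin z(1) UNIV_I UNIV_I] resolvent_scaleC[OF lin z(1) UNIV_I])
      finally have "x = R z ?y - (z + 1) *\<^sub>C R z x" .
      then have "(z + 1) *\<^sub>C R z x = R z ?y - x" by (simp add: algebra_simps)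
      then have "(1 / (z + 1)) *\<^sub>C (z + 1) *\<^sub>C R z x = (1 / (z + 1)) *\<^sub>C (R z ?y - x)" by simp
      then show ?thesis using z(2) by (simp add: scaleC_scaleC scaleC_diff_right)
    qed
    have "has_pv_integral_imag_axis (\<lambda>z. (1 / (z - -1)) *\<^sub>C R z ?y - (1 / (z - -1)) *\<^sub>C x)
        (G (-1) ?y - (complex_of_real 1 * pi * \<i>) *\<^sub>C x)"
      by (intro pv_integral_diff G pv_simple_pole_scaleC) auto
    then have "has_pv_integral_imag_axis (\<lambda>z. R z x) (G (-1) ?y - (complex_of_real 1 * pi * \<i>) *\<^sub>C x)"
    proof (rule pv_integral_transform)
      fix t :: real
      have "\<i> * complex_of_real t + 1 \<noteq> 0" using imag_neq[of "-1" t] by simp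
      from eq[OF imag_mem this]
      show "(1 / (\<i> * complex_of_real t - - 1)) *\<^sub>C R (\<i> * complex_of_real t) (op_app S x + x) -
          (1 / (\<i> * complex_of_real t - - 1)) *\<^sub>C x = R (\<i> * complex_of_real t) x" by simp
    qed
    then show ?thesis by blast
  qed
  let ?N = "\<lambda>x \<rho>. imag_integral \<rho> (\<lambda>z. R z x)"
  obtain I where "(?N x \<longlongrightarrow> I) at_top"
  proof (rule tendsto_at_top_if_Cauchy)
    fix e :: real assume e: "e > 0"
    define c where "c = \<bar>C\<bar> + 1"
    have c: "c > 0" by (simp add: c_def add_nonneg_pos)
    define d where "d = e / (4 * c)"
    have d: "d > 0" using e c by (simp add: d_def)
    have "x \<in> closure (op_dom S)" using dense by (auto simp: densely_defined_on_def)
    then obtain y where y: "y \<in> op_dom S" "norm (x - y) < d"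
      using d unfolding closure_approachable by (auto simp: dist_norm norm_minus_commute)
    have "C * norm (x - y) \<le> \<bar>C\<bar> * norm (x - y)" by (simp add: mult_right_mono)
    also have "\<dots> \<le> \<bar>C\<bar> * d" using y by (simp add: mult_left_mono)
    also have "\<dots> < c * d" using d by (simp add: c_def)
    also have "\<dots> = e / 4" using c by (simp add: d_def)
    finally have Cxy: "C * norm (x - y) < e / 4" .
    obtain I where "(?N y \<longlongrightarrow> I) at_top"
      using dom[OF y(1)] by (auto simp: has_pv_integral_imag_axis_def)
    then have "\<forall>\<^sub>F \<rho> in at_top. dist (?N y \<rho>) I < e / 4"
      using e by (intro tendstoD) auto
    then obtain r where r: "\<And>\<rho>. \<rho> \<ge> r \<Longrightarrow> dist (?N y \<rho>) I < e / 4"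
      by (auto simp: eventually_at_top_linorder)
    have near: "norm (?N x \<rho> - I) < e / 2" if "\<rho> \<ge> max r 1" for \<rho>
    proof -
      have "norm (?N x \<rho> - ?N y \<rho>) < e / 4"
        unfolding imag_integral_R_diff using trunc[of \<rho> "x - y"] Cxy that by simp
      moreover have "norm (?N y \<rho> - I) < e / 4" using r[of \<rho>] that by (simp add: dist_norm)
      ultimately show ?thesis
        using norm_triangle_ineq[of "?N x \<rho> - ?N y \<rho>" "?N y \<rho> - I"] by simp
    qed
    have "dist (?N x \<rho>) (?N x \<sigma>) < e" if "\<rho> \<ge> max r 1" "\<sigma> \<ge> \<rho>" for \<rho> \<sigma>
    proof -
      have "dist (?N x \<rho>) I < e / 2" "dist (?N x \<sigma>) I < e / 2"
        using near[of \<rho>] near[of \<sigma>] that by (auto simp: dist_norm)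
      then show ?thesis using dist_triangle2[of "?N x \<rho>" "?N x \<sigma>" I] by simp
    qed
    then show "\<exists>r. \<forall>\<rho>\<ge>r. \<forall>\<sigma>\<ge>\<rho>. dist (?N x \<rho>) (?N x \<sigma>) < e" by blast
  qed
  then show ?thesis using integrable_R by (auto simp: has_pv_integral_imag_axis_def)
qed

text \<open>
  The sign of \<open>S\<close>: formally \<open>1\<close> on the part of the spectrum in the right half-plane and \<open>- 1\<close> on the
  part in the left one.
\<close>

definition J where
  "J x = (1 / (pi * \<i>)) *\<^sub>C (THE I. has_pv_integral_imag_axis (\<lambda>z. R z x) I)"

lemma J: "has_pv_integral_imag_axis (\<lambda>z. R z x) ((pi * \<i>) *\<^sub>C J x)"
proof -
  obtain I where I: "has_pv_integral_imag_axis (\<lambda>z. R z x) I" using pv_R_exists by blast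
  then have "(THE I. has_pv_integral_imag_axis (\<lambda>z. R z x) I) = I"
    by (rule the_equality) (rule pv_integral_unique[OF _ I])
  then show ?thesis using I by (simp add: J_def scaleC_scaleC)
qed

lemma J_eqI: "has_pv_integral_imag_axis (\<lambda>z. R z x) ((pi * \<i>) *\<^sub>C y) \<Longrightarrow> J x = y"
proof -
  assume "has_pv_integral_imag_axis (\<lambda>z. R z x) ((pi * \<i>) *\<^sub>C y)"
  from pv_integral_unique[OF J this]
  have "(1 / (pi * \<i>)) *\<^sub>C ((pi * \<i>) *\<^sub>C J x) = (1 / (pi * \<i>)) *\<^sub>C ((pi * \<i>) *\<^sub>C y)" by simp
  then show "J x = y" by (simp add: scaleC_scaleC)
qed

lemma J_add: "J (x + y) = J x + J y"
proof (rule J_eqI)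
  have "has_pv_integral_imag_axis (\<lambda>z. R z (x + y)) ((pi * \<i>) *\<^sub>C J x + (pi * \<i>) *\<^sub>C J y)"
    by (rule pv_integral_transform[OF pv_integral_add[OF J J]]) (simp only: R_imag_add)
  then show "has_pv_integral_imag_axis (\<lambda>z. R z (x + y)) ((pi * \<i>) *\<^sub>C (J x + J y))"
    by (simp only: scaleC_add_right)
qed

lemma J_scaleC: "J (a *\<^sub>C x) = a *\<^sub>C J x"
proof (rule J_eqI)
  have "has_pv_integral_imag_axis (\<lambda>z. R z (a *\<^sub>C x)) (a *\<^sub>C (pi * \<i>) *\<^sub>C J x)"
    by (rule pv_integral_transform[OF pv_integral_scaleC[OF J]]) (simp only: R_imag_scaleC)
  then show "has_pv_integral_imag_axis (\<lambda>z. R z (a *\<^sub>C x)) ((pi * \<i>) *\<^sub>C a *\<^sub>C J x)"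
    by (simp only: scaleC_scaleC mult.commute)
qed

lemma bounded_linear_J: "bounded_linear J"
proof (rule bounded_linear_intro[of _ "C / pi"])
  fix x
  have "norm ((pi * \<i>) *\<^sub>C J x) \<le> C * norm x" by (rule pv_integral_norm_le[OF J trunc])
  then show "norm (J x) \<le> norm x * (C / pi)" by (simp add: norm_scaleC norm_mult field_simps)
qed (auto simp: J_add J_scaleC scaleR_eq_scaleC simp del: scaleC_complex)

lemma commute_J:
  assumes B: "bounded_linear B" "\<And>a x. B (a *\<^sub>C x) = a *\<^sub>C B x"
    and comm: "\<And>t x. B (R (\<i> * complex_of_real t) x) = R (\<i> * complex_of_real t) (B x)"
  shows "B (J x) = J (B x)"
proof (rule J_eqI[symmetric])
  have "has_pv_integral_imag_axis (\<lambda>z. R z (B x)) (B ((pi * \<i>) *\<^sub>C J x))"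
    by (rule pv_integral_transform[OF pv_integral_bounded_linear[OF J B]]) (simp only: comm)
  then show "has_pv_integral_imag_axis (\<lambda>z. R z (B x)) ((pi * \<i>) *\<^sub>C B (J x))"
    by (simp only: B(2))
qed

text \<open>
  For \<open>s = 1\<close> and \<open>s = - 1\<close> these turn out to be the spectral projections onto the right and the left part.
\<close>

definition P where "P s x = (1/2) *\<^sub>R (x + s *\<^sub>R J x)"

lemma bounded_linear_P: "bounded_linear (P s)"
  unfolding P_def[abs_def]
  by (intro bounded_linear_const_scaleR bounded_linear_add bounded_linear_ident bounded_linear_J)

lemma P_scaleC: "P s (a *\<^sub>C x) = a *\<^sub>C P s x"
  by (simp add: P_def J_scaleC scaleC_add_right scaleC_scaleR)

lemma P_sum: "P s x + P (-s) x = x"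
proof -
  have "(1/2) *\<^sub>R x + (1/2) *\<^sub>R x = x" by (simp only: scaleR_add_left[symmetric]) simp
  then show ?thesis by (simp add: P_def algebra_simps)
qed

lemma P_diff: "P 1 x - P (-1) x = J x"
proof -
  have "(1/2) *\<^sub>R J x + (1/2) *\<^sub>R J x = J x" by (simp only: scaleR_add_left[symmetric]) simp
  then show ?thesis by (simp add: P_def algebra_simps)
qed

lemma P_commute: "P s (P r x) = P r (P s x)"
proof -
  interpret J: bounded_linear J by (rule bounded_linear_J)
  show ?thesis by (simp add: P_def J.add J.scaleR scaleR_add_right mult.commute add_ac)
qed

lemma commute_P:
  assumes B: "bounded_linear B" "\<And>a x. B (a *\<^sub>C x) = a *\<^sub>C B x"
    and comm: "\<And>t x. B (R (\<i> * complex_of_real t) x) = R (\<i> * complex_of_real t) (B x)"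
  shows "B (P s x) = P s (B x)"
proof -
  interpret B: bounded_linear B by (rule B(1))
  show ?thesis by (simp add: P_def B.add B.scaleR commute_J[OF B comm])
qed

lemma R_P: "z \<in> resolvent_set_on UNIV S \<Longrightarrow> R z (P s x) = P s (R z x)"
  by (rule commute_P[OF bounded_linear_resolvent[OF lin] resolvent_scaleC[OF lin _ UNIV_I]
        resolvent_commute[OF lin _ imag_mem UNIV_I]])

text \<open>
  For \<open>s Re \<mu> < 0\<close> this is formally \<open>(S - \<mu>)\<inverse>\<close> on the range of \<open>P s\<close> and zero on the range of \<open>P (- s)\<close>,
  as closing the contour suggests.
\<close>

definition H where "H s \<mu> x = (complex_of_real s / (2 * pi * \<i>)) *\<^sub>C G \<mu> x"

lemma R_eq_R_zero: "z \<in> resolvent_set_on UNIV S \<Longrightarrow> R z x = R 0 (x + z *\<^sub>C R z x)"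
  using resolvent_identity[OF lin _ zero_mem, of z x] resolvent_commute[OF lin _ zero_mem, of z x]
  by (simp add: resolvent_add[OF lin zero_mem] resolvent_scaleC[OF lin zero_mem] algebra_simps)

text \<open>
  This says \<open>(S - \<mu>) H = P s\<close>, in a form that uses only the bounded operator \<open>R 0\<close>: under the integral,
  \<open>R z x = R 0 (x + z R z x)\<close> and \<open>z / (z - \<mu>) = 1 + \<mu> / (z - \<mu>)\<close>, so that the pole contributes
  \<open>s x / 2\<close>, the resolvent \<open>s J x / 2\<close>, and the remainder \<open>\<mu> H s \<mu> x\<close>.
\<close>

lemma H_eq:
  assumes s: "s = 1 \<or> s = -1" "s * Re \<mu> < 0"
  shows "H s \<mu> x = R 0 (P s x + \<mu> *\<^sub>C H s \<mu> x)"
proof -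
  have re: "Re \<mu> \<noteq> 0" using s by auto
  let ?c = "complex_of_real s / (2 * pi * \<i>)"
  let ?I = "(complex_of_real s * pi * \<i>) *\<^sub>C x + (pi * \<i>) *\<^sub>C J x + \<mu> *\<^sub>C G \<mu> x"
  have "has_pv_integral_imag_axis
      (\<lambda>z. (1 / (z - \<mu>)) *\<^sub>C x + R z x + \<mu> *\<^sub>C (1 / (z - \<mu>)) *\<^sub>C R z x) ?I"
    by (intro pv_integral_add pv_integral_scaleC J G re pv_simple_pole_scaleC s)
  from pv_integral_bounded_linear[OF this bounded_linear_resolvent[OF lin zero_mem]]
  have 1: "has_pv_integral_imag_axis
      (\<lambda>z. R 0 ((1 / (z - \<mu>)) *\<^sub>C x + R z x + \<mu> *\<^sub>C (1 / (z - \<mu>)) *\<^sub>C R z x)) (R 0 ?I)"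
    by (simp add: resolvent_scaleC[OF lin zero_mem])
  have 2: "(1 / (z - \<mu>)) *\<^sub>C R z x = R 0 ((1 / (z - \<mu>)) *\<^sub>C x + R z x + \<mu> *\<^sub>C (1 / (z - \<mu>)) *\<^sub>C R z x)"
    if z: "z \<in> resolvent_set_on UNIV S" "z - \<mu> \<noteq> 0" for z
  proof -
    have "(1 / (z - \<mu>)) *\<^sub>C R z x = R 0 ((1 / (z - \<mu>)) *\<^sub>C (x + z *\<^sub>C R z x))"
      using R_eq_R_zero[OF z(1), of x] resolvent_scaleC[OF lin zero_mem, of "x + z *\<^sub>C R z x" "1 / (z - \<mu>)"]
      by simp
    moreover have "(1 / (z - \<mu>)) *\<^sub>C (x + z *\<^sub>C R z x)
        = (1 / (z - \<mu>)) *\<^sub>C x + R z x + \<mu> *\<^sub>C (1 / (z - \<mu>)) *\<^sub>C R z x"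
    proof -
      have "(1 / (z - \<mu>)) * z = 1 + \<mu> * (1 / (z - \<mu>))" using z(2) by (simp add: field_simps)
      then show ?thesis
        by (simp only: scaleC_add_right scaleC_scaleC scaleC_add_left scaleC_one add.assoc)
    qed
    ultimately show ?thesis by (simp only:)
  qed
  have "G \<mu> x = R 0 ?I"
  proof (rule pv_integral_unique[OF G(1)[OF re]])
    show "has_pv_integral_imag_axis (\<lambda>z. (1 / (z - \<mu>)) *\<^sub>C R z x) (R 0 ?I)"
      by (rule pv_integral_transform[OF 1 2[OF imag_mem imag_neq[OF re], symmetric]])
  qed
  then have "H s \<mu> x = R 0 (?c *\<^sub>C ?I)"
    by (simp only: H_def resolvent_scaleC[OF lin zero_mem UNIV_I])
  also have "?c *\<^sub>C ?I = P s x + \<mu> *\<^sub>C H s \<mu> x"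
  proof -
    have "?c * (complex_of_real s * pi * \<i>) = 1/2" "?c * (pi * \<i>) = complex_of_real (s / 2)"
      using s by (auto simp: field_simps)
    then show ?thesis
      by (simp only: scaleC_add_right scaleC_scaleC)
        (simp add: P_def H_def scaleR_eq_scaleC scaleC_add_right scaleC_scaleC mult.commute
          del: scaleC_complex)
  qed
  finally show ?thesis .
qed

lemma H_dom:
  assumes s: "s = 1 \<or> s = -1" "s * Re \<mu> < 0"
  shows "H s \<mu> x \<in> op_dom S" "op_app S (H s \<mu> x) - \<mu> *\<^sub>C H s \<mu> x = P s x"
proof -
  show "H s \<mu> x \<in> op_dom S" by (subst H_eq[OF s]) (rule resolvent_in_dom[OF zero_mem UNIV_I])
  have "op_app S (R 0 (P s x + \<mu> *\<^sub>C H s \<mu> x)) = P s x + \<mu> *\<^sub>C H s \<mu> x"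
    using resolvent_right[OF zero_mem, of "P s x + \<mu> *\<^sub>C H s \<mu> x"] by simp
  then show "op_app S (H s \<mu> x) - \<mu> *\<^sub>C H s \<mu> x = P s x"
    unfolding H_eq[OF s, of x, symmetric] by simp
qed

lemma H_eq_R: "s = 1 \<or> s = -1 \<Longrightarrow> s * Re \<mu> < 0 \<Longrightarrow> \<bar>Re \<mu>\<bar> < h \<Longrightarrow> H s \<mu> x = R \<mu> (P s x)"
  using resolvent_eqI[OF strip_mem H_dom] by metis

lemma H_bound: "s = 1 \<or> s = -1 \<Longrightarrow> Re \<mu> \<noteq> 0 \<Longrightarrow> norm (H s \<mu> x) \<le> \<kappa> \<mu> * norm x"
proof -
  assume s: "s = 1 \<or> s = -1" and re: "Re \<mu> \<noteq> 0"
  have "cmod (complex_of_real s / (2 * pi * \<i>)) = 1 / (2 * pi)"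
    using s by (auto simp: norm_divide norm_mult)
  also have "\<dots> \<le> 1" using pi_gt3 by simp
  finally have "norm (H s \<mu> x) \<le> 1 * norm (G \<mu> x)"
    unfolding H_def norm_scaleC by (rule mult_right_mono) simp
  then show ?thesis using G(2)[OF re, of x] by simp
qed

text \<open>
  Differentiation under the integral, by expanding the kernel \<open>1 / (z - \<nu>)\<close> to first order at \<open>\<mu>\<close>; the
  remainder is quadratic in \<open>\<nu> - \<mu>\<close>, uniformly for \<open>\<nu>\<close> within half the distance of \<open>\<mu>\<close> from the axis.
\<close>

lemma holomorphic_G:
  assumes \<mu>: "Re \<mu> \<noteq> 0"
  shows "(\<lambda>\<nu>. cinner (G \<nu> x) v) field_differentiable at \<mu>"
proof -
  obtain D where D: "has_pv_integral_imag_axis (\<lambda>z. (1 / (z - \<mu>)\<^sup>2) *\<^sub>C R z x) D"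
  proof (rule weighted_integral[of \<mu> "1 / \<bar>Re \<mu>\<bar>" "\<lambda>z. 1 / (z - \<mu>)\<^sup>2" x])
    show "continuous_on UNIV (\<lambda>t. 1 / (\<i> * complex_of_real t - \<mu>)\<^sup>2)"
      using imag_neq[OF \<mu>] by (intro continuous_intros) auto
    fix t
    have "\<bar>Re \<mu>\<bar> \<le> cmod (\<i> * complex_of_real t - \<mu>)"
      using abs_Re_le_cmod[of "\<i> * complex_of_real t - \<mu>"] by simp
    moreover have "cmod (1 / (\<i> * complex_of_real t - \<mu>)\<^sup>2) * cmod (\<i> * complex_of_real t - \<mu>)
        = 1 / cmod (\<i> * complex_of_real t - \<mu>)"
      using imag_neq[OF \<mu>, of t] by (simp add: norm_divide norm_power power2_eq_square norm_mult)
    ultimately show "cmod (1 / (\<i> * complex_of_real t - \<mu>)\<^sup>2) * cmod (\<i> * complex_of_real t - \<mu>) \<le> 1 / \<bar>Re \<mu>\<bar>"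
      using \<mu> by (simp only:) (rule frac_le, auto)
  qed (use \<mu> in auto)
  define r where "r = \<bar>Re \<mu>\<bar> / 2"
  define M where "M = 1 / r\<^sup>2 * \<kappa> \<mu> * norm x"
  have r: "r > 0" using \<mu> by (simp add: r_def)
  have est: "norm (G \<nu> x - G \<mu> x - (\<nu> - \<mu>) *\<^sub>C D) \<le> (cmod (\<nu> - \<mu>))\<^sup>2 * M" if \<nu>: "cmod (\<nu> - \<mu>) < r" for \<nu>
  proof -
    have "\<bar>Re \<nu> - Re \<mu>\<bar> < r" using \<nu> abs_Re_le_cmod[of "\<nu> - \<mu>"] by simp
    then have re: "r \<le> \<bar>Re \<nu>\<bar>" "Re \<nu> \<noteq> 0" using r unfolding r_def by linarith+
    obtain E where E: "has_pv_integral_imag_axis (\<lambda>z. (1 / ((z - \<nu>) * (z - \<mu>)\<^sup>2)) *\<^sub>C R z x) E"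
      "norm E \<le> 1 / r\<^sup>2 * \<kappa> \<mu> * norm x"
    proof (rule weighted_integral[of \<mu> "1 / r\<^sup>2" "\<lambda>z. 1 / ((z - \<nu>) * (z - \<mu>)\<^sup>2)" x])
      show "continuous_on UNIV (\<lambda>t. 1 / ((\<i> * complex_of_real t - \<nu>) * (\<i> * complex_of_real t - \<mu>)\<^sup>2))"
        using imag_neq[OF \<mu>] imag_neq[OF re(2)] by (intro continuous_intros) auto
      fix t
      let ?a = "cmod (\<i> * complex_of_real t - \<nu>)" and ?b = "cmod (\<i> * complex_of_real t - \<mu>)"
      have ab: "r \<le> ?a" "r \<le> ?b"
        using abs_Re_le_cmod[of "\<i> * complex_of_real t - \<mu>"] abs_Re_le_cmod[of "\<i> * complex_of_real t - \<nu>"]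
          re r by (auto simp: r_def)
      then have "r\<^sup>2 \<le> ?a * ?b" using r by (simp add: power2_eq_square mult_mono)
      moreover have "cmod (1 / ((\<i> * complex_of_real t - \<nu>) * (\<i> * complex_of_real t - \<mu>)\<^sup>2)) * ?b = 1 / (?a * ?b)"
        using ab r by (simp add: norm_divide norm_mult norm_power power2_eq_square)
      ultimately show "cmod (1 / ((\<i> * complex_of_real t - \<nu>) * (\<i> * complex_of_real t - \<mu>)\<^sup>2)) * ?b \<le> 1 / r\<^sup>2"
        using r by (simp add: frac_le)
    qed (use \<mu> in auto)
    have alg: "1 / (z - \<nu>) - 1 / (z - \<mu>) - (\<nu> - \<mu>) * (1 / (z - \<mu>)\<^sup>2)
        = (\<nu> - \<mu>)\<^sup>2 * (1 / ((z - \<nu>) * (z - \<mu>)\<^sup>2))" if "z - \<nu> \<noteq> 0" "z - \<mu> \<noteq> 0" for z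
    proof -
      define a b where "a = z - \<nu>" and "b = z - \<mu>"
      have "1 / a - 1 / b - (b - a) * (1 / b\<^sup>2) = (b - a)\<^sup>2 * (1 / (a * b\<^sup>2))"
        using that by (simp add: a_def[symmetric] b_def[symmetric] field_simps power2_eq_square)
      moreover have "b - a = \<nu> - \<mu>" by (simp add: a_def b_def)
      ultimately show ?thesis by (simp add: a_def b_def)
    qed
    have "has_pv_integral_imag_axis (\<lambda>z. (1 / (z - \<nu>)) *\<^sub>C R z x - (1 / (z - \<mu>)) *\<^sub>C R z x
        - (\<nu> - \<mu>) *\<^sub>C (1 / (z - \<mu>)\<^sup>2) *\<^sub>C R z x) (G \<nu> x - G \<mu> x - (\<nu> - \<mu>) *\<^sub>C D)"
      by (intro pv_integral_diff pv_integral_scaleC G D re(2) \<mu>)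
    moreover have "has_pv_integral_imag_axis (\<lambda>z. (1 / (z - \<nu>)) *\<^sub>C R z x - (1 / (z - \<mu>)) *\<^sub>C R z x
        - (\<nu> - \<mu>) *\<^sub>C (1 / (z - \<mu>)\<^sup>2) *\<^sub>C R z x) ((\<nu> - \<mu>)\<^sup>2 *\<^sub>C E)"
      by (rule pv_integral_transform[OF pv_integral_scaleC[OF E(1), of "(\<nu> - \<mu>)\<^sup>2"]])
        (simp only: scaleC_scaleC scaleC_diff_left[symmetric] alg[OF imag_neq[OF re(2)] imag_neq[OF \<mu>]])
    ultimately have "G \<nu> x - G \<mu> x - (\<nu> - \<mu>) *\<^sub>C D = (\<nu> - \<mu>)\<^sup>2 *\<^sub>C E" by (rule pv_integral_unique)
    then show ?thesis
      unfolding M_def by (simp only: norm_scaleC norm_power) (rule mult_left_mono[OF E(2)], simp)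
  qed
  have "((\<lambda>\<nu>. cinner (G \<nu> x) v) has_field_derivative cinner D v) (at \<mu>)"
    unfolding has_field_derivative_iff
  proof (rule LIM_I)
    fix e :: real assume e: "e > 0"
    have M: "M \<ge> 0" by (simp add: M_def \<kappa>_nonneg)
    define d where "d = min r (e / (M * norm v + 1))"
    have d: "d > 0" using r e M by (simp add: d_def add_nonneg_pos)
    have "cmod ((cinner (G \<nu> x) v - cinner (G \<mu> x) v) / (\<nu> - \<mu>) - cinner D v) < e"
      if \<nu>: "\<nu> \<noteq> \<mu>" "cmod (\<nu> - \<mu>) < d" for \<nu>
    proof -
      have "(cinner (G \<nu> x) v - cinner (G \<mu> x) v) / (\<nu> - \<mu>) - cinner D v
          = cinner (G \<nu> x - G \<mu> x - (\<nu> - \<mu>) *\<^sub>C D) v / (\<nu> - \<mu>)"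
        using \<nu> by (simp add: cinner_diff_left cinner_scaleC_left diff_divide_distrib)
      also have "cmod \<dots> \<le> (cmod (\<nu> - \<mu>))\<^sup>2 * M * norm v / cmod (\<nu> - \<mu>)"
        unfolding norm_divide using \<nu>
        by (intro divide_right_mono order_trans[OF norm_cinner_le] mult_right_mono est) (auto simp: d_def)
      also have "\<dots> = cmod (\<nu> - \<mu>) * (M * norm v)" using \<nu> by (simp add: power2_eq_square)
      also have "\<dots> \<le> cmod (\<nu> - \<mu>) * (M * norm v + 1)" by (simp add: mult_left_mono)
      also have "\<dots> < e / (M * norm v + 1) * (M * norm v + 1)"
        using \<nu>(2) M by (intro mult_strict_right_mono) (auto simp: d_def add_nonneg_pos)
      also have "\<dots> = e" using M by (simp add: add_nonneg_eq_0_iff)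
      finally show ?thesis .
    qed
    then show "\<exists>s>0. \<forall>\<nu>. \<nu> \<noteq> \<mu> \<and> norm (\<nu> - \<mu>) < s \<longrightarrow>
        norm ((cinner (G \<nu> x) v - cinner (G \<mu> x) v) / (\<nu> - \<mu>) - cinner D v) < e"
      using d by blast
  qed
  then show ?thesis using field_differentiable_def by blast
qed

text \<open>
  On \<open>y = P 1 (P (- 1) x)\<close> the resolvent \<open>R \<mu> y\<close> extends from the strip to the left as
  \<open>H 1 \<mu> (P (- 1) x)\<close> and to the right as \<open>H (- 1) \<mu> (P 1 x)\<close>. The resulting entire function is bounded,
  hence constant, and it vanishes at infinity along the axis.
\<close>

lemma P_disjoint: "P 1 (P (-1) x) = 0"
proof -
  let ?y = "P 1 (P (-1) x)"
  have "cinner (R 0 ?y) v = 0" for v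
  proof -
    define \<phi> where "\<phi> \<mu> = (if Re \<mu> < 0 then cinner (H 1 \<mu> (P (-1) x)) v
      else if Re \<mu> > 0 then cinner (H (-1) \<mu> (P 1 x)) v else cinner (R \<mu> ?y) v)" for \<mu>
    have \<phi>_strip: "\<phi> \<mu> = cinner (R \<mu> ?y) v" if "\<bar>Re \<mu>\<bar> < h1" for \<mu>
      using that h1 H_eq_R[of 1 \<mu> "P (-1) x"] H_eq_R[of "-1" \<mu> "P 1 x"] P_commute[of 1 "-1" x]
      by (auto simp: \<phi>_def)
    have "\<phi> field_differentiable at \<mu>" for \<mu>
    proof -
      consider "Re \<mu> < 0" | "Re \<mu> > 0" | "Re \<mu> = 0" by linarith
      then show ?thesis
      proof cases
        case 1
        have "(\<lambda>\<nu>. (complex_of_real 1 / (2 * pi * \<i>)) * cinner (G \<nu> (P (-1) x)) v) field_differentiable at \<mu>"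
          using 1 by (intro field_differentiable_mult field_differentiable_const holomorphic_G) auto
        then show ?thesis
          by (rule field_differentiable_transform_within_open[OF _ open_halfspace_Re_lt[of 0]])
            (use 1 in \<open>auto simp: \<phi>_def H_def cinner_scaleC_left\<close>)
      next
        case 2
        have "(\<lambda>\<nu>. (complex_of_real (-1) / (2 * pi * \<i>)) * cinner (G \<nu> (P 1 x)) v) field_differentiable at \<mu>"
          using 2 by (intro field_differentiable_mult field_differentiable_const holomorphic_G) auto
        then show ?thesis
          by (rule field_differentiable_transform_within_open[OF _ open_halfspace_Re_gt[of 0]])
            (use 2 in \<open>auto simp: \<phi>_def H_def cinner_scaleC_left\<close>)
      next
        case 3
        let ?U = "{z. \<bar>Re z\<bar> < h1}"
        have U: "open ?U" by (intro open_Collect_less continuous_intros)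
        have \<mu>U: "\<mu> \<in> ?U" using 3 h1 by simp
        have "((\<lambda>z. cinner (R z ?y) v) has_field_derivative cinner (R \<mu> (R \<mu> ?y)) v) (at \<mu> within ?U)"
          by (rule has_field_derivative_cinner_resolvent[OF lin, of _ _ "2 * K"])
            (use strip_mem h1 K strip_bound \<mu>U in auto)
        then have "(\<lambda>z. cinner (R z ?y) v) field_differentiable at \<mu>"
          unfolding at_within_open[OF \<mu>U U] field_differentiable_def by blast
        then show ?thesis
          by (rule field_differentiable_transform_within_open[OF _ U \<mu>U]) (auto simp: \<phi>_strip)
      qed
    qed
    then have hol: "\<phi> holomorphic_on UNIV" by (simp add: holomorphic_on_def)
    have bdd: "bounded (range \<phi>)"
    proof -
      define k where "k = K / 2 * (1 + 1 / min 1 ((h1/2)\<^sup>2)) * pi"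
      define B where "B = (k * norm (P (-1) x) + k * norm (P 1 x) + 2 * K * norm ?y) * norm v"
      have k: "k \<ge> 0" using K by (simp add: k_def)
      have \<kappa>: "\<kappa> \<mu> \<le> k" if "h1 / 2 \<le> \<bar>Re \<mu>\<bar>" for \<mu>
      proof -
        have "(h1 / 2)\<^sup>2 \<le> (Re \<mu>)\<^sup>2" using that h1 by (simp add: abs_le_square_iff[symmetric])
        then have "min 1 ((h1/2)\<^sup>2) \<le> min 1 ((Re \<mu>)\<^sup>2)" by (simp add: min.coboundedI2 min.coboundedI1)
        moreover have "min 1 ((h1/2)\<^sup>2) > 0" using h1 by simp
        ultimately show ?thesis unfolding \<kappa>_def k_def using K
          by (intro mult_mono mult_left_mono add_left_mono frac_le) (auto simp: add_nonneg_nonneg)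
      qed
      have "cmod (\<phi> \<mu>) \<le> B" for \<mu>
      proof (cases "\<bar>Re \<mu>\<bar> < h1 / 2")
        case True
        then have m: "\<bar>Re \<mu>\<bar> < h1" using h1 by simp
        have "norm (R \<mu> ?y) \<le> 2 * K * norm ?y"
          by (rule resolvent_norm_le[OF strip_mem]) (use m h1 strip_bound in auto)
        also have "\<dots> \<le> k * norm (P (-1) x) + k * norm (P 1 x) + 2 * K * norm ?y"
          using k by simp
        finally show ?thesis unfolding \<phi>_strip[OF m] B_def
          by (intro order_trans[OF norm_cinner_le] mult_right_mono) auto
      next
        case False
        then have ge: "h1 / 2 \<le> \<bar>Re \<mu>\<bar>" by simp
        have Hb: "norm (H s \<mu> y) \<le> k * norm y" if "s = 1 \<or> s = -1" for s y
          using H_bound[OF that, of \<mu> y] mult_right_mono[OF \<kappa>[OF ge], of "norm y"] ge h1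
          by (cases "Re \<mu> = 0") auto
        have "norm (H 1 \<mu> (P (-1) x)) \<le> k * norm (P (-1) x) + k * norm (P 1 x) + 2 * K * norm ?y"
          "norm (H (-1) \<mu> (P 1 x)) \<le> k * norm (P (-1) x) + k * norm (P 1 x) + 2 * K * norm ?y"
          using Hb[of 1 "P (-1) x"] Hb[of "-1" "P 1 x"] k K by (auto intro: order_trans add_increasing add_increasing2)
        moreover have "Re \<mu> \<noteq> 0" using ge h1 by auto
        ultimately show ?thesis unfolding \<phi>_def B_def
          by (auto intro!: order_trans[OF norm_cinner_le] mult_right_mono)
      qed
      then show ?thesis unfolding bounded_iff by blast
    qed
    from Liouville_theorem[OF hol bdd] obtain c where c: "\<And>\<mu>. \<phi> \<mu> = c"
      by (auto simp: constant_on_def)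
    define M where "M = K * norm ?y * norm v"
    have cM: "(1 + \<bar>t\<bar>) * cmod c \<le> M" for t
    proof -
      have "c = cinner (R (\<i> * complex_of_real t) ?y) v"
        using c[of "\<i> * complex_of_real t"] \<phi>_strip[of "\<i> * complex_of_real t"] h1 by simp
      then have "(1 + \<bar>t\<bar>) * cmod c \<le> (1 + \<bar>t\<bar>) * (norm (R (\<i> * complex_of_real t) ?y) * norm v)"
        using norm_cinner_le by (intro mult_left_mono) auto
      also have "\<dots> \<le> M"
        using mult_right_mono[OF decay[of t ?y], of "norm v"] by (simp add: M_def mult.assoc)
      finally show ?thesis .
    qed
    have "c = 0"
    proof (rule ccontr)
      assume "c \<noteq> 0"
      then have "(1 + \<bar>M / cmod c\<bar>) * cmod c = cmod c + \<bar>M\<bar>" by (simp add: distrib_right)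
      then have "cmod c + \<bar>M\<bar> \<le> M" using cM[of "M / cmod c"] by simp
      then show False using \<open>c \<noteq> 0\<close> zero_less_norm_iff[of c] by linarith
    qed
    then show ?thesis using c[of 0] \<phi>_strip[of 0] h1 by simp
  qed
  then have "R 0 ?y = R 0 0"
    using cinner_eq_zeroI[of "R 0 ?y"] resolvent_scaleC[OF lin zero_mem, of 0 0] by simp
  then show ?thesis by (simp only: R_zero_eq_iff)
qed

text \<open>
  Defined as a kernel, the subspace is closed; by \<open>P_disjoint\<close> it is also the range of \<open>P s\<close>.
\<close>

definition V where "V s = {x. P (- s) x = 0}"

lemma P_V: "s = 1 \<or> s = -1 \<Longrightarrow> P s x \<in> V s"
  using P_disjoint[of x] P_commute[of 1 "-1" x] by (auto simp: V_def)

lemma V_fix: "x \<in> V s \<Longrightarrow> P s x = x"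
  using P_sum[of s x] by (simp add: V_def)

lemma V_invariant: "u \<in> op_dom S \<Longrightarrow> u \<in> V s \<Longrightarrow> op_app S u \<in> V s"
proof -
  assume u: "u \<in> op_dom S" "u \<in> V s"
  have "R 0 (op_app S u) = u" using resolvent_left[OF zero_mem u(1)] by simp
  then have "R 0 (P (- s) (op_app S u)) = R 0 0"
    using u(2) resolvent_scaleC[OF lin zero_mem, of 0 0] by (simp add: R_P[OF zero_mem] V_def)
  then show ?thesis by (simp add: V_def R_zero_eq_iff)
qed

lemma closed_V: "closed (V s)"
  unfolding V_def
  by (rule closed_Collect_eq[OF linear_continuous_on[OF bounded_linear_P] continuous_on_const])

lemma csubspace_V: "csubspace (V s)"
proof -
  interpret P: bounded_linear "P (- s)" by (rule bounded_linear_P)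
  show ?thesis by (simp add: csubspace_def V_def P.zero P.add P_scaleC)
qed

lemma V_shift: "u \<in> op_dom S \<Longrightarrow> u \<in> V s \<Longrightarrow> op_app S u - z *\<^sub>C u \<in> V s"
  by (intro csubspace_diff csubspace_scaleC csubspace_V V_invariant)

lemma H_V:
  assumes s: "s = 1 \<or> s = -1" "s * Re \<mu> < 0" and y: "y \<in> V s"
  shows "H s \<mu> y \<in> V s"
proof -
  have re: "Re \<mu> \<noteq> 0" using s by auto
  interpret P: bounded_linear "P (- s)" by (rule bounded_linear_P)
  have "G \<mu> (P (- s) y) = P (- s) (G \<mu> y)"
  proof (rule commute_P[OF bounded_linear_G[OF re] G_scaleC[OF re]])
    show "G \<mu> (R (\<i> * complex_of_real t) x) = R (\<i> * complex_of_real t) (G \<mu> x)" for t x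
      by (rule commute_G[OF re bounded_linear_resolvent[OF lin imag_mem] R_imag_scaleC
            resolvent_commute[OF lin imag_mem imag_mem UNIV_I], symmetric])
  qed
  moreover have "G \<mu> 0 = 0" using G_scaleC[OF re, of 0 0] by simp
  ultimately show ?thesis using y by (simp add: V_def H_def P_scaleC)
qed

text \<open>
  From \<open>u = R 0 (y + \<mu> u)\<close> with \<open>y = (S - \<mu>) u\<close> and since \<open>H\<close> commutes with \<open>R 0\<close>, one has
  \<open>H u = R 0 (H y + \<mu> H u)\<close>; comparison with \<open>H_eq\<close> gives \<open>H y = P s u\<close>.
\<close>

lemma H_left_inverse:
  assumes s: "s = 1 \<or> s = -1" "s * Re \<mu> < 0" and u: "u \<in> op_dom S" "u \<in> V s"
  shows "H s \<mu> (op_app S u - \<mu> *\<^sub>C u) = u"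
proof -
  have re: "Re \<mu> \<noteq> 0" using s by auto
  let ?y = "op_app S u - \<mu> *\<^sub>C u"
  have "R 0 (?y + \<mu> *\<^sub>C u) = u" using resolvent_left[OF zero_mem u(1)] by simp
  moreover have "H s \<mu> (R 0 x) = R 0 (H s \<mu> x)" for x
  proof -
    have "R 0 (G \<mu> x) = G \<mu> (R 0 x)"
      by (rule commute_G[OF re bounded_linear_resolvent[OF lin zero_mem]
            resolvent_scaleC[OF lin zero_mem UNIV_I] resolvent_commute[OF lin zero_mem imag_mem UNIV_I]])
    then show ?thesis by (simp add: H_def resolvent_scaleC[OF lin zero_mem])
  qed
  ultimately have "H s \<mu> u = R 0 (H s \<mu> (?y + \<mu> *\<^sub>C u))" by metis
  also have "H s \<mu> (?y + \<mu> *\<^sub>C u) = H s \<mu> ?y + \<mu> *\<^sub>C H s \<mu> u"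
    by (simp only: H_def G_add[OF re] G_scaleC[OF re] scaleC_add_right scaleC_left_commute[of \<mu>])
  finally have "R 0 (P s u + \<mu> *\<^sub>C H s \<mu> u) = R 0 (H s \<mu> ?y + \<mu> *\<^sub>C H s \<mu> u)"
    using H_eq[OF s, of u] by simp
  then show ?thesis using V_fix[OF u(2)] by (simp add: R_zero_eq_iff)
qed

text \<open>
  Off the axis the resolvent of the restriction is \<open>H s \<mu>\<close>, on the axis it is the restriction of \<open>R \<mu>\<close>.
\<close>

lemma spectrum_V:
  assumes s: "s = 1 \<or> s = -1"
  shows "spectrum_on (V s) (op_restrict S (V s)) \<subseteq> {z. 0 < s * Re z}"
proof -
  have "\<mu> \<in> resolvent_set_on (V s) (op_restrict S (V s))" if "s * Re \<mu> < 0" for \<mu>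
  proof (rule resolvent_setI[of _ "H s \<mu>" _ _ "\<kappa> \<mu>"])
    show "norm (H s \<mu> y) \<le> \<kappa> \<mu> * norm y" for y using H_bound[OF s] that by force
  qed (use H_dom[OF s that] H_V[OF s that] V_fix V_shift H_left_inverse[OF s that]
      in \<open>auto simp: op_restrict_def\<close>)
  moreover have "\<mu> \<in> resolvent_set_on (V s) (op_restrict S (V s))" if "s * Re \<mu> = 0" for \<mu>
  proof -
    have "Re \<mu> = 0" using that s by auto
    then have \<mu>: "\<mu> \<in> resolvent_set_on UNIV S" and b: "\<And>x. norm (R \<mu> x) \<le> 2 * K * norm x"
      using strip_mem h strip_bound[of \<mu>] h1 resolvent_norm_le[of \<mu> UNIV S _ "2 * K"] by auto
    have inv: "R \<mu> y \<in> V s" if "y \<in> V s" for y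
    proof -
      have "R \<mu> (P (-s) y) = R \<mu> (0 *\<^sub>C 0)" using that by (simp add: V_def)
      then show ?thesis by (simp only: R_P[OF \<mu>] resolvent_scaleC[OF lin \<mu> UNIV_I]) (simp add: V_def)
    qed
    show ?thesis
      by (rule resolvent_setI[of _ "R \<mu>" _ _ "2 * K"])
        (use resolvent_in_dom[OF \<mu>] resolvent_right[OF \<mu>] resolvent_left[OF \<mu>] inv V_shift b
          in \<open>auto simp: op_restrict_def\<close>)
  qed
  ultimately show ?thesis
    unfolding spectrum_on_def by (auto simp: not_less le_less)
qed

theorem dichotomous_V:
  "dichotomous_wrt S (V 1) (V (-1))"
  "has_pv_integral_imag_axis (\<lambda>z. resolvent S z x) ((pi * \<i>) *\<^sub>C J x)"
  "J x = projection_along (V 1) (V (-1)) x - projection_along (V (-1)) (V 1) x"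
proof -
  have disj: "x = 0" if "x \<in> V 1" "x \<in> V (-1)" for x
    using P_sum[of 1 x] that by (simp add: V_def)
  have comp: "complementary (V 1) (V (-1))"
    unfolding complementary_def
  proof (intro conjI allI csubspace_V)
    show "V 1 \<inter> V (-1) = {0}" using disj csubspace_zero[OF csubspace_V] by auto
    show "\<exists>v\<in>V 1. \<exists>w\<in>V (-1). x = v + w" for x
      using P_V[of 1 x] P_V[of "-1" x] P_sum[of 1 x] by force
  qed
  then show "dichotomous_wrt S (V 1) (V (-1))"
    unfolding dichotomous_wrt_def
    using dense closed_V V_invariant spectrum_V[of 1] spectrum_V[of "-1"] h strip by auto
  show "has_pv_integral_imag_axis (\<lambda>z. resolvent S z x) ((pi * \<i>) *\<^sub>C J x)" by (rule J)
  have proj: "projection_along (V s) (V (-s)) x = P s x" if s: "s = 1 \<or> s = -1" for s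
    unfolding projection_along_def
  proof (rule the_equality)
    have "x - P s x = P (-s) x" using P_sum[of s x] by (simp add: algebra_simps)
    then show "P s x \<in> V s \<and> x - P s x \<in> V (-s)" using P_V[OF s, of x] P_V[of "-s" x] s by auto
    fix v assume v: "v \<in> V s \<and> x - v \<in> V (-s)"
    interpret P: bounded_linear "P s" by (rule bounded_linear_P)
    have "P s (x - v) = 0" using v by (simp add: V_def)
    then show "v = P s x" using V_fix[of v s] v by (simp add: P.diff)
  qed
  show "J x = projection_along (V 1) (V (-1)) x - projection_along (V (-1)) (V 1) x"
    using proj[of 1] proj[of "-1"] P_diff by simp
qed

end

section \<open>Resolvents of sectorially dichotomous operators\<close>

lemma resolvent_set_if_surjective:
  assumes S: "linear_operator_on V S"
    and into: "\<And>u. u \<in> op_dom S \<Longrightarrow> op_app S u - z *\<^sub>C u \<in> V"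
    and surj: "\<And>y. y \<in> V \<Longrightarrow> \<exists>u\<in>op_dom S. op_app S u - z *\<^sub>C u = y"
    and bound: "\<And>u. u \<in> op_dom S \<Longrightarrow> norm u \<le> K * norm (op_app S u - z *\<^sub>C u)"
  shows "z \<in> resolvent_set_on V S"
proof -
  have "inj_on (\<lambda>u. op_app S u - z *\<^sub>C u) (op_dom S)"
  proof (rule inj_onI)
    fix u v assume uv: "u \<in> op_dom S" "v \<in> op_dom S"
      and eq: "op_app S u - z *\<^sub>C u = op_app S v - z *\<^sub>C v"
    have "op_app S (u - v) - z *\<^sub>C (u - v) = (op_app S u - z *\<^sub>C u) - (op_app S v - z *\<^sub>C v)"
      by (simp add: linear_operator_on_diff[OF S uv] scaleC_diff_right)
    then have "op_app S (u - v) - z *\<^sub>C (u - v) = 0" by (simp only: eq diff_self)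
    moreover have "u - v \<in> op_dom S" using csubspace_diff[OF linear_operator_onD(1)[OF S]] uv by blast
    ultimately have "norm (u - v) \<le> K * 0" using bound[of "u - v"] by simp
    then show "u = v" by simp
  qed
  moreover have "(\<lambda>u. op_app S u - z *\<^sub>C u) ` op_dom S = V"
  proof
    show "(\<lambda>u. op_app S u - z *\<^sub>C u) ` op_dom S \<subseteq> V" using into by blast
    show "V \<subseteq> (\<lambda>u. op_app S u - z *\<^sub>C u) ` op_dom S"
    proof
      fix y assume "y \<in> V"
      from surj[OF this] show "y \<in> (\<lambda>u. op_app S u - z *\<^sub>C u) ` op_dom S" by (auto intro: rev_image_eqI)
    qed
  qed
  ultimately show ?thesis using bound unfolding resolvent_set_on_def bij_betw_def by blast
qed

text \<open>
  Close to the origin the bound at \<open>0\<close> is perturbed, away from it the decay in \<open>\<bar>z\<bar>\<close> is used. The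
  threshold \<open>1 / (2 (K + 1))\<close> is such that \<open>\<bar>z\<bar> K \<le> 1 / 2\<close> below it.
\<close>

lemma decay_including_zero:
  fixes S :: "'a::complex_normed_vector operator"
  assumes M: "0 \<le> M" and K: "0 \<le> K"
    and dec: "\<And>z x. z \<in> U \<Longrightarrow> x \<in> op_dom S \<Longrightarrow> cmod z * norm x \<le> M * norm (op_app S x - z *\<^sub>C x)"
    and zero: "\<And>x. x \<in> op_dom S \<Longrightarrow> norm x \<le> K * norm (op_app S x)"
  obtains N where "N \<ge> 0"
    "\<And>z x. z \<in> U \<Longrightarrow> x \<in> op_dom S \<Longrightarrow> (1 + cmod z) * norm x \<le> N * norm (op_app S x - z *\<^sub>C x)"
proof -
  define N where "N = 4 * K + (2 * K + 3) * M"
  have "(1 + cmod z) * norm x \<le> N * norm (op_app S x - z *\<^sub>C x)" if z: "z \<in> U" and x: "x \<in> op_dom S" for z x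
  proof -
    let ?n = "norm (op_app S x - z *\<^sub>C x)"
    have n: "norm x \<le> K * (?n + cmod z * norm x)"
    proof -
      have "norm (op_app S x) \<le> ?n + cmod z * norm x"
        using norm_triangle_ineq[of "op_app S x - z *\<^sub>C x" "z *\<^sub>C x"] by (simp add: norm_scaleC)
      then show ?thesis using zero[OF x] mult_left_mono[OF _ K] order_trans by blast
    qed
    show ?thesis
    proof (cases "cmod z \<le> 1 / (2 * (K + 1))")
      case True
      have "cmod z * K \<le> 1 / (2 * (K + 1)) * K" using True K by (rule mult_right_mono)
      also have "\<dots> \<le> 1/2" using K by (simp add: field_simps)
      finally have "cmod z * K * norm x \<le> 1/2 * norm x" by (rule mult_right_mono) simp
      then have "norm x \<le> 2 * K * ?n" using n by (simp add: distrib_left mult_ac)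
      moreover have "1 / (2 * (K + 1)) \<le> 1" using K by (simp add: field_simps)
      then have "(1 + cmod z) * norm x \<le> 2 * norm x" using True by (intro mult_right_mono) auto
      ultimately have "(1 + cmod z) * norm x \<le> 4 * K * ?n" by simp
      also have "\<dots> \<le> N * ?n" using K M by (intro mult_right_mono) (auto simp: N_def)
      finally show ?thesis .
    next
      case False
      have "1 = (1 / (2 * (K + 1))) * (2 * (K + 1))" using K by simp
      also have "\<dots> \<le> cmod z * (2 * (K + 1))" using False K by (intro mult_right_mono) auto
      finally have "1 + cmod z \<le> (2 * K + 3) * cmod z" by (simp add: algebra_simps)
      then have "(1 + cmod z) * norm x \<le> (2 * K + 3) * cmod z * norm x" by (rule mult_right_mono) simp
      also have "\<dots> \<le> (2 * K + 3) * (M * ?n)"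
        unfolding mult.assoc using dec[OF z x] K by (intro mult_left_mono) auto
      also have "\<dots> \<le> N * ?n" unfolding mult.assoc[symmetric]
        using K M by (intro mult_right_mono) (auto simp: N_def)
      finally show ?thesis .
    qed
  qed
  moreover have "N \<ge> 0" using K M by (simp add: N_def)
  ultimately show ?thesis using that by blast
qed

text \<open>
  The closed left half-plane without the origin lies in \<open>\<bar>Arg z\<bar> \<ge> \<pi> / 2\<close>, outside the sector.
\<close>

lemma sectorial_left_halfplane:
  assumes S: "sectorial_on V S \<theta>" and \<theta>: "\<theta> < pi / 2" and zero: "0 \<in> resolvent_set_on V S"
  obtains M where "M \<ge> 0" "\<And>z. Re z \<le> 0 \<Longrightarrow> z \<in> resolvent_set_on V S"
    "\<And>z x. Re z \<le> 0 \<Longrightarrow> x \<in> op_dom S \<Longrightarrow> (1 + cmod z) * norm x \<le> M * norm (op_app S x - z *\<^sub>C x)"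
proof -
  have lin: "linear_operator_on V S" using S by (auto simp: sectorial_on_def densely_defined_on_def)
  have "\<exists>M>0. \<forall>z. pi/2 \<le> \<bar>Arg z\<bar> \<and> 0 < cmod z \<longrightarrow> (\<forall>y\<in>V. norm (resolvent S z y) \<le> M / cmod z * norm y)"
    using S \<theta> pi_gt_zero unfolding sectorial_on_def by (metis field_sum_of_halves less_add_same_cancel1 half_gt_zero less_imp_le)
  then obtain M where M: "M > 0"
    "\<And>z y. pi/2 \<le> \<bar>Arg z\<bar> \<Longrightarrow> z \<noteq> 0 \<Longrightarrow> y \<in> V \<Longrightarrow> norm (resolvent S z y) \<le> M / cmod z * norm y"
    by auto
  have arg: "pi/2 \<le> \<bar>Arg z\<bar>" if "Re z \<le> 0" "z \<noteq> 0" for z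
    using Arg_Re_pos[of z] that by auto
  have mem: "z \<in> resolvent_set_on V S" if z: "Re z \<le> 0" for z
  proof (cases "z = 0")
    case False
    then have "z \<notin> sector \<theta>" using arg[OF z] \<theta> by (auto simp: sector_def)
    then show ?thesis using S unfolding sectorial_on_def spectrum_on_def by blast
  qed (simp add: zero)
  have dec: "cmod z * norm x \<le> M * norm (op_app S x - z *\<^sub>C x)" if "z \<in> {z. Re z \<le> 0}" "x \<in> op_dom S" for z x
  proof (cases "z = 0")
    case False
    have re: "Re z \<le> 0" using that by simp
    have "norm x \<le> M / cmod z * norm (op_app S x - z *\<^sub>C x)"
      by (rule norm_le_of_resolvent[OF lin mem[OF re] that(2) M(2)[OF arg[OF re False] False]])
    then show ?thesis using False by (simp add: field_simps)
  qed (use M in simp)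
  obtain K0 where K0: "\<And>x. x \<in> op_dom S \<Longrightarrow> norm x \<le> K0 * norm (op_app S x - 0 *\<^sub>C x)"
    using zero by (auto simp: resolvent_set_on_def)
  have K: "norm x \<le> \<bar>K0\<bar> * norm (op_app S x)" if "x \<in> op_dom S" for x
    using K0[OF that] mult_right_mono[OF abs_ge_self[of K0], of "norm (op_app S x)"] by simp
  show ?thesis
  proof (rule decay_including_zero[OF less_imp_le[OF M(1)] abs_ge_zero dec K])
    fix N assume "N \<ge> 0" "\<And>z x. z \<in> {z. Re z \<le> 0} \<Longrightarrow> x \<in> op_dom S \<Longrightarrow>
      (1 + cmod z) * norm x \<le> N * norm (op_app S x - z *\<^sub>C x)"
    then show ?thesis using that[of N] mem by simp
  qed
qed

text \<open>
  A primitive \<open>g\<close> of \<open>f\<close> exists on the closed half-plane, as it is convex. The increment of \<open>g\<close> from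
  \<open>- \<i>\<rho>\<close> to \<open>\<i>\<rho>\<close> is the integral over the segment and also over the left half circle, whose length is
  \<open>\<pi> \<rho>\<close> and on which \<open>f\<close> is at most \<open>B / \<rho>\<close>.
\<close>

lemma norm_imag_axis_integral_le:
  fixes f :: "complex \<Rightarrow> complex"
  assumes hol: "\<And>w. Re w \<le> 0 \<Longrightarrow> (f has_field_derivative f' w) (at w within {z. Re z \<le> 0})"
    and bound: "\<And>z. Re z \<le> 0 \<Longrightarrow> cmod z * cmod (f z) \<le> B" and \<rho>: "\<rho> > 0"
  shows "cmod (imag_integral \<rho> f) \<le> B * pi"
proof -
  let ?U = "{z. Re z \<le> 0}"
  have cont: "continuous_on ?U f" using hol by (auto intro: DERIV_continuous_on)
  have diff: "f field_differentiable at w" if "w \<in> interior ?U - {}" for w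
  proof -
    have w: "w \<in> interior ?U" using that by simp
    have "w \<in> ?U" by (rule subsetD[OF interior_subset w])
    then have "(f has_field_derivative f' w) (at w within ?U)" using hol by simp
    then have "(f has_field_derivative f' w) (at w)" unfolding at_within_interior[OF w] .
    then show ?thesis by (auto simp: field_differentiable_def)
  qed
  have "\<exists>g. \<forall>z\<in>?U. (g has_field_derivative f z) (at z within ?U)"
  proof (rule holomorphic_convex_primitive[OF convex_halfspace_Re_le finite.emptyI cont diff])
    fix g assume "\<And>z. z \<in> ?U \<Longrightarrow> (g has_field_derivative f z) (at z within ?U)"
    then show ?thesis by (intro exI[of _ g] ballI)
  qed
  then obtain g where "\<forall>z\<in>?U. (g has_field_derivative f z) (at z within ?U)" ..
  then have g: "\<And>z. z \<in> ?U \<Longrightarrow> (g has_field_derivative f z) (at z within ?U)" by (rule bspec)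
  have chain: "((\<lambda>t. g (\<gamma> t)) has_vector_derivative \<gamma>' * f (\<gamma> t)) (at t within X)"
    if "(\<gamma> has_vector_derivative \<gamma>') (at t within X)" "t \<in> X" "\<gamma> ` X \<subseteq> ?U" for \<gamma> \<gamma>' t X
    using field_vector_diff_chain_within[OF that(1) DERIV_subset[OF g that(3)]] that by (auto simp: o_def)
  have "((\<lambda>t. \<i> * f (\<i> * complex_of_real t)) has_integral (g (\<i> * complex_of_real \<rho>) - g (\<i> * complex_of_real (-\<rho>)))) {-\<rho>..\<rho>}"
  proof (rule fundamental_theorem_of_calculus)
    fix t assume t: "t \<in> {-\<rho>..\<rho>}"
    have "((\<lambda>t. \<i> * complex_of_real t) has_vector_derivative \<i>) (at t within {-\<rho>..\<rho>})"
      by (auto intro!: derivative_eq_intros has_vector_derivative_real_field)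
    then show "((\<lambda>t. g (\<i> * complex_of_real t)) has_vector_derivative \<i> * f (\<i> * complex_of_real t))
      (at t within {-\<rho>..\<rho>})" by (rule chain[OF _ t]) auto
  qed (use \<rho> in simp)
  then have eq: "imag_integral \<rho> f = g (\<i> * complex_of_real \<rho>) - g (\<i> * complex_of_real (-\<rho>))"
    unfolding scaleC_complex by (rule integral_unique)
  define \<gamma> where "\<gamma> t = complex_of_real \<rho> * exp (\<i> * complex_of_real t)" for t
  have \<gamma>U: "\<gamma> t \<in> ?U" if "t \<in> {pi/2..3*pi/2}" for t
  proof -
    have "cos (t - pi) \<ge> 0" using that by (intro cos_ge_zero) auto
    then show ?thesis using \<rho> by (simp add: \<gamma>_def Re_exp mult_nonneg_nonpos)
  qed
  have \<gamma>': "(\<gamma> has_vector_derivative \<i> * \<gamma> t) (at t within X)" for t X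
    unfolding \<gamma>_def by (auto intro!: derivative_eq_intros has_vector_derivative_real_field)
  have "((\<lambda>t. \<i> * \<gamma> t * f (\<gamma> t)) has_integral (g (\<gamma> (3*pi/2)) - g (\<gamma> (pi/2)))) {pi/2..3*pi/2}"
    by (rule fundamental_theorem_of_calculus[OF _ chain[OF \<gamma>']]) (use \<gamma>U in auto)
  then have "cmod (g (\<gamma> (3*pi/2)) - g (\<gamma> (pi/2))) \<le> B * measure lborel {pi/2..3*pi/2}"
  proof (rule has_integral_bound_real[where S = "{}", rotated 2])
    show "cmod (\<i> * \<gamma> t * f (\<gamma> t)) \<le> B" if "t \<in> {pi/2..3*pi/2} - {}" for t
      using bound[of "\<gamma> t"] \<gamma>U[of t] that by (simp add: norm_mult)
    show "0 \<le> B" using bound[of 0] by simp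
  qed auto
  moreover have "\<gamma> (pi/2) = \<i> * complex_of_real \<rho>"
    unfolding \<gamma>_def cis_conv_exp[symmetric] by simp
  moreover have "\<gamma> (3*pi/2) = \<i> * complex_of_real (- \<rho>)"
  proof -
    have "cis (3*pi/2) = cis pi * cis (pi/2)" unfolding cis_mult by (simp add: field_simps)
    then show ?thesis unfolding \<gamma>_def cis_conv_exp[symmetric] by simp
  qed
  ultimately show ?thesis unfolding eq by (simp add: norm_minus_commute)
qed

lemma sectorial_imag_integral_bounded:
  fixes S :: "'a::complex_hilbert operator"
  assumes S: "sectorial_on V S \<theta>" and \<theta>: "\<theta> < pi / 2" and zero: "0 \<in> resolvent_set_on V S"
  obtains C where "C \<ge> 0"
    "\<And>\<rho> y. \<rho> > 0 \<Longrightarrow> y \<in> V \<Longrightarrow> norm (imag_integral \<rho> (\<lambda>z. resolvent S z y)) \<le> C * norm y"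
proof -
  have lin: "linear_operator_on V S" using S by (auto simp: sectorial_on_def densely_defined_on_def)
  obtain M where M: "M \<ge> 0" and mem: "\<And>z. Re z \<le> 0 \<Longrightarrow> z \<in> resolvent_set_on V S"
    and dec: "\<And>z x. Re z \<le> 0 \<Longrightarrow> x \<in> op_dom S \<Longrightarrow> (1 + cmod z) * norm x \<le> M * norm (op_app S x - z *\<^sub>C x)"
    using sectorial_left_halfplane[OF S \<theta> zero] by blast
  let ?U = "{z. Re z \<le> 0}"
  have U: "?U \<subseteq> resolvent_set_on V S" using mem by auto
  have bnd: "norm x \<le> M * norm (op_app S x - z *\<^sub>C x)" if "z \<in> ?U" "x \<in> op_dom S" for z x
    using dec[of z x] that mult_right_mono[of 1 "1 + cmod z" "norm x"] by simp
  have "norm (imag_integral \<rho> (\<lambda>z. resolvent S z y)) \<le> (M * pi) * norm y" if \<rho>: "\<rho> > 0" and y: "y \<in> V" for \<rho> y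
  proof (rule norm_le_if_cinner_le)
    fix v
    let ?f = "\<lambda>z. cinner (resolvent S z y) v"
    have "continuous_on {-\<rho>..\<rho>} (\<lambda>t. resolvent S (\<i> * complex_of_real t) y)"
      by (rule continuous_on_compose2[OF continuous_on_resolvent[OF lin U y M bnd]])
        (auto intro!: continuous_intros)
    then have int: "(\<lambda>t. \<i> *\<^sub>C resolvent S (\<i> * complex_of_real t) y) integrable_on {-\<rho>..\<rho>}"
      by (intro integrable_continuous_real continuous_intros)
    have "cinner (imag_integral \<rho> (\<lambda>z. resolvent S z y)) v = imag_integral \<rho> ?f"
      using integral_linear[OF int bounded_linear_cinner_left[of v]] by (simp add: o_def cinner_scaleC_left)
    also have "cmod \<dots> \<le> M * norm y * norm v * pi"
    proof (rule norm_imag_axis_integral_le[OF _ _ \<rho>])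
      show "(?f has_field_derivative cinner (resolvent S w (resolvent S w y)) v) (at w within ?U)"
        if "Re w \<le> 0" for w
        by (rule has_field_derivative_cinner_resolvent[OF lin U y M bnd]) (use that in auto)
      show "cmod z * cmod (?f z) \<le> M * norm y * norm v" if z: "Re z \<le> 0" for z
      proof -
        have "(1 + cmod z) * norm (resolvent S z y) \<le> M * norm y"
          using dec[OF z resolvent_in_dom[OF mem[OF z] y]] by (simp add: resolvent_right[OF mem[OF z] y])
        then have "cmod z * norm (resolvent S z y) \<le> M * norm y"
          using mult_right_mono[of "cmod z" "1 + cmod z" "norm (resolvent S z y)"] by simp
        then have "cmod z * norm (resolvent S z y) * norm v \<le> M * norm y * norm v"
          by (rule mult_right_mono) simp
        moreover have "cmod z * cmod (?f z) \<le> cmod z * (norm (resolvent S z y) * norm v)"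
          by (intro mult_left_mono norm_cinner_le) simp
        ultimately show ?thesis by (simp add: mult.assoc)
      qed
    qed
    finally show "cmod (cinner (imag_integral \<rho> (\<lambda>z. resolvent S z y)) v) \<le> M * pi * norm y * norm v"
      by (simp add: mult_ac)
  qed (use M in simp)
  then show ?thesis using that[of "M * pi"] M by simp
qed

lemma op_restrict_simps [simp]:
  "op_dom (op_restrict S V) = op_dom S \<inter> V" "op_app (op_restrict S V) = op_app S"
  "op_dom (op_uminus S) = op_dom S" "op_app (op_uminus S) x = - op_app S x"
  by (auto simp: op_restrict_def op_uminus_def)

lemma resolvent_set_op_uminus:
  assumes S: "linear_operator_on V S" and V: "csubspace V" and z: "- z \<in> resolvent_set_on V S"
  shows "z \<in> resolvent_set_on V (op_uminus S)"
proof -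
  have D: "csubspace (op_dom S)" by (rule linear_operator_onD(1)[OF S])
  have neg: "- x \<in> W" if "csubspace W" "x \<in> W" for x and W :: "'a set"
    using csubspace_scaleC[OF that, of "-1"] by simp
  obtain K where K: "\<And>x. x \<in> op_dom S \<Longrightarrow> norm x \<le> K * norm (op_app S x - (- z) *\<^sub>C x)"
    using z by (auto simp: resolvent_set_on_def)
  have app: "op_app (op_uminus S) x - z *\<^sub>C x = - (op_app S x - (- z) *\<^sub>C x)" for x by simp
  show ?thesis
  proof (rule resolvent_set_if_surjective)
    show "linear_operator_on V (op_uminus S)"
      using S neg[OF V] by (auto simp: linear_operator_on_def)
    show "op_app (op_uminus S) u - z *\<^sub>C u \<in> V" if "u \<in> op_dom (op_uminus S)" for u
    proof -
      have "op_app S u - (- z) *\<^sub>C u \<in> V"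
        using z that by (auto simp: resolvent_set_on_def bij_betw_def)
      then show ?thesis unfolding app by (rule neg[OF V])
    qed
    show "\<exists>u\<in>op_dom (op_uminus S). op_app (op_uminus S) u - z *\<^sub>C u = y" if "y \<in> V" for y
    proof (rule bexI[of _ "resolvent S (- z) (- y)"])
      show "op_app (op_uminus S) (resolvent S (- z) (- y)) - z *\<^sub>C resolvent S (- z) (- y) = y"
        unfolding app resolvent_right[OF z neg[OF V that]] by simp
      show "resolvent S (- z) (- y) \<in> op_dom (op_uminus S)"
        using resolvent_in_dom[OF z neg[OF V that]] by simp
    qed
    show "norm u \<le> K * norm (op_app (op_uminus S) u - z *\<^sub>C u)" if "u \<in> op_dom (op_uminus S)" for u
      unfolding app norm_minus_cancel using K that by simp
  qed
qed

lemma abs_Arg_minus: "z \<noteq> 0 \<Longrightarrow> \<bar>Arg (- z)\<bar> = pi - \<bar>Arg z\<bar>"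
  using Arg_minus[of z] mpi_less_Arg[of z] Arg_le_pi[of z] by auto

lemma complementary_commute: "complementary V W \<Longrightarrow> complementary W V"
  unfolding complementary_def by (metis Int_commute add.commute)

text \<open>
  Everything is glued from the two sectorial operators. Since \<open>0\<close> belongs to all three resolvent sets,
  the domain of \<open>A\<close> splits along \<open>Vp\<close> and \<open>Vm\<close>, which the definition of dichotomy does not state. The
  components are then estimated separately; the projections are bounded by \<open>complementary_bounded\<close>.
\<close>

lemma sectorially_dichotomousD:
  fixes A :: "'a::complex_hilbert operator"
  assumes A: "sectorially_dichotomous A \<theta>"
  shows "densely_defined_on UNIV A"
    and "\<And>t. \<i> * complex_of_real t \<in> resolvent_set_on UNIV A"
    and "\<And>\<theta>'. \<theta> < \<theta>' \<Longrightarrow> \<exists>M\<ge>0. \<forall>z. z \<noteq> 0 \<longrightarrow> \<theta>' \<le> \<bar>Arg z\<bar> \<longrightarrow> \<bar>Arg z\<bar> \<le> pi - \<theta>' \<longrightarrow>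
      z \<in> resolvent_set_on UNIV A \<and> (\<forall>x\<in>op_dom A. cmod z * norm x \<le> M * norm (op_app A x - z *\<^sub>C x))"
    and "\<exists>C\<ge>0. \<forall>\<rho>>0. \<forall>x. norm (imag_integral \<rho> (\<lambda>z. resolvent A z x)) \<le> C * norm x"
proof -
  obtain Vp Vm where dich: "dichotomous_wrt A Vp Vm" and \<theta>: "0 \<le> \<theta>" "\<theta> < pi / 2"
    and sp: "sectorial_on Vp (op_restrict A Vp) \<theta>"
    and sm: "sectorial_on Vm (op_uminus (op_restrict A Vm)) \<theta>"
    using A by (auto simp: sectorially_dichotomous_def)
  let ?P = "op_restrict A Vp" and ?M = "op_uminus (op_restrict A Vm)"
  show dens: "densely_defined_on UNIV A" using dich by (simp add: dichotomous_wrt_def)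
  have lin: "linear_operator_on UNIV A" using dens by (simp add: densely_defined_on_def)
  have linp: "linear_operator_on Vp ?P" and linm: "linear_operator_on Vm ?M"
    using sp sm by (auto simp: sectorial_on_def densely_defined_on_def)
  show imag: "\<i> * complex_of_real t \<in> resolvent_set_on UNIV A" for t
    using dich by (auto simp: dichotomous_wrt_def)
  have zero: "0 \<in> resolvent_set_on UNIV A" using imag[of 0] by simp
  have comp: "complementary Vp Vm" and cl: "closed Vp" "closed Vm"
    using dich by (auto simp: dichotomous_wrt_def)
  then have cs: "csubspace Vp" "csubspace Vm" by (auto simp: complementary_def)
  have "0 \<in> resolvent_set_on Vm (op_restrict A Vm)"
    using dich by (force simp: dichotomous_wrt_def spectrum_on_def)
  moreover have "linear_operator_on Vm (op_restrict A Vm)"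
  proof -
    have "csubspace (op_dom A \<inter> Vm)"
      using cs(2) linear_operator_onD(1)[OF lin] by (auto simp: csubspace_def)
    then show ?thesis
      using lin dich by (auto simp: linear_operator_on_def dichotomous_wrt_def)
  qed
  ultimately have zm: "0 \<in> resolvent_set_on Vm ?M" using resolvent_set_op_uminus[of Vm _ 0] cs by simp
  have zp: "0 \<in> resolvent_set_on Vp ?P"
    using dich by (force simp: dichotomous_wrt_def spectrum_on_def)
  obtain c1 where c1: "c1 \<ge> 0" "\<And>v w. v \<in> Vp \<Longrightarrow> w \<in> Vm \<Longrightarrow> norm v \<le> c1 * norm (v + w)"
    using complementary_bounded[OF cl comp] by blast
  obtain c2 where c2: "c2 \<ge> 0" "\<And>v w. v \<in> Vm \<Longrightarrow> w \<in> Vp \<Longrightarrow> norm v \<le> c2 * norm (v + w)"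
    using complementary_bounded[OF cl(2,1) complementary_commute[OF comp]] by blast
  have split: "\<exists>y1\<in>Vp. \<exists>y2\<in>Vm. y = y1 + y2" for y
    using comp by (simp add: complementary_def)
  have addA: "op_app A (u1 + u2) - z *\<^sub>C (u1 + u2) = (op_app A u1 - z *\<^sub>C u1) + (op_app A u2 - z *\<^sub>C u2)"
    if "u1 \<in> op_dom A" "u2 \<in> op_dom A" for u1 u2 z
    using linear_operator_onD(4)[OF lin that] by (simp add: scaleC_add_right)
  \<comment> \<open>The solution of \<open>(A - z) u = y\<close> for \<open>y\<close> in \<open>Vm\<close>, in terms of the sectorial operator \<open>- A\<close>.\<close>
  have minus: "- resolvent ?M (- z) y \<in> op_dom A" "- resolvent ?M (- z) y \<in> Vm"
    "op_app A (- resolvent ?M (- z) y) - z *\<^sub>C (- resolvent ?M (- z) y) = y"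
    if z: "- z \<in> resolvent_set_on Vm ?M" and y: "y \<in> Vm" for z y
  proof -
    let ?w = "resolvent ?M (- z) y"
    have w: "?w \<in> op_dom A" "?w \<in> Vm" using resolvent_in_dom[OF z y] by auto
    have s: "- ?w = (-1) *\<^sub>C ?w" by simp
    show "- ?w \<in> op_dom A" "- ?w \<in> Vm"
      unfolding s using csubspace_scaleC[OF linear_operator_onD(1)[OF lin] w(1)] csubspace_scaleC[OF cs(2) w(2)]
      by blast+
    have "op_app A (- ?w) = - op_app A ?w"
      unfolding s linear_operator_onD(5)[OF lin w(1)] by simp
    then show "op_app A (- ?w) - z *\<^sub>C (- ?w) = y" using resolvent_right[OF z y] by simp
  qed
  have plus: "resolvent ?P z y \<in> op_dom A" "resolvent ?P z y \<in> Vp"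
    "op_app A (resolvent ?P z y) - z *\<^sub>C resolvent ?P z y = y"
    if z: "z \<in> resolvent_set_on Vp ?P" and y: "y \<in> Vp" for z y
    using resolvent_in_dom[OF z y] resolvent_right[OF z y] by auto
  have dom: "\<exists>u1\<in>op_dom A \<inter> Vp. \<exists>u2\<in>op_dom A \<inter> Vm. u = u1 + u2" if u: "u \<in> op_dom A" for u
  proof -
    obtain y1 y2 where y: "y1 \<in> Vp" "y2 \<in> Vm" "op_app A u = y1 + y2" using split by blast
    let ?u1 = "resolvent ?P 0 y1" and ?u2 = "- resolvent ?M (- 0) y2"
    have z': "- 0 \<in> resolvent_set_on Vm ?M" using zm by simp
    have "op_app A (?u1 + ?u2) - 0 *\<^sub>C (?u1 + ?u2) = op_app A u"
      unfolding addA[OF plus(1)[OF zp y(1)] minus(1)[OF z' y(2)]]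
      using plus(3)[OF zp y(1)] minus(3)[OF z' y(2)] y(3) by simp
    then have "resolvent A 0 (op_app A u) = ?u1 + ?u2"
      by (rule resolvent_eqI[OF zero csubspace_add[OF linear_operator_onD(1)[OF lin]
            plus(1)[OF zp y(1)] minus(1)[OF z' y(2)]]])
    moreover have "resolvent A 0 (op_app A u) = u" using resolvent_left[OF zero u] by simp
    ultimately have "u = ?u1 + ?u2" by simp
    then show ?thesis
      using plus(1,2)[OF zp y(1)] minus(1,2)[OF z' y(2)] by blast
  qed
  show "\<exists>M\<ge>0. \<forall>z. z \<noteq> 0 \<longrightarrow> \<theta>' \<le> \<bar>Arg z\<bar> \<longrightarrow> \<bar>Arg z\<bar> \<le> pi - \<theta>' \<longrightarrow>
      z \<in> resolvent_set_on UNIV A \<and> (\<forall>x\<in>op_dom A. cmod z * norm x \<le> M * norm (op_app A x - z *\<^sub>C x))"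
    if \<theta>': "\<theta> < \<theta>'" for \<theta>'
  proof (cases "\<theta>' \<le> pi")
    case True
    obtain M1 where M1: "M1 > 0" "\<And>z y. \<theta>' \<le> \<bar>Arg z\<bar> \<Longrightarrow> z \<noteq> 0 \<Longrightarrow> y \<in> Vp \<Longrightarrow>
        norm (resolvent ?P z y) \<le> M1 / cmod z * norm y"
      using sp \<theta>' True unfolding sectorial_on_def by (metis zero_less_norm_iff)
    obtain M2 where M2: "M2 > 0" "\<And>z y. \<theta>' \<le> \<bar>Arg z\<bar> \<Longrightarrow> z \<noteq> 0 \<Longrightarrow> y \<in> Vm \<Longrightarrow>
        norm (resolvent ?M z y) \<le> M2 / cmod z * norm y"
      using sm \<theta>' True unfolding sectorial_on_def by (metis zero_less_norm_iff)
    define M where "M = M1 * c1 + M2 * c2"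
    have "z \<in> resolvent_set_on UNIV A \<and> (\<forall>x\<in>op_dom A. cmod z * norm x \<le> M * norm (op_app A x - z *\<^sub>C x))"
      if z: "z \<noteq> 0" "\<theta>' \<le> \<bar>Arg z\<bar>" "\<bar>Arg z\<bar> \<le> pi - \<theta>'" for z
    proof -
      have mz: "- z \<noteq> 0" "\<theta>' \<le> \<bar>Arg (- z)\<bar>" using z by (auto simp: abs_Arg_minus)
      have rp: "z \<in> resolvent_set_on Vp ?P"
        using sp z \<theta>' by (force simp: sectorial_on_def spectrum_on_def sector_def)
      have rm: "- z \<in> resolvent_set_on Vm ?M"
        using sm mz \<theta>' by (force simp: sectorial_on_def spectrum_on_def sector_def)
      have b: "cmod z * norm u \<le> M * norm (op_app A u - z *\<^sub>C u)" if u: "u \<in> op_dom A" for u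
      proof -
        obtain u1 u2 where u12: "u1 \<in> op_dom A" "u1 \<in> Vp" "u2 \<in> op_dom A" "u2 \<in> Vm" "u = u1 + u2"
          using dom[OF u] by blast
        let ?y = "op_app A u - z *\<^sub>C u" and ?y1 = "op_app A u1 - z *\<^sub>C u1" and ?y2 = "op_app A u2 - z *\<^sub>C u2"
        have y: "?y = ?y1 + ?y2" unfolding u12(5) by (rule addA[OF u12(1,3)])
        have "op_app A u1 \<in> Vp" "op_app A u2 \<in> Vm"
          using dich u12 by (auto simp: dichotomous_wrt_def)
        then have yV: "?y1 \<in> Vp" "?y2 \<in> Vm"
          using u12 cs by (auto intro!: csubspace_diff csubspace_scaleC)
        have "norm u1 \<le> M1 / cmod z * norm ?y1"
          using norm_le_of_resolvent[OF linp rp _ M1(2)[OF z(2,1)], of u1] u12 by simp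
        then have "cmod z * norm u1 \<le> M1 * norm ?y1" using z(1) by (simp add: field_simps)
        also have "\<dots> \<le> M1 * (c1 * norm ?y)"
          unfolding y using c1(2)[OF yV] M1(1) by (intro mult_left_mono) auto
        finally have 1: "cmod z * norm u1 \<le> M1 * (c1 * norm ?y)" .
        have "norm u2 \<le> M2 / cmod (- z) * norm (op_app ?M u2 - (- z) *\<^sub>C u2)"
          using norm_le_of_resolvent[OF linm rm _ M2(2)[OF mz(2,1)], of u2] u12 by simp
        moreover have "op_app ?M u2 - (- z) *\<^sub>C u2 = - ?y2" by simp
        ultimately have "norm u2 \<le> M2 / cmod z * norm ?y2" by (simp only: norm_minus_cancel)
        then have "cmod z * norm u2 \<le> M2 * norm ?y2" using z(1) by (simp add: field_simps)
        also have "\<dots> \<le> M2 * (c2 * norm ?y)"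
          unfolding y using c2(2)[OF yV(2,1)] M2(1) by (intro mult_left_mono) (auto simp: add.commute)
        finally have 2: "cmod z * norm u2 \<le> M2 * (c2 * norm ?y)" .
        have "cmod z * norm u \<le> cmod z * norm u1 + cmod z * norm u2"
          unfolding u12(5) distrib_left[symmetric] by (intro mult_left_mono norm_triangle_ineq) simp
        then show ?thesis using 1 2 by (simp add: M_def algebra_simps)
      qed
      have "z \<in> resolvent_set_on UNIV A"
      proof (rule resolvent_set_if_surjective[OF lin UNIV_I])
        show "\<exists>u\<in>op_dom A. op_app A u - z *\<^sub>C u = y" for y
        proof -
          obtain y1 y2 where y: "y1 \<in> Vp" "y2 \<in> Vm" "y = y1 + y2" using split by blast
          let ?u = "resolvent ?P z y1 + (- resolvent ?M (- z) y2)"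
          have "?u \<in> op_dom A"
            using plus(1)[OF rp y(1)] minus(1)[OF rm y(2)] linear_operator_onD(1)[OF lin] csubspace_add by blast
          moreover have "op_app A ?u - z *\<^sub>C ?u = y"
            unfolding addA[OF plus(1)[OF rp y(1)] minus(1)[OF rm y(2)]]
              plus(3)[OF rp y(1)] minus(3)[OF rm y(2)] y(3) by (rule refl)
          ultimately show ?thesis by blast
        qed
        show "norm u \<le> M / cmod z * norm (op_app A u - z *\<^sub>C u)" if "u \<in> op_dom A" for u
          using b[OF that] z(1) by (simp add: field_simps)
      qed
      then show ?thesis using b by blast
    qed
    moreover have "M \<ge> 0" using M1 M2 c1 c2 by (simp add: M_def)
    ultimately show ?thesis by blast
  next
    case False
    have "\<not> (\<theta>' \<le> \<bar>Arg z\<bar>)" for z using False mpi_less_Arg[of z] Arg_le_pi[of z] by linarith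
    then show ?thesis by auto
  qed
  obtain M1 where M1: "M1 \<ge> 0" "\<And>z. Re z \<le> 0 \<Longrightarrow> z \<in> resolvent_set_on Vp ?P"
    "\<And>z x. Re z \<le> 0 \<Longrightarrow> x \<in> op_dom ?P \<Longrightarrow> (1 + cmod z) * norm x \<le> M1 * norm (op_app ?P x - z *\<^sub>C x)"
    using sectorial_left_halfplane[OF sp \<theta>(2) zp] by blast
  obtain M2 where M2: "M2 \<ge> 0" "\<And>z. Re z \<le> 0 \<Longrightarrow> z \<in> resolvent_set_on Vm ?M"
    "\<And>z x. Re z \<le> 0 \<Longrightarrow> x \<in> op_dom ?M \<Longrightarrow> (1 + cmod z) * norm x \<le> M2 * norm (op_app ?M x - z *\<^sub>C x)"
    using sectorial_left_halfplane[OF sm \<theta>(2) zm] by blast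
  obtain C1 where C1: "C1 \<ge> 0"
    "\<And>\<rho> y. \<rho> > 0 \<Longrightarrow> y \<in> Vp \<Longrightarrow> norm (imag_integral \<rho> (\<lambda>z. resolvent ?P z y)) \<le> C1 * norm y"
    using sectorial_imag_integral_bounded[OF sp \<theta>(2) zp] by blast
  obtain C2 where C2: "C2 \<ge> 0"
    "\<And>\<rho> y. \<rho> > 0 \<Longrightarrow> y \<in> Vm \<Longrightarrow> norm (imag_integral \<rho> (\<lambda>z. resolvent ?M z y)) \<le> C2 * norm y"
    using sectorial_imag_integral_bounded[OF sm \<theta>(2) zm] by blast
  have "norm (imag_integral \<rho> (\<lambda>z. resolvent A z x)) \<le> (C1 * c1 + C2 * c2) * norm x" if \<rho>: "\<rho> > 0" for \<rho> x
  proof -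
    obtain x1 x2 where x: "x1 \<in> Vp" "x2 \<in> Vm" "x = x1 + x2" using split by blast
    define f where "f t = \<i> *\<^sub>C resolvent ?P (\<i> * complex_of_real t) x1" for t
    define g where "g t = \<i> *\<^sub>C resolvent ?M (\<i> * complex_of_real t) x2" for t
    have b1: "norm u \<le> M1 * norm (op_app ?P u - z *\<^sub>C u)" if "z \<in> {z. Re z \<le> 0}" "u \<in> op_dom ?P" for z u
      using M1(3)[of z u] that mult_right_mono[of 1 "1 + cmod z" "norm u"] by simp
    have b2: "norm u \<le> M2 * norm (op_app ?M u - z *\<^sub>C u)" if "z \<in> {z. Re z \<le> 0}" "u \<in> op_dom ?M" for z u
      using M2(3)[of z u] that mult_right_mono[of 1 "1 + cmod z" "norm u"] by simp
    have U1: "{z. Re z \<le> 0} \<subseteq> resolvent_set_on Vp ?P" and U2: "{z. Re z \<le> 0} \<subseteq> resolvent_set_on Vm ?M"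
      using M1(2) M2(2) by auto
    have cf: "continuous_on X f" for X unfolding f_def
      by (intro continuous_intros continuous_on_compose2[OF continuous_on_resolvent[OF linp U1 x(1) M1(1) b1]]) auto
    have cg: "continuous_on X g" for X unfolding g_def
      by (intro continuous_intros continuous_on_compose2[OF continuous_on_resolvent[OF linm U2 x(2) M2(1) b2]]) auto
    have fi: "f integrable_on {-\<rho>..\<rho>}" by (rule integrable_continuous_real[OF cf])
    have gi: "(\<lambda>t. g (- t)) integrable_on {-\<rho>..\<rho>}"
      by (intro integrable_continuous_real continuous_on_compose2[OF cg[of UNIV]] continuous_intros) auto
    \<comment> \<open>On \<open>Vm\<close> one has \<open>(A - z)\<inverse> = - (- A - (- z))\<inverse>\<close>, whence the reflected argument of \<open>g\<close>.\<close>
    have eq: "\<i> *\<^sub>C resolvent A (\<i> * complex_of_real t) x = f t - g (- t)" for t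
    proof -
      let ?z = "\<i> * complex_of_real t"
      have rp: "?z \<in> resolvent_set_on Vp ?P" and rm: "- ?z \<in> resolvent_set_on Vm ?M"
        using M1(2)[of ?z] M2(2)[of "- ?z"] by auto
      have "resolvent A ?z x = resolvent ?P ?z x1 + (- resolvent ?M (- ?z) x2)"
      proof (rule resolvent_eqI[OF imag])
        show "resolvent ?P ?z x1 + (- resolvent ?M (- ?z) x2) \<in> op_dom A"
          using plus(1)[OF rp x(1)] minus(1)[OF rm x(2)] linear_operator_onD(1)[OF lin] csubspace_add by blast
        show "op_app A (resolvent ?P ?z x1 + (- resolvent ?M (- ?z) x2))
            - ?z *\<^sub>C (resolvent ?P ?z x1 + (- resolvent ?M (- ?z) x2)) = x"
          unfolding addA[OF plus(1)[OF rp x(1)] minus(1)[OF rm x(2)]]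
            plus(3)[OF rp x(1)] minus(3)[OF rm x(2)] x(3) by (rule refl)
      qed
      then show ?thesis by (simp add: f_def g_def scaleC_diff_right)
    qed
    have "imag_integral \<rho> (\<lambda>z. resolvent A z x) = integral {-\<rho>..\<rho>} f - integral {-\<rho>..\<rho>} (\<lambda>t. g (- t))"
      unfolding eq by (rule integral_diff[OF fi gi])
    also have "integral {-\<rho>..\<rho>} (\<lambda>t. g (- t)) = integral {-\<rho>..\<rho>} g"
      using Henstock_Kurzweil_Integration.integral_reflect_real[of \<rho> "-\<rho>" g] by simp
    finally have "norm (imag_integral \<rho> (\<lambda>z. resolvent A z x)) \<le> norm (integral {-\<rho>..\<rho>} f) + norm (integral {-\<rho>..\<rho>} g)"
      using norm_triangle_ineq4 by simp
    also have "\<dots> \<le> C1 * norm x1 + C2 * norm x2"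
      using C1(2)[OF \<rho> x(1)] C2(2)[OF \<rho> x(2)] unfolding f_def g_def by simp
    also have "\<dots> \<le> C1 * (c1 * norm x) + C2 * (c2 * norm x)"
      using c1(2)[OF x(1,2)] c2(2)[OF x(2,1)] C1(1) C2(1) unfolding x(3)
      by (intro add_mono mult_left_mono) (auto simp: add.commute)
    finally show ?thesis by (simp add: algebra_simps)
  qed
  moreover have "C1 * c1 + C2 * c2 \<ge> 0" using C1(1) C2(1) c1(1) c2(1) by simp
  ultimately show "\<exists>C\<ge>0. \<forall>\<rho>>0. \<forall>x. norm (imag_integral \<rho> (\<lambda>z. resolvent A z x)) \<le> C * norm x"
    by blast
qed

section \<open>Adjoints\<close>

lemma riesz_representation_complex:
  fixes f :: "'a::complex_hilbert \<Rightarrow> complex"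
  assumes f: "bounded_linear f" and scale: "\<And>a x. f (a *\<^sub>C x) = a * f x"
  obtains y where "\<And>x. f x = cinner x y"
proof -
  interpret f: bounded_linear f by (rule f)
  obtain K where K: "\<And>x. norm (f x) \<le> norm x * K" using f.bounded by blast
  obtain y where y: "\<And>x. Re (f x) = inner x y"
  proof (rule riesz_representation[of UNIV "\<lambda>x. Re (f x)" K])
    show "\<bar>Re (f x)\<bar> \<le> K * norm x" for x
      using K[of x] abs_Re_le_cmod[of "f x"] by (simp add: mult.commute)
  qed (auto simp: f.add f.scaleR)
  have "f x = cinner x y" for x
  proof (rule complex_eqI)
    show "Re (f x) = Re (cinner x y)" using y by (simp add: inner_eq_Re_cinner)
    have "Re (f (\<i> *\<^sub>C x)) = Re (cinner (\<i> *\<^sub>C x) y)" using y by (simp add: inner_eq_Re_cinner)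
    then show "Im (f x) = Im (cinner x y)" by (simp add: scale cinner_scaleC_left)
  qed
  then show ?thesis by (rule that)
qed

lemma cinner_right_unique:
  fixes x y :: "'a::complex_inner"
  assumes D: "UNIV \<subseteq> closure D" and eq: "\<And>u. u \<in> D \<Longrightarrow> cinner u x = cinner u y"
  shows "x = y"
proof -
  have "closed {u. cinner u (x - y) = 0}"
    by (rule closed_Collect_eq[OF linear_continuous_on[OF bounded_linear_cinner_left] continuous_on_const])
  moreover have "D \<subseteq> {u. cinner u (x - y) = 0}" using eq by (auto simp: cinner_diff_right)
  ultimately have "closure D \<subseteq> {u. cinner u (x - y) = 0}" by (rule closure_minimal[rotated])
  then have "x - y \<in> {u. cinner u (x - y) = 0}" using D by blast
  then show ?thesis by (simp add: cinner_self)
qed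

lemma adjoint_op_eqI:
  fixes A :: "'a::complex_inner operator"
  assumes A: "densely_defined_on UNIV A"
    and y: "\<And>x. x \<in> op_dom A \<Longrightarrow> cinner (op_app A x) y = cinner x z"
  shows "y \<in> op_dom (adjoint_op A)" "op_app (adjoint_op A) y = z"
proof -
  show "y \<in> op_dom (adjoint_op A)" using y by (auto simp: adjoint_op_def)
  have "(THE z. \<forall>x\<in>op_dom A. cinner (op_app A x) y = cinner x z) = z"
  proof (rule the_equality)
    fix z' assume z': "\<forall>x\<in>op_dom A. cinner (op_app A x) y = cinner x z'"
    show "z' = z"
      by (rule cinner_right_unique[of "op_dom A"])
        (use A z' y in \<open>auto simp: densely_defined_on_def\<close>)
  qed (use y in blast)
  then show "op_app (adjoint_op A) y = z" by (simp add: adjoint_op_def)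
qed

lemma cinner_adjoint_op:
  fixes A :: "'a::complex_inner operator"
  assumes A: "densely_defined_on UNIV A" and x: "x \<in> op_dom A" and y: "y \<in> op_dom (adjoint_op A)"
  shows "cinner (op_app A x) y = cinner x (op_app (adjoint_op A) y)"
proof -
  obtain z where z: "\<And>x. x \<in> op_dom A \<Longrightarrow> cinner (op_app A x) y = cinner x z"
    using y by (auto simp: adjoint_op_def)
  then show ?thesis using adjoint_op_eqI(2)[OF A z] x by simp
qed

lemma linear_operator_on_adjoint_op:
  fixes A :: "'a::complex_inner operator"
  assumes A: "densely_defined_on UNIV A"
  shows "linear_operator_on UNIV (adjoint_op A)"
proof -
  let ?B = "adjoint_op A"
  have 0: "0 \<in> op_dom ?B"
    by (rule adjoint_op_eqI(1)[OF A, of 0 0]) simp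
  have add: "x + y \<in> op_dom ?B" "op_app ?B (x + y) = op_app ?B x + op_app ?B y"
    if "x \<in> op_dom ?B" "y \<in> op_dom ?B" for x y
    by (rule adjoint_op_eqI[OF A, of "x + y" "op_app ?B x + op_app ?B y"];
        simp add: cinner_add_right cinner_adjoint_op[OF A _ that(1)] cinner_adjoint_op[OF A _ that(2)])+
  have scale: "a *\<^sub>C x \<in> op_dom ?B" "op_app ?B (a *\<^sub>C x) = a *\<^sub>C op_app ?B x"
    if "x \<in> op_dom ?B" for a x
    by (rule adjoint_op_eqI[OF A, of "a *\<^sub>C x" "a *\<^sub>C op_app ?B x"];
        simp add: cinner_scaleC_right cinner_adjoint_op[OF A _ that])+
  show ?thesis
    unfolding linear_operator_on_def csubspace_def using 0 add scale by blast
qed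

text \<open>
  The identity \<open>\<langle>(A - z) x, y\<rangle> = \<langle>x, (A\<^sup>* - cnj z) y\<rangle>\<close> with \<open>x = (A - z)\<inverse> v\<close> gives the lower bound for
  \<open>A\<^sup>* - cnj z\<close>. A solution of \<open>(A\<^sup>* - cnj z) y = v\<close> is the vector that represents the bounded functional
  \<open>x \<mapsto> \<langle>(A - z)\<inverse> x, v\<rangle>\<close>.
\<close>

lemma adjoint_resolvent:
  fixes A :: "'a::complex_hilbert operator"
  assumes A: "densely_defined_on UNIV A" and z: "z \<in> resolvent_set_on UNIV A" and N: "0 \<le> N"
    and bound: "\<And>x. x \<in> op_dom A \<Longrightarrow> norm x \<le> N * norm (op_app A x - z *\<^sub>C x)"
  shows "cnj z \<in> resolvent_set_on UNIV (adjoint_op A)"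
    and "y \<in> op_dom (adjoint_op A) \<Longrightarrow> norm y \<le> N * norm (op_app (adjoint_op A) y - cnj z *\<^sub>C y)"
    and "cinner (resolvent A z x) v = cinner x (resolvent (adjoint_op A) (cnj z) v)"
proof -
  let ?B = "adjoint_op A"
  have lin: "linear_operator_on UNIV A" using A by (simp add: densely_defined_on_def)
  have shift: "cinner (op_app A x - z *\<^sub>C x) y = cinner x (op_app ?B y - cnj z *\<^sub>C y)"
    if "x \<in> op_dom A" "y \<in> op_dom ?B" for x y
    using cinner_adjoint_op[OF A that]
    by (simp add: cinner_diff_left cinner_diff_right cinner_scaleC_left cinner_scaleC_right)
  have bnd: "norm y \<le> N * norm (op_app ?B y - cnj z *\<^sub>C y)" if y: "y \<in> op_dom ?B" for y
  proof (rule norm_le_if_cinner_le)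
    fix v
    let ?x = "resolvent A z v"
    have x: "?x \<in> op_dom A" by (rule resolvent_in_dom[OF z UNIV_I])
    have "cinner v y = cinner ?x (op_app ?B y - cnj z *\<^sub>C y)"
      using shift[OF x y] resolvent_right[OF z UNIV_I, of v] by simp
    then have "cmod (cinner y v) = cmod (cinner ?x (op_app ?B y - cnj z *\<^sub>C y))"
      by (metis cinner_commute complex_mod_cnj)
    also have "\<dots> \<le> norm ?x * norm (op_app ?B y - cnj z *\<^sub>C y)" by (rule norm_cinner_le)
    also have "\<dots> \<le> (N * norm v) * norm (op_app ?B y - cnj z *\<^sub>C y)"
      by (intro mult_right_mono resolvent_norm_le[OF z UNIV_I bound]) auto
    finally show "cmod (cinner y v) \<le> N * norm (op_app ?B y - cnj z *\<^sub>C y) * norm v"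
      by (simp add: mult_ac)
  qed (use N in simp)
  then show "y \<in> op_dom ?B \<Longrightarrow> norm y \<le> N * norm (op_app ?B y - cnj z *\<^sub>C y)" .
  have surj: "\<exists>y\<in>op_dom ?B. op_app ?B y - cnj z *\<^sub>C y = v" for v
  proof -
    obtain y where y: "\<And>x. cinner (resolvent A z x) v = cinner x y"
    proof (rule riesz_representation_complex[of "\<lambda>x. cinner (resolvent A z x) v"])
      show "bounded_linear (\<lambda>x. cinner (resolvent A z x) v)"
        by (rule bounded_linear_compose[OF bounded_linear_cinner_left bounded_linear_resolvent[OF lin z]])
    qed (auto simp: resolvent_scaleC[OF lin z] cinner_scaleC_left)
    have *: "cinner (op_app A x) y = cinner x (v + cnj z *\<^sub>C y)" if x: "x \<in> op_dom A" for x
    proof -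
      have "cinner x v = cinner (op_app A x - z *\<^sub>C x) y"
        using y[of "op_app A x - z *\<^sub>C x"] resolvent_left[OF z x] by simp
      then show ?thesis
        by (simp add: cinner_diff_left cinner_add_right cinner_scaleC_left cinner_scaleC_right)
    qed
    show ?thesis
      by (rule bexI[of _ y]) (use adjoint_op_eqI[OF A *] in auto)
  qed
  show mem: "cnj z \<in> resolvent_set_on UNIV ?B"
    by (rule resolvent_set_if_surjective[OF linear_operator_on_adjoint_op[OF A] UNIV_I surj bnd])
  show "cinner (resolvent A z x) v = cinner x (resolvent ?B (cnj z) v)"
    using shift[OF resolvent_in_dom[OF z UNIV_I] resolvent_in_dom[OF mem UNIV_I], of x v]
    by (simp add: resolvent_right[OF z UNIV_I] resolvent_right[OF mem UNIV_I])
qed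

lemma subspace_closure:
  fixes D :: "'a::real_normed_vector set"
  assumes D: "subspace D"
  shows "subspace (closure D)"
proof (rule subspaceI)
  show "0 \<in> closure D" using subspace_0[OF D] closure_subset by (rule subsetD[rotated])
  show "x + y \<in> closure D" if xy: "x \<in> closure D" "y \<in> closure D" for x y
  proof -
    obtain f where f: "\<And>n. f n \<in> D" "f \<longlonglongrightarrow> x"
      using xy(1) unfolding closure_sequential by blast
    obtain g where g: "\<And>n. g n \<in> D" "g \<longlonglongrightarrow> y"
      using xy(2) unfolding closure_sequential by blast
    show ?thesis unfolding closure_sequential
      using subspace_add[OF D f(1) g(1)] tendsto_add[OF f(2) g(2)] by (intro exI[of _ "\<lambda>n. f n + g n"]) simp
  qed
  show "c *\<^sub>R x \<in> closure D" if x: "x \<in> closure D" for c x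
  proof -
    obtain f where f: "\<And>n. f n \<in> D" "f \<longlonglongrightarrow> x"
      using x unfolding closure_sequential by blast
    show ?thesis unfolding closure_sequential
      using subspace_scale[OF D f(1)] tendsto_scaleR[OF tendsto_const[of c] f(2)]
      by (intro exI[of _ "\<lambda>n. c *\<^sub>R f n"]) simp
  qed
qed

text \<open>
  If \<open>m\<close> represents \<open>\<langle>-, x0\<rangle>\<close> on the closure of \<open>D\<close>, then \<open>x0 - m\<close> is orthogonal to \<open>D\<close>. Orthogonality
  for the complex inner product follows from the real one by testing with \<open>\<i> x\<close> as well.
\<close>

lemma dense_subspaceI:
  fixes D :: "'a::complex_hilbert set"
  assumes D: "csubspace D" and orth: "\<And>u. (\<And>x. x \<in> D \<Longrightarrow> cinner x u = 0) \<Longrightarrow> u = 0"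
  shows "UNIV \<subseteq> closure D"
proof
  fix x0 :: 'a
  have sub: "subspace (closure D)" by (rule subspace_closure[OF csubspace_imp_subspace[OF D]])
  obtain m where m: "m \<in> closure D" "\<And>x. x \<in> closure D \<Longrightarrow> inner x x0 = inner x m"
  proof (rule riesz_representation[of "closure D" "\<lambda>x. inner x x0" "norm x0"])
    show "\<bar>inner x x0\<bar> \<le> norm x0 * norm x" for x
      using Cauchy_Schwarz_ineq2[of x x0] by (simp add: mult.commute)
  qed (use sub in \<open>auto simp: inner_add_left\<close>)
  have re: "Re (cinner x (x0 - m)) = 0" if "x \<in> D" for x
    using m(2)[of x] that closure_subset[of D] by (auto simp: inner_eq_Re_cinner[symmetric] inner_diff_right)
  have "cinner x (x0 - m) = 0" if x: "x \<in> D" for x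
  proof (rule complex_eqI)
    show "Re (cinner x (x0 - m)) = Re 0" using re[OF x] by simp
    have "Re (cinner (\<i> *\<^sub>C x) (x0 - m)) = 0" by (rule re[OF csubspace_scaleC[OF D x]])
    then show "Im (cinner x (x0 - m)) = Im 0" by (simp add: cinner_scaleC_left)
  qed
  then have "x0 - m = 0" by (rule orth)
  then show "x0 \<in> closure D" using m(1) by simp
qed

text \<open>
  The domain of \<open>A\<^sup>*\<close> is the range of \<open>((A - z)\<inverse>)\<^sup>*\<close>, and a vector orthogonal to it is annihilated by
  the injective operator \<open>(A - z)\<inverse>\<close>.
\<close>

lemma densely_defined_adjoint_op:
  fixes A :: "'a::complex_hilbert operator"
  assumes A: "densely_defined_on UNIV A" and z: "z \<in> resolvent_set_on UNIV A"
  shows "densely_defined_on UNIV (adjoint_op A)"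
  unfolding densely_defined_on_def
proof
  let ?B = "adjoint_op A"
  show lin: "linear_operator_on UNIV ?B" by (rule linear_operator_on_adjoint_op[OF A])
  have linA: "linear_operator_on UNIV A" using A by (simp add: densely_defined_on_def)
  obtain K where K: "\<And>x. x \<in> op_dom A \<Longrightarrow> norm x \<le> K * norm (op_app A x - z *\<^sub>C x)"
    using z by (auto simp: resolvent_set_on_def)
  have K': "norm x \<le> \<bar>K\<bar> * norm (op_app A x - z *\<^sub>C x)" if "x \<in> op_dom A" for x
    using K[OF that] mult_right_mono[OF abs_ge_self[of K], of "norm (op_app A x - z *\<^sub>C x)"] by simp
  note adj = adjoint_resolvent[OF A z abs_ge_zero K']
  show "UNIV \<subseteq> closure (op_dom ?B)"
  proof (rule dense_subspaceI[OF linear_operator_onD(1)[OF lin]])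
    fix u assume u: "\<And>x. x \<in> op_dom ?B \<Longrightarrow> cinner x u = 0"
    have "cinner (resolvent A z u) v = 0" for v
    proof -
      have "cinner (resolvent ?B (cnj z) v) u = 0" by (rule u[OF resolvent_in_dom[OF adj(1) UNIV_I]])
      then have "cinner u (resolvent ?B (cnj z) v) = 0"
        using cinner_commute[of u "resolvent ?B (cnj z) v"] by simp
      then show ?thesis using adj(3)[of u v] by simp
    qed
    then have "resolvent A z u = 0" by (rule cinner_eq_zeroI)
    then have "op_app A 0 - z *\<^sub>C 0 = u" using resolvent_right[OF z UNIV_I, of u] by simp
    moreover have "op_app A (0 *\<^sub>C 0) = 0 *\<^sub>C op_app A 0"
      using linear_operator_onD(5)[OF linA csubspace_zero[OF linear_operator_onD(1)[OF linA]]] .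
    ultimately show "u = 0" by simp
  qed
qed

text \<open>
  On the imaginary axis \<open>- z = cnj z\<close>, so up to a sign the integral is the adjoint of the truncated
  integral of \<open>(A - z)\<inverse>\<close> and has the same norm. Only the bound is transported, since
  strong convergence need not survive passage to adjoints.
\<close>

lemma imag_integral_adjoint_resolvent_le:
  fixes A :: "'a::complex_hilbert operator"
  assumes A: "densely_defined_on UNIV A" and imag: "\<And>t. \<i> * complex_of_real t \<in> resolvent_set_on UNIV A"
    and N: "0 \<le> N"
    and bound: "\<And>t x. x \<in> op_dom A \<Longrightarrow> norm x \<le> N * norm (op_app A x - (\<i> * complex_of_real t) *\<^sub>C x)"
    and C: "0 \<le> C" "\<And>x. norm (imag_integral \<rho> (\<lambda>z. resolvent A z x)) \<le> C * norm x"
  shows "norm (imag_integral \<rho> (\<lambda>z. resolvent (adjoint_op A) (- z) y)) \<le> C * norm y"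
proof (rule norm_le_if_cinner_le)
  let ?B = "adjoint_op A"
  have lin: "linear_operator_on UNIV A" and linB: "linear_operator_on UNIV ?B"
    using A linear_operator_on_adjoint_op[OF A] by (auto simp: densely_defined_on_def)
  have cnj: "cnj (\<i> * complex_of_real t) = - (\<i> * complex_of_real t)" for t by simp
  note adj = adjoint_resolvent[OF A imag N bound, unfolded cnj]
  let ?U = "range (\<lambda>t. \<i> * complex_of_real t)" and ?W = "range (\<lambda>t. - (\<i> * complex_of_real t))"
  have U: "?U \<subseteq> resolvent_set_on UNIV A" and W: "?W \<subseteq> resolvent_set_on UNIV ?B"
    using imag adj(1) by auto
  have bU: "norm x \<le> N * norm (op_app A x - z *\<^sub>C x)" if "z \<in> ?U" "x \<in> op_dom A" for z x
    using that bound by auto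
  have bW: "norm x \<le> N * norm (op_app ?B x - z *\<^sub>C x)" if "z \<in> ?W" "x \<in> op_dom ?B" for z x
    using that adj(2) by auto
  have intA: "(\<lambda>t. \<i> *\<^sub>C resolvent A (\<i> * complex_of_real t) x) integrable_on {-\<rho>..\<rho>}" for x
    by (intro integrable_continuous_real continuous_intros
        continuous_on_compose2[OF continuous_on_resolvent[OF lin U UNIV_I N bU]]) auto
  have intB: "(\<lambda>t. \<i> *\<^sub>C resolvent ?B (- (\<i> * complex_of_real t)) y) integrable_on {-\<rho>..\<rho>}"
    by (intro integrable_continuous_real continuous_intros
        continuous_on_compose2[OF continuous_on_resolvent[OF linB W UNIV_I N bW]]) auto
  fix v
  have "cinner v (imag_integral \<rho> (\<lambda>z. resolvent ?B (- z) y))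
      = integral {-\<rho>..\<rho>} (\<lambda>t. cinner v (\<i> *\<^sub>C resolvent ?B (- (\<i> * complex_of_real t)) y))"
    using integral_linear[OF intB bounded_linear_cinner_right[of v]] by (simp add: o_def)
  also have "\<dots> = integral {-\<rho>..\<rho>} (\<lambda>t. - cinner (\<i> *\<^sub>C resolvent A (\<i> * complex_of_real t) v) y)"
    by (simp add: cinner_scaleC_left cinner_scaleC_right adj(3))
  also have "\<dots> = - cinner (imag_integral \<rho> (\<lambda>z. resolvent A z v)) y"
    using integral_linear[OF intA[of v] bounded_linear_cinner_left[of y]] by (simp add: o_def)
  finally have "cmod (cinner (imag_integral \<rho> (\<lambda>z. resolvent ?B (- z) y)) v)
      = cmod (cinner (imag_integral \<rho> (\<lambda>z. resolvent A z v)) y)"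
    by (metis cinner_commute complex_mod_cnj norm_minus_cancel)
  also have "\<dots> \<le> norm (imag_integral \<rho> (\<lambda>z. resolvent A z v)) * norm y" by (rule norm_cinner_le)
  also have "\<dots> \<le> (C * norm v) * norm y" by (intro mult_right_mono C) auto
  finally show "cmod (cinner (imag_integral \<rho> (\<lambda>z. resolvent ?B (- z) y)) v) \<le> C * norm y * norm v"
    by (simp add: mult_ac)
qed (use C in simp)

section \<open>Estimates for subordinate and nonnegative perturbations\<close>

lemma rpow_nonneg: "0 \<le> rpow a p"
  by (simp add: rpow_def)

lemma rpow_mono: "0 \<le> a \<Longrightarrow> a \<le> b \<Longrightarrow> 0 \<le> p \<Longrightarrow> rpow a p \<le> rpow b p"
  by (simp add: rpow_def powr_mono2)

lemma rpow_mult: "0 \<le> a \<Longrightarrow> 0 \<le> b \<Longrightarrow> rpow (a * b) p = rpow a p * rpow b p"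
  by (simp add: rpow_def powr_mult)

lemma rpow_split: "0 \<le> a \<Longrightarrow> p < 1 \<Longrightarrow> rpow a (1 - p) * rpow a p = a"
  by (cases "a = 0") (auto simp: rpow_def powr_add[symmetric])

text \<open>
  Here \<open>N\<close> bounds \<open>(S - z)\<inverse>\<close>, so \<open>S (S - z)\<inverse> = 1 + z (S - z)\<inverse>\<close> is bounded by \<open>1 + M\<close>. For \<open>N\<close> of
  order \<open>1 / \<bar>z\<bar>\<close> the relative bound of \<open>R\<close> tends to zero because \<open>p < 1\<close>.
\<close>

lemma subordinate_estimate:
  fixes R S :: "'a::complex_normed_vector operator"
  assumes R: "subordinate p R S" and p: "p < 1"
  obtains c where "c \<ge> 0"
    "\<And>x z N M. x \<in> op_dom S \<Longrightarrow> 0 \<le> N \<Longrightarrow> cmod z * N \<le> M \<Longrightarrow>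
      norm x \<le> N * norm (op_app S x - z *\<^sub>C x) \<Longrightarrow>
      norm (op_app R x) \<le> c * rpow N (1 - p) * rpow (1 + M) p * norm (op_app S x - z *\<^sub>C x)"
proof -
  have p0: "0 \<le> p" using R by (simp add: subordinate_def)
  obtain c where c: "c \<ge> 0"
    "\<And>x. x \<in> op_dom S \<Longrightarrow> norm (op_app R x) \<le> c * rpow (norm x) (1 - p) * rpow (norm (op_app S x)) p"
    using R by (auto simp: subordinate_def)
  have "norm (op_app R x) \<le> c * rpow N (1 - p) * rpow (1 + M) p * norm (op_app S x - z *\<^sub>C x)"
    if x: "x \<in> op_dom S" and N: "0 \<le> N" "cmod z * N \<le> M"
      and le: "norm x \<le> N * norm (op_app S x - z *\<^sub>C x)" for x z N M
  proof -
    let ?n = "norm (op_app S x - z *\<^sub>C x)"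
    have M: "0 \<le> M" using N by (meson mult_nonneg_nonneg norm_ge_zero order_trans)
    have "norm (op_app S x) \<le> ?n + cmod z * norm x"
      using norm_triangle_ineq[of "op_app S x - z *\<^sub>C x" "z *\<^sub>C x"] by (simp add: norm_scaleC)
    also have "cmod z * norm x \<le> cmod z * (N * ?n)" using le by (simp add: mult_left_mono)
    also have "\<dots> \<le> M * ?n" unfolding mult.assoc[symmetric] using N(2) by (rule mult_right_mono) simp
    finally have Sx: "norm (op_app S x) \<le> (1 + M) * ?n" by (simp add: algebra_simps)
    have "norm (op_app R x) \<le> c * rpow (norm x) (1 - p) * rpow (norm (op_app S x)) p" by (rule c(2)[OF x])
    also have "\<dots> \<le> c * rpow (N * ?n) (1 - p) * rpow ((1 + M) * ?n) p"
      using c(1) p p0 le Sx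
      by (intro mult_mono mult_left_mono rpow_mono mult_nonneg_nonneg rpow_nonneg) auto
    also have "\<dots> = c * rpow N (1 - p) * rpow (1 + M) p * (rpow ?n (1 - p) * rpow ?n p)"
      using N(1) M by (simp add: rpow_mult mult_ac)
    finally show ?thesis by (simp only: rpow_split[OF norm_ge_zero p])
  qed
  then show ?thesis using that c(1) by blast
qed

lemma quadratic_nonneg_imp:
  fixes a b r :: real
  assumes "\<And>t. 0 \<le> a + 2 * t * r + t\<^sup>2 * b" and b: "0 \<le> b"
  shows "r\<^sup>2 \<le> a * b"
proof (cases "b = 0")
  case True
  have "r = 0"
  proof (rule ccontr)
    assume "r \<noteq> 0"
    then show False using assms(1)[of "- (a + 1) / (2 * r)"] True by (simp add: field_simps)
  qed
  then show ?thesis using True by simp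
next
  case False
  then have "b > 0" using b by simp
  have "0 \<le> a + 2 * (- r / b) * r + (- r / b)\<^sup>2 * b" by (rule assms(1))
  also have "\<dots> = a - r\<^sup>2 / b" using False by (simp add: field_simps power2_eq_square)
  finally show ?thesis using \<open>b > 0\<close> by (simp add: field_simps)
qed

lemma nonnegative_cauchy_schwarz:
  fixes B :: "'a::complex_inner operator"
  assumes lin: "linear_operator_on UNIV B" and sym: "symmetric_operator B" and pos: "nonnegative_operator B"
    and x: "x \<in> op_dom B" and y: "y \<in> op_dom B"
  shows "(cmod (cinner (op_app B x) y))\<^sup>2 \<le> Re (cinner (op_app B x) x) * Re (cinner (op_app B y) y)"
proof -
  let ?s = "cinner (op_app B x) y"
  \<comment> \<open>A rotation of \<open>y\<close> makes the mixed term real, and a real parameter \<open>t\<close> suffices.\<close>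
  define a where "a = (if ?s = 0 then 1 else sgn ?s)"
  have na: "cmod a = 1" by (simp add: a_def norm_sgn)
  define v where "v = a *\<^sub>C y"
  have vd: "v \<in> op_dom B" unfolding v_def by (rule csubspace_scaleC[OF linear_operator_onD(1)[OF lin] y])
  have Bv: "op_app B v = a *\<^sub>C op_app B y" unfolding v_def by (rule linear_operator_onD(5)[OF lin y])
  have xv: "cinner (op_app B x) v = complex_of_real (cmod ?s)"
  proof (cases "?s = 0")
    case False
    have "cnj (sgn ?s) * ?s = complex_of_real (cmod ?s)"
      using complex_norm_square[of ?s] False by (simp add: sgn_div_norm scaleR_conv_of_real power2_eq_square field_simps)
    then show ?thesis using False by (simp add: v_def a_def cinner_scaleC_right)
  qed (simp add: v_def cinner_scaleC_right)
  have vx: "cinner (op_app B v) x = complex_of_real (cmod ?s)"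
    using sym vd x xv cinner_commute[of v "op_app B x"] by (simp add: symmetric_operator_def)
  have vv: "cinner (op_app B v) v = cinner (op_app B y) y"
    using na complex_norm_square[of a]
    by (simp add: Bv cinner_scaleC_left) (simp add: v_def cinner_scaleC_right mult.assoc[symmetric])
  have "0 \<le> Re (cinner (op_app B x) x) + 2 * t * cmod ?s + t\<^sup>2 * Re (cinner (op_app B y) y)" for t
  proof -
    let ?t = "complex_of_real t"
    have tv: "?t *\<^sub>C v \<in> op_dom B" by (rule csubspace_scaleC[OF linear_operator_onD(1)[OF lin] vd])
    have "x + ?t *\<^sub>C v \<in> op_dom B" by (rule csubspace_add[OF linear_operator_onD(1)[OF lin] x tv])
    then have "0 \<le> Re (cinner (op_app B (x + ?t *\<^sub>C v)) (x + ?t *\<^sub>C v))"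
      using pos by (auto simp: nonnegative_operator_def complex_nonneg_Reals_iff)
    also have "op_app B (x + ?t *\<^sub>C v) = op_app B x + ?t *\<^sub>C op_app B v"
      by (simp add: linear_operator_onD(4)[OF lin x tv] linear_operator_onD(5)[OF lin vd])
    finally show ?thesis
      by (simp add: cinner_add_left cinner_add_right cinner_scaleC_left cinner_scaleC_right xv vx vv
          power2_eq_square algebra_simps)
  qed
  moreover have "0 \<le> Re (cinner (op_app B y) y)"
    using pos y by (auto simp: nonnegative_operator_def complex_nonneg_Reals_iff)
  ultimately show ?thesis by (rule quadratic_nonneg_imp)
qed

text \<open>
  Cauchy-Schwarz for the form of \<open>B\<close> bounds \<open>\<bar>\<langle>B y, w\<rangle>\<bar>\<^sup>2\<close> by \<open>2 e U q N \<parallel>x\<parallel>\<^sup>2\<close>. Since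
  \<open>2 q N e U = 4 (4 q N e) (U / 8)\<close>, the geometric mean of \<open>4 q N e\<close> and \<open>U / 8\<close> appears, and the weight
  \<open>1 / 8\<close> lets the part in \<open>U\<close> be absorbed when the estimates for both components are added.
\<close>

lemma component_estimate:
  fixes B :: "'a::complex_inner operator"
  assumes lin: "linear_operator_on UNIV B" and sym: "symmetric_operator B" and pos: "nonnegative_operator B"
    and y: "y \<in> op_dom B" and w: "w \<in> op_dom B"
    and Nq: "0 \<le> N" "0 \<le> q" "norm w \<le> N * norm x" "norm (op_app B w) \<le> q * norm x"
    and \<beta>: "Re (cinner (op_app B y) y) \<le> 2 * e * U" and eU: "0 \<le> e" "0 \<le> U"
    and le: "(norm x)\<^sup>2 \<le> e * norm w + cmod (cinner (op_app B y) w)"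
  shows "norm x \<le> N * e + (4 * q * N * e + U / 8)"
proof (cases "x = 0")
  case True
  then show ?thesis using Nq eU by simp
next
  case False
  have \<beta>0: "0 \<le> Re (cinner (op_app B y) y)"
    using pos y by (auto simp: nonnegative_operator_def complex_nonneg_Reals_iff)
  have "Re (cinner (op_app B w) w) \<le> norm (op_app B w) * norm w"
    using complex_Re_le_cmod norm_cinner_le order_trans by blast
  also have "\<dots> \<le> (q * norm x) * (N * norm x)" using Nq by (intro mult_mono) auto
  finally have Bw: "Re (cinner (op_app B w) w) \<le> (q * norm x) * (N * norm x)" .
  have "(cmod (cinner (op_app B y) w))\<^sup>2 \<le> Re (cinner (op_app B y) y) * Re (cinner (op_app B w) w)"
    by (rule nonnegative_cauchy_schwarz[OF lin sym pos y w])
  also have "\<dots> \<le> Re (cinner (op_app B y) y) * ((q * norm x) * (N * norm x))"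
    using Bw \<beta>0 by (rule mult_left_mono)
  also have "\<dots> \<le> (2 * e * U) * ((q * norm x) * (N * norm x))"
    using \<beta> Nq by (intro mult_right_mono) auto
  also have "\<dots> = 4 * ((4 * q * N * e) * (U / 8)) * (norm x)\<^sup>2" by (simp add: power2_eq_square)
  also have "\<dots> \<le> (4 * q * N * e + U / 8)\<^sup>2 * (norm x)\<^sup>2"
  proof (rule mult_right_mono)
    have "4 * (a * b) \<le> (a + b)\<^sup>2" for a b :: real
      using sum_squares_bound[of a b] unfolding power2_sum by simp
    then show "4 * ((4 * q * N * e) * (U / 8)) \<le> (4 * q * N * e + U / 8)\<^sup>2" .
  qed simp
  also have "\<dots> = ((4 * q * N * e + U / 8) * norm x)\<^sup>2" by (simp add: power_mult_distrib)
  finally have "cmod (cinner (op_app B y) w) \<le> (4 * q * N * e + U / 8) * norm x"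
    by (rule power2_le_imp_le) (use Nq eU in simp)
  moreover have "e * norm w \<le> e * (N * norm x)" using Nq(3) eU(1) by (rule mult_left_mono)
  ultimately have "norm x * norm x \<le> (N * e + (4 * q * N * e + U / 8)) * norm x"
    using le by (simp add: power2_eq_square algebra_simps)
  then show ?thesis using False by simp
qed

lemma norm_Pair_mono:
  assumes "norm x \<le> c * norm a" "norm y \<le> c * norm b" "0 \<le> c"
  shows "norm (x, y) \<le> c * norm (a, b)"
proof -
  have "(norm x)\<^sup>2 + (norm y)\<^sup>2 \<le> (c * norm a)\<^sup>2 + (c * norm b)\<^sup>2"
    using assms by (intro add_mono power_mono) auto
  also have "\<dots> = c\<^sup>2 * ((norm a)\<^sup>2 + (norm b)\<^sup>2)" by (simp add: power_mult_distrib distrib_left)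
  finally have "norm (x, y) \<le> sqrt (c\<^sup>2 * ((norm a)\<^sup>2 + (norm b)\<^sup>2))"
    unfolding norm_Pair by (rule real_sqrt_le_mono)
  then show ?thesis using assms(3) by (simp add: norm_Pair real_sqrt_mult)
qed

lemma integral_powr_tail_le:
  fixes p \<rho> :: real
  assumes p: "p < 1" and \<rho>: "\<rho> \<ge> 0"
  shows "integral {-\<rho>..\<rho>} (\<lambda>t. (1 + \<bar>t\<bar>) powr (p - 2)) \<le> 2 / (1 - p)"
proof -
  let ?f = "\<lambda>t::real. (1 + \<bar>t\<bar>) powr (p - 2)"
  have cont: "continuous_on X ?f" for X
    by (intro continuous_intros) (auto simp: add_nonneg_eq_0_iff)
  have int: "?f integrable_on {a..b}" for a b by (rule integrable_continuous_real[OF cont])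
  have half: "integral {0..\<rho>} ?f \<le> 1 / (1 - p)"
  proof -
    have "(?f has_integral ((1 + \<rho>) powr (p - 1) / (p - 1) - (1 + 0) powr (p - 1) / (p - 1))) {0..\<rho>}"
    proof (rule fundamental_theorem_of_calculus[OF \<rho>])
      fix t assume t: "t \<in> {0..\<rho>}"
      have "((\<lambda>t. (1 + t) powr (p - 1) / (p - 1)) has_real_derivative (1 + t) powr (p - 1 - 1)) (at t within {0..\<rho>})"
        using t p by (auto intro!: derivative_eq_intros)
      moreover have "p - 1 - 1 = p - 2" by simp
      ultimately show "((\<lambda>t. (1 + t) powr (p - 1) / (p - 1)) has_vector_derivative ?f t) (at t within {0..\<rho>})"
        using t by (simp add: has_real_derivative_iff_has_vector_derivative)
    qed
    then have "integral {0..\<rho>} ?f = (1 + \<rho>) powr (p - 1) / (p - 1) - 1 / (p - 1)"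
      by (simp add: integral_unique)
    moreover have "(1 + \<rho>) powr (p - 1) / (p - 1) \<le> 0" using p by (simp add: divide_nonneg_neg)
    moreover have "- 1 / (p - 1) = 1 / (1 - p)" by (metis minus_diff_eq minus_divide_divide)
    ultimately show ?thesis by simp
  qed
  have "integral {-\<rho>..0} ?f + integral {0..\<rho>} ?f = integral {-\<rho>..\<rho>} ?f"
    using \<rho> int by (intro Henstock_Kurzweil_Integration.integral_combine) auto
  moreover have "integral {-\<rho>..0} ?f = integral {0..\<rho>} ?f"
    using Henstock_Kurzweil_Integration.integral_reflect_real[of \<rho> 0 ?f] by simp
  ultimately show ?thesis using half by simp
qed

section \<open>Hamiltonians\<close>

lemma abs_Arg_cnj: "\<bar>Arg (cnj z)\<bar> = \<bar>Arg z\<bar>"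
  by (simp add: Arg_cnj)

locale sectorial_hamiltonian =
  fixes A B C :: "'a::complex_hilbert operator" and p \<theta> :: real
  assumes nonneg: "nonnegative_hamiltonian A B C"
    and p: "0 \<le> p" "p < 1"
    and dominant: "diagonally_dominant p A B C"
    and \<theta>: "0 \<le> \<theta>" "\<theta> < pi / 2"
    and A: "sectorially_dichotomous A \<theta>"
begin

abbreviation "A' \<equiv> adjoint_op A"
abbreviation "T \<equiv> hamiltonian A B C"

definition D :: "('a \<times> 'a) operator" where
  "D = Operator (op_dom A \<times> op_dom A') (\<lambda>(x, y). (op_app A x, - op_app A' y))"

lemma D_simps [simp]:
  "op_dom D = op_dom A \<times> op_dom A'" "op_app D (x, y) = (op_app A x, - op_app A' y)"
  by (simp_all add: D_def)

lemma dense_A: "densely_defined_on UNIV A"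
  by (rule sectorially_dichotomousD(1)[OF A])

lemma imag_A: "\<i> * complex_of_real t \<in> resolvent_set_on UNIV A"
  by (rule sectorially_dichotomousD(2)[OF A])

lemma lin_A: "linear_operator_on UNIV A"
  using dense_A by (simp add: densely_defined_on_def)

lemma dense_A': "densely_defined_on UNIV A'"
  by (rule densely_defined_adjoint_op[OF dense_A imag_A])

lemma lin_A': "linear_operator_on UNIV A'"
  using dense_A' by (simp add: densely_defined_on_def)

lemma lin_B: "linear_operator_on UNIV B" and lin_C: "linear_operator_on UNIV C"
  and sym: "symmetric_operator B" "symmetric_operator C"
  and pos: "nonnegative_operator B" "nonnegative_operator C"
  using nonneg by (auto simp: nonnegative_hamiltonian_def hamiltonian_entries_def densely_defined_on_def)

lemma dom_B: "y \<in> op_dom A' \<Longrightarrow> y \<in> op_dom B" and dom_C: "x \<in> op_dom A \<Longrightarrow> x \<in> op_dom C"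
  using dominant by (auto simp: diagonally_dominant_def subordinate_def)

lemma dom_T: "op_dom T = op_dom A \<times> op_dom A'"
  by (rule op_dom_hamiltonian_diagonally_dominant[OF dominant])

lemma app_T: "op_app T (x, y) = (op_app A x + op_app B y, op_app C x - op_app A' y)"
  by (simp add: hamiltonian_def)

lemma csubspace_dom: "csubspace (op_dom A \<times> op_dom A')"
  using linear_operator_onD(1)[OF lin_A] linear_operator_onD(1)[OF lin_A']
  by (auto simp: csubspace_def scaleC_prod_def zero_prod_def)

lemma lin_D: "linear_operator_on UNIV D"
  unfolding linear_operator_on_def
  using csubspace_dom
  by (auto simp: scaleC_prod_def linear_operator_onD(4,5)[OF lin_A] linear_operator_onD(4,5)[OF lin_A'])

lemma lin_T: "linear_operator_on UNIV T"
  unfolding linear_operator_on_def dom_T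
  using csubspace_dom dom_B dom_C
  by (auto simp: app_T scaleC_prod_def linear_operator_onD(4,5)[OF lin_A] linear_operator_onD(4,5)[OF lin_A']
      linear_operator_onD(4,5)[OF lin_B] linear_operator_onD(4,5)[OF lin_C] scaleC_add_right scaleC_diff_right)

lemma dense_T: "densely_defined_on UNIV T"
proof -
  have "closure (op_dom A) = UNIV" "closure (op_dom A') = UNIV"
    using dense_A dense_A' by (auto simp: densely_defined_on_def)
  then show ?thesis using lin_T by (simp add: densely_defined_on_def dom_T closure_Times)
qed

text \<open>
  The set of \<open>z\<close> for which both diagonal entries of \<open>D - z\<close> have an inverse of norm at most
  \<open>N\<close>; for the second one, \<open>- A\<^sup>* - z = - (A - (- cnj z))\<^sup>*\<close>.
\<close>

definition bounded_inverse :: "complex \<Rightarrow> real \<Rightarrow> bool" where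
  "bounded_inverse z N \<longleftrightarrow> 0 \<le> N \<and> z \<in> resolvent_set_on UNIV A \<and> - cnj z \<in> resolvent_set_on UNIV A \<and>
    (\<forall>x\<in>op_dom A. norm x \<le> N * norm (op_app A x - z *\<^sub>C x)) \<and>
    (\<forall>x\<in>op_dom A. norm x \<le> N * norm (op_app A x - (- cnj z) *\<^sub>C x))"

lemma bounded_inverseD:
  assumes "bounded_inverse z N"
  shows "0 \<le> N" "z \<in> resolvent_set_on UNIV A" "- z \<in> resolvent_set_on UNIV A'"
    "\<And>x. x \<in> op_dom A \<Longrightarrow> norm x \<le> N * norm (op_app A x - z *\<^sub>C x)"
    "\<And>y. y \<in> op_dom A' \<Longrightarrow> norm y \<le> N * norm (op_app A' y - (- z) *\<^sub>C y)"
proof -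
  show N: "0 \<le> N" "z \<in> resolvent_set_on UNIV A"
    "\<And>x. x \<in> op_dom A \<Longrightarrow> norm x \<le> N * norm (op_app A x - z *\<^sub>C x)"
    using assms by (auto simp: bounded_inverse_def)
  have m: "- cnj z \<in> resolvent_set_on UNIV A"
    and b: "\<And>x. x \<in> op_dom A \<Longrightarrow> norm x \<le> N * norm (op_app A x - (- cnj z) *\<^sub>C x)"
    using assms unfolding bounded_inverse_def by blast+
  have e: "cnj (- cnj z) = - z" by simp
  show "- z \<in> resolvent_set_on UNIV A'"
    "\<And>y. y \<in> op_dom A' \<Longrightarrow> norm y \<le> N * norm (op_app A' y - (- z) *\<^sub>C y)"
    using adjoint_resolvent(1,2)[OF dense_A m N(1) b] unfolding e by blast+
qed

text \<open>
  The bisector is symmetric under \<open>z \<mapsto> - cnj z\<close>, the map that relates the two diagonal entries.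
\<close>

lemma bounded_inverse_bisector:
  assumes "\<theta> < \<theta>'"
  obtains M where "M \<ge> 0"
    "\<And>z. z \<noteq> 0 \<Longrightarrow> \<theta>' \<le> \<bar>Arg z\<bar> \<Longrightarrow> \<bar>Arg z\<bar> \<le> pi - \<theta>' \<Longrightarrow> bounded_inverse z (M / cmod z)"
proof -
  obtain M where M: "M \<ge> 0" and res: "\<And>z. z \<noteq> 0 \<Longrightarrow> \<theta>' \<le> \<bar>Arg z\<bar> \<Longrightarrow> \<bar>Arg z\<bar> \<le> pi - \<theta>' \<Longrightarrow>
      z \<in> resolvent_set_on UNIV A \<and> (\<forall>x\<in>op_dom A. cmod z * norm x \<le> M * norm (op_app A x - z *\<^sub>C x))"
    using sectorially_dichotomousD(3)[OF A assms] by blast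
  have half: "z \<in> resolvent_set_on UNIV A \<and> (\<forall>x\<in>op_dom A. norm x \<le> M / cmod z * norm (op_app A x - z *\<^sub>C x))"
    if "z \<noteq> 0" "\<theta>' \<le> \<bar>Arg z\<bar>" "\<bar>Arg z\<bar> \<le> pi - \<theta>'" for z
    using res[OF that] that(1) by (auto simp: field_simps)
  have "bounded_inverse z (M / cmod z)" if z: "z \<noteq> 0" "\<theta>' \<le> \<bar>Arg z\<bar>" "\<bar>Arg z\<bar> \<le> pi - \<theta>'" for z
  proof -
    have "\<bar>Arg (- cnj z)\<bar> = pi - \<bar>Arg z\<bar>" using z by (simp add: abs_Arg_minus abs_Arg_cnj)
    then show ?thesis
      unfolding bounded_inverse_def using half[OF z] half[of "- cnj z"] z M by simp
  qed
  then show ?thesis using that M by blast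
qed

lemma bounded_inverse_imag:
  obtains M where "M \<ge> 0" "\<And>t. bounded_inverse (\<i> * complex_of_real t) (M / (1 + \<bar>t\<bar>))"
proof -
  obtain M0 where M0: "M0 \<ge> 0"
    "\<And>z. z \<noteq> 0 \<Longrightarrow> pi/2 \<le> \<bar>Arg z\<bar> \<Longrightarrow> \<bar>Arg z\<bar> \<le> pi - pi/2 \<Longrightarrow> bounded_inverse z (M0 / cmod z)"
    using bounded_inverse_bisector[OF \<theta>(2)] by blast
  obtain K0 where K0: "\<And>x. x \<in> op_dom A \<Longrightarrow> norm x \<le> K0 * norm (op_app A x - 0 *\<^sub>C x)"
    using imag_A[of 0] by (auto simp: resolvent_set_on_def)
  have K: "norm x \<le> \<bar>K0\<bar> * norm (op_app A x)" if "x \<in> op_dom A" for x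
    using K0[OF that] mult_right_mono[OF abs_ge_self[of K0], of "norm (op_app A x)"] by simp
  let ?U = "range (\<lambda>t. \<i> * complex_of_real t)"
  have dec: "cmod z * norm x \<le> M0 * norm (op_app A x - z *\<^sub>C x)" if "z \<in> ?U" and x: "x \<in> op_dom A" for z x
  proof (cases "z = 0")
    case False
    have re: "Re z = 0" using that by auto
    have "pi/2 \<le> \<bar>Arg z\<bar>" "pi/2 \<le> \<bar>Arg (- z)\<bar>"
      using Arg_Re_pos[of z] Arg_Re_pos[of "- z"] re False by auto
    then have "bounded_inverse z (M0 / cmod z)" using False by (intro M0(2)) (auto simp: abs_Arg_minus)
    from bounded_inverseD(4)[OF this x] show ?thesis using False by (simp add: field_simps)
  qed (use M0(1) in simp)
  show ?thesis
  proof (rule decay_including_zero[OF M0(1) abs_ge_zero dec K])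
    fix M assume M: "0 \<le> M" "\<And>z x. z \<in> ?U \<Longrightarrow> x \<in> op_dom A \<Longrightarrow>
        (1 + cmod z) * norm x \<le> M * norm (op_app A x - z *\<^sub>C x)"
    have "bounded_inverse (\<i> * complex_of_real t) (M / (1 + \<bar>t\<bar>))" for t
    proof -
      have "norm x \<le> M / (1 + \<bar>t\<bar>) * norm (op_app A x - (\<i> * complex_of_real t) *\<^sub>C x)" if "x \<in> op_dom A" for x
      proof -
        have "(1 + \<bar>t\<bar>) * norm x \<le> M * norm (op_app A x - (\<i> * complex_of_real t) *\<^sub>C x)"
          using M(2)[OF rangeI that, of t] by (simp add: norm_mult)
        moreover have "1 + \<bar>t\<bar> > 0" by simp
        ultimately show ?thesis by (simp add: pos_le_divide_eq mult.commute)
      qed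
      moreover have "- cnj (\<i> * complex_of_real t) = \<i> * complex_of_real t" by simp
      ultimately show ?thesis unfolding bounded_inverse_def using M(1) imag_A by simp
    qed
    then show ?thesis using that M(1) by blast
  qed
qed

lemma bounded_inverse_mono:
  assumes "bounded_inverse z N" "N \<le> N'"
  shows "bounded_inverse z N'"
proof -
  have "N * norm x \<le> N' * norm x" for x :: 'a using assms(2) by (rule mult_right_mono) simp
  then show ?thesis using assms unfolding bounded_inverse_def by (meson order_trans)
qed

lemma bounded_inverse_imag_uniform:
  obtains M where "\<And>t. bounded_inverse (\<i> * complex_of_real t) M"
proof -
  obtain M where M: "M \<ge> 0" "\<And>t. bounded_inverse (\<i> * complex_of_real t) (M / (1 + \<bar>t\<bar>))"
    using bounded_inverse_imag by blast
  have "M / (1 + \<bar>t\<bar>) \<le> M / 1" for t using M(1) by (intro divide_left_mono) auto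
  then have "bounded_inverse (\<i> * complex_of_real t) M" for t
    using bounded_inverse_mono[OF M(2)[of t], of M] by simp
  then show ?thesis by (rule that)
qed

lemma bounded_inverse_D:
  assumes z: "bounded_inverse z N"
  shows "z \<in> resolvent_set_on UNIV D"
    and "\<And>u. u \<in> op_dom D \<Longrightarrow> norm u \<le> N * norm (op_app D u - z *\<^sub>C u)"
    and "resolvent D z (f, g) = (resolvent A z f, - resolvent A' (- z) g)"
proof -
  note Z = bounded_inverseD[OF z]
  have shift: "op_app D (x, y) - z *\<^sub>C (x, y) = (op_app A x - z *\<^sub>C x, - (op_app A' y - (- z) *\<^sub>C y))" for x y
    by (simp add: scaleC_prod_def)
  show bound: "norm u \<le> N * norm (op_app D u - z *\<^sub>C u)" if dom: "u \<in> op_dom D" for u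
  proof -
    obtain x y where u: "u = (x, y)" "x \<in> op_dom A" "y \<in> op_dom A'" using dom by (cases u) auto
    show ?thesis unfolding u(1) shift
      by (rule norm_Pair_mono[OF Z(4)[OF u(2)] _ Z(1)]) (use Z(5)[OF u(3)] in \<open>simp only: norm_minus_cancel\<close>)
  qed
  have neg: "- resolvent A' (- z) g \<in> op_dom A'" "op_app A' (- resolvent A' (- z) g) - (- z) *\<^sub>C (- resolvent A' (- z) g) = - g" for g
  proof -
    have r: "resolvent A' (- z) g \<in> op_dom A'" by (rule resolvent_in_dom[OF Z(3) UNIV_I])
    have s: "- resolvent A' (- z) g = (-1) *\<^sub>C resolvent A' (- z) g" by simp
    show "- resolvent A' (- z) g \<in> op_dom A'"
      unfolding s by (rule csubspace_scaleC[OF linear_operator_onD(1)[OF lin_A'] r])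
    have "op_app A' (- resolvent A' (- z) g) = - op_app A' (resolvent A' (- z) g)"
      unfolding s linear_operator_onD(5)[OF lin_A' r] by simp
    then have "op_app A' (- resolvent A' (- z) g) - (- z) *\<^sub>C (- resolvent A' (- z) g)
        = - (op_app A' (resolvent A' (- z) g) - (- z) *\<^sub>C resolvent A' (- z) g)" by simp
    then show "op_app A' (- resolvent A' (- z) g) - (- z) *\<^sub>C (- resolvent A' (- z) g) = - g"
      by (simp only: resolvent_right[OF Z(3) UNIV_I])
  qed
  have sol: "(resolvent A z f, - resolvent A' (- z) g) \<in> op_dom D"
    "op_app D (resolvent A z f, - resolvent A' (- z) g) - z *\<^sub>C (resolvent A z f, - resolvent A' (- z) g) = (f, g)" for f g
    unfolding shift neg(2) resolvent_right[OF Z(2) UNIV_I]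
    using neg(1) resolvent_in_dom[OF Z(2) UNIV_I] by auto
  show mem: "z \<in> resolvent_set_on UNIV D"
  proof (rule resolvent_set_if_surjective[OF lin_D UNIV_I _ bound])
    show "\<exists>u\<in>op_dom D. op_app D u - z *\<^sub>C u = v" for v
      using sol[of "fst v" "snd v"] by (intro bexI[of _ "(resolvent A z (fst v), - resolvent A' (- z) (snd v))"]) simp_all
  qed
  show "resolvent D z (f, g) = (resolvent A z f, - resolvent A' (- z) g)"
    by (rule resolvent_eqI[OF mem sol])
qed

definition relative_bound :: "complex \<Rightarrow> real \<Rightarrow> bool" where
  "relative_bound z q \<longleftrightarrow> 0 \<le> q \<and>
    (\<forall>x\<in>op_dom A. norm (op_app C x) \<le> q * norm (op_app A x - z *\<^sub>C x)) \<and>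
    (\<forall>y\<in>op_dom A'. norm (op_app B y) \<le> q * norm (op_app A' y - (- z) *\<^sub>C y))"

text \<open>
  With \<open>N\<close> of order \<open>1 / \<bar>z\<bar>\<close> and \<open>M\<close> fixed, the relative bound is at most of order
  \<open>\<bar>z\<bar> powr (p - 1)\<close>.
\<close>

lemma relative_bound_subordinate:
  obtains c where "c \<ge> 0" "\<And>z N M. bounded_inverse z N \<Longrightarrow> cmod z * N \<le> M \<Longrightarrow>
    relative_bound z (c * rpow N (1 - p) * rpow (1 + M) p)"
proof -
  obtain c1 where c1: "c1 \<ge> 0"
    "\<And>x z N M. x \<in> op_dom A \<Longrightarrow> 0 \<le> N \<Longrightarrow> cmod z * N \<le> M \<Longrightarrow>
      norm x \<le> N * norm (op_app A x - z *\<^sub>C x) \<Longrightarrow>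
      norm (op_app C x) \<le> c1 * rpow N (1 - p) * rpow (1 + M) p * norm (op_app A x - z *\<^sub>C x)"
    using subordinate_estimate[OF _ p(2), of C A] dominant unfolding diagonally_dominant_def by blast
  obtain c2 where c2: "c2 \<ge> 0"
    "\<And>x z N M. x \<in> op_dom A' \<Longrightarrow> 0 \<le> N \<Longrightarrow> cmod z * N \<le> M \<Longrightarrow>
      norm x \<le> N * norm (op_app A' x - z *\<^sub>C x) \<Longrightarrow>
      norm (op_app B x) \<le> c2 * rpow N (1 - p) * rpow (1 + M) p * norm (op_app A' x - z *\<^sub>C x)"
    using subordinate_estimate[OF _ p(2), of B A'] dominant unfolding diagonally_dominant_def by blast
  define c where "c = c1 + c2"
  have "relative_bound z (c * rpow N (1 - p) * rpow (1 + M) p)"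
    if z: "bounded_inverse z N" and M: "cmod z * N \<le> M" for z N M
  proof -
    note Z = bounded_inverseD[OF z]
    let ?r = "rpow N (1 - p) * rpow (1 + M) p"
    have r: "?r \<ge> 0" by (intro mult_nonneg_nonneg rpow_nonneg)
    have le: "c1 * ?r \<le> c * ?r" "c2 * ?r \<le> c * ?r"
      using r c1(1) c2(1) by (auto simp: c_def intro: mult_right_mono)
    have C: "norm (op_app C x) \<le> c * ?r * norm (op_app A x - z *\<^sub>C x)" if x: "x \<in> op_dom A" for x
    proof -
      have "norm (op_app C x) \<le> c1 * ?r * norm (op_app A x - z *\<^sub>C x)"
        using c1(2)[OF x Z(1) M Z(4)[OF x]] by (simp only: mult.assoc)
      also have "\<dots> \<le> c * ?r * norm (op_app A x - z *\<^sub>C x)" by (rule mult_right_mono[OF le(1) norm_ge_zero])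
      finally show ?thesis .
    qed
    have M': "cmod (- z) * N \<le> M" using M by simp
    have B: "norm (op_app B y) \<le> c * ?r * norm (op_app A' y - (- z) *\<^sub>C y)" if y: "y \<in> op_dom A'" for y
    proof -
      have "norm (op_app B y) \<le> c2 * ?r * norm (op_app A' y - (- z) *\<^sub>C y)"
        using c2(2)[OF y Z(1) M' Z(5)[OF y]] by (simp only: mult.assoc)
      also have "\<dots> \<le> c * ?r * norm (op_app A' y - (- z) *\<^sub>C y)" by (rule mult_right_mono[OF le(2) norm_ge_zero])
      finally show ?thesis .
    qed
    have "0 \<le> c * ?r" using r c1(1) c2(1) by (simp add: c_def)
    then show ?thesis using B C unfolding relative_bound_def by (simp only: mult.assoc) blast
  qed
  moreover have "c \<ge> 0" using c1(1) c2(1) by (simp add: c_def)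
  ultimately show ?thesis using that by blast
qed

lemma norm_T_diff_D:
  assumes q: "relative_bound z q" and u: "u \<in> op_dom D"
  shows "norm (op_app T u - op_app D u) \<le> q * norm (op_app D u - z *\<^sub>C u)"
proof -
  obtain x y where u: "u = (x, y)" "x \<in> op_dom A" "y \<in> op_dom A'" using u by (cases u) auto
  have q0: "0 \<le> q" and C: "norm (op_app C x) \<le> q * norm (op_app A x - z *\<^sub>C x)"
    and B: "norm (op_app B y) \<le> q * norm (op_app A' y - (- z) *\<^sub>C y)"
    using q u by (auto simp: relative_bound_def)
  have "op_app D u - z *\<^sub>C u = (op_app A x - z *\<^sub>C x, - (op_app A' y - (- z) *\<^sub>C y))"
    by (simp add: u scaleC_prod_def)
  moreover have "op_app T u - op_app D u = (op_app B y, op_app C x)"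
    by (simp add: u app_T)
  moreover have "norm (op_app B y, op_app C x) = norm (op_app C x, op_app B y)"
    by (simp add: norm_Pair add.commute)
  ultimately show ?thesis
    using norm_Pair_mono[OF C _ q0, of "op_app B y" "- (op_app A' y - (- z) *\<^sub>C y)"] B
    by (simp only: norm_minus_cancel)
qed

lemma resolvent_set_T:
  assumes z: "bounded_inverse z N" and q: "relative_bound z q" "q < 1"
  shows "z \<in> resolvent_set_on UNIV T"
proof -
  note Z = bounded_inverse_D[OF z]
  have dom: "op_dom T = op_dom D" by (simp add: dom_T)
  have sub: "subspace (op_dom D)" by (rule csubspace_imp_subspace[OF linear_operator_onD(1)[OF lin_D]])
  have linD: "op_app D (x - y) - z *\<^sub>C (x - y) = op_app D x - z *\<^sub>C x - (op_app D y - z *\<^sub>C y)"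
    if "x \<in> op_dom D" "y \<in> op_dom D" for x y
    unfolding linear_operator_on_diff[OF lin_D that] scaleC_diff_right by simp
  have linT: "op_app T (x - y) - z *\<^sub>C (x - y) = op_app T x - z *\<^sub>C x - (op_app T y - z *\<^sub>C y)"
    if "x \<in> op_dom D" "y \<in> op_dom D" for x y
    unfolding linear_operator_on_diff[OF lin_T that[folded dom]] scaleC_diff_right by simp
  have bij: "bij_betw (\<lambda>u. op_app D u - z *\<^sub>C u) (op_dom D) UNIV"
    using Z(1) by (simp only: resolvent_set_on_def mem_Collect_eq)
  have q0: "0 \<le> q" using q by (simp add: relative_bound_def)
  have le: "norm (op_app T u - z *\<^sub>C u - (op_app D u - z *\<^sub>C u)) \<le> q * norm (op_app D u - z *\<^sub>C u)"
    if "u \<in> op_dom D" for u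
    using norm_T_diff_D[OF q(1) that] by (simp only: diff_diff_eq2 add_diff_cancel_right' diff_add_cancel add_diff_eq)
  have bijT: "bij_betw (\<lambda>u. op_app T u - z *\<^sub>C u) (op_dom D) UNIV"
    by (rule perturbed_bijection(1)[OF sub linD linT bij q0 q(2) le])
  have DT: "norm (op_app D u - z *\<^sub>C u) \<le> norm (op_app T u - z *\<^sub>C u) / (1 - q)" if "u \<in> op_dom D" for u
    by (rule perturbed_bijection(2)[OF sub linD linT bij q0 q(2) le]) (assumption | rule that)+
  have "norm u \<le> (N / (1 - q)) * norm (op_app T u - z *\<^sub>C u)" if "u \<in> op_dom D" for u
    using order_trans[OF Z(2)[OF that] mult_left_mono[OF DT[OF that] bounded_inverseD(1)[OF z]]] by simp
  then show ?thesis unfolding resolvent_set_on_def dom using bijT by blast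
qed

text \<open>
  On the imaginary axis the contributions of the diagonal part cancel in
  \<open>\<langle>f, y\<rangle> + \<langle>x, g\<rangle> = \<langle>B y, y\<rangle> + \<langle>C x, x\<rangle>\<close>, where \<open>(f, g) = (T - z) (x, y)\<close>. So both forms are small
  when \<open>(f, g)\<close> is. Testing the first equation with \<open>w = (A\<^sup>* + z)\<inverse> x\<close> yields
  \<open>\<parallel>x\<parallel>\<^sup>2 = \<langle>f, w\<rangle> - \<langle>B y, w\<rangle>\<close>, where the form of \<open>B\<close> controls the last term; \<open>y\<close> is treated alike with
  \<open>(A - z)\<inverse> y\<close> and \<open>C\<close>.
\<close>

lemma lower_bound_T:
  assumes z: "bounded_inverse z N" and re: "Re z = 0" and q: "relative_bound z q" and u: "u \<in> op_dom T"
  shows "norm u \<le> N * (4 + 16 * q) * norm (op_app T u - z *\<^sub>C u)"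
proof -
  note Z = bounded_inverseD[OF z]
  have cz: "cnj z = - z" using re by (simp add: complex_eq_iff)
  obtain x y where xy: "u = (x, y)" "x \<in> op_dom A" "y \<in> op_dom A'" using u by (cases u) (auto simp: dom_T)
  have q0: "0 \<le> q" and qC: "\<And>x. x \<in> op_dom A \<Longrightarrow> norm (op_app C x) \<le> q * norm (op_app A x - z *\<^sub>C x)"
    and qB: "\<And>y. y \<in> op_dom A' \<Longrightarrow> norm (op_app B y) \<le> q * norm (op_app A' y - (- z) *\<^sub>C y)"
    using q by (auto simp: relative_bound_def)
  define f where "f = op_app A x - z *\<^sub>C x + op_app B y"
  define g where "g = op_app C x - (op_app A' y - (- z) *\<^sub>C y)"
  have Tu: "op_app T u - z *\<^sub>C u = (f, g)"
    by (simp add: xy app_T scaleC_prod_def f_def g_def)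
  define e where "e = norm (op_app T u - z *\<^sub>C u)"
  define U where "U = norm u"
  have f: "norm f \<le> e" and g: "norm g \<le> e"
    using norm_fst_le[of f g] norm_snd_le[of g f] by (auto simp: e_def Tu)
  have x: "norm x \<le> U" and y: "norm y \<le> U"
    using norm_fst_le[of x y] norm_snd_le[of y x] by (auto simp: U_def xy)
  have e0: "0 \<le> e" and U0: "0 \<le> U" by (auto simp: e_def U_def)
  have shift: "cinner (op_app A v - z *\<^sub>C v) w = cinner v (op_app A' w - (- z) *\<^sub>C w)"
    if "v \<in> op_dom A" "w \<in> op_dom A'" for v w
    using cinner_adjoint_op[OF dense_A that]
    by (simp add: cinner_diff_left cinner_add_right cinner_scaleC_left cinner_scaleC_right cz)
  have sum: "cinner (op_app B y) y + cinner x (op_app C x) = cinner f y + cinner x g"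
    unfolding f_def g_def cinner_add_left cinner_diff_right[of x "op_app C x"] shift[OF xy(2,3)] by simp
  have B0: "0 \<le> Re (cinner (op_app B y) y)" and C0: "0 \<le> Re (cinner (op_app C x) x)"
    using pos dom_B[OF xy(3)] dom_C[OF xy(2)]
    by (auto simp: nonnegative_operator_def complex_nonneg_Reals_iff)
  have Cx: "Re (cinner x (op_app C x)) = Re (cinner (op_app C x) x)"
    using cinner_commute[of x "op_app C x"] by simp
  have "Re (cinner f y) \<le> e * U"
    using complex_Re_le_cmod[of "cinner f y"] norm_cinner_le[of f y] mult_mono[OF f y e0 norm_ge_zero] by linarith
  moreover have "Re (cinner x g) \<le> e * U"
    using complex_Re_le_cmod[of "cinner x g"] norm_cinner_le[of x g] mult_mono[OF x g U0 norm_ge_zero]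
    by (simp add: mult.commute)
  ultimately have le: "Re (cinner (op_app B y) y) + Re (cinner (op_app C x) x) \<le> 2 * e * U"
    using arg_cong[OF sum, of Re] Cx by simp
  have nx: "norm x \<le> N * e + (4 * q * N * e + U / 8)"
  proof (rule component_estimate[OF lin_B sym(1) pos(1) dom_B[OF xy(3)]])
    let ?w = "resolvent A' (- z) x"
    have w: "?w \<in> op_dom A'" by (rule resolvent_in_dom[OF Z(3) UNIV_I])
    have wx: "op_app A' ?w - (- z) *\<^sub>C ?w = x" by (rule resolvent_right[OF Z(3) UNIV_I])
    show "?w \<in> op_dom B" by (rule dom_B[OF w])
    show "norm ?w \<le> N * norm x" using Z(5)[OF w] unfolding wx .
    show "norm (op_app B ?w) \<le> q * norm x" using qB[OF w] unfolding wx .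
    show "Re (cinner (op_app B y) y) \<le> 2 * e * U" using le C0 by simp
    have "complex_of_real ((norm x)\<^sup>2) = cinner x (op_app A' ?w - (- z) *\<^sub>C ?w)"
      unfolding wx by (rule cinner_self[symmetric])
    also have "\<dots> = cinner (f - op_app B y) ?w"
      unfolding shift[OF xy(2) w, symmetric] by (simp add: f_def)
    finally have "(norm x)\<^sup>2 = cmod (cinner f ?w - cinner (op_app B y) ?w)"
      by (metis cinner_diff_left norm_of_real abs_of_nonneg zero_le_power2)
    also have "\<dots> \<le> cmod (cinner f ?w) + cmod (cinner (op_app B y) ?w)" by (rule norm_triangle_ineq4)
    also have "cmod (cinner f ?w) \<le> e * norm ?w"
      using norm_cinner_le[of f ?w] mult_right_mono[OF f, of "norm ?w"] by simp
    finally show "(norm x)\<^sup>2 \<le> e * norm ?w + cmod (cinner (op_app B y) ?w)" by simp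
  qed (use Z(1) q0 e0 U0 in auto)
  have ny: "norm y \<le> N * e + (4 * q * N * e + U / 8)"
  proof (rule component_estimate[OF lin_C sym(2) pos(2) dom_C[OF xy(2)]])
    let ?w = "resolvent A z y"
    have w: "?w \<in> op_dom A" by (rule resolvent_in_dom[OF Z(2) UNIV_I])
    have wy: "op_app A ?w - z *\<^sub>C ?w = y" by (rule resolvent_right[OF Z(2) UNIV_I])
    show "?w \<in> op_dom C" by (rule dom_C[OF w])
    show "norm ?w \<le> N * norm y" using Z(4)[OF w] unfolding wy .
    show "norm (op_app C ?w) \<le> q * norm y" using qC[OF w] unfolding wy .
    show "Re (cinner (op_app C x) x) \<le> 2 * e * U" using le B0 by simp
    have "complex_of_real ((norm y)\<^sup>2) = cinner (op_app A ?w - z *\<^sub>C ?w) y"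
      unfolding wy by (rule cinner_self[symmetric])
    also have "\<dots> = cinner ?w (op_app C x - g)"
      unfolding shift[OF w xy(3)] by (simp add: g_def add.commute)
    finally have "(norm y)\<^sup>2 = cmod (cinner ?w (op_app C x) - cinner ?w g)"
      by (metis cinner_diff_right norm_of_real abs_of_nonneg zero_le_power2)
    also have "\<dots> \<le> cmod (cinner ?w (op_app C x)) + cmod (cinner ?w g)" by (rule norm_triangle_ineq4)
    also have "cmod (cinner ?w (op_app C x)) = cmod (cinner (op_app C x) ?w)"
      by (metis cinner_commute complex_mod_cnj)
    also have "cmod (cinner ?w g) \<le> e * norm ?w"
      using norm_cinner_le[of ?w g] mult_left_mono[OF g, of "norm ?w"] by (simp add: mult.commute)
    finally show "(norm y)\<^sup>2 \<le> e * norm ?w + cmod (cinner (op_app C x) ?w)" by simp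
  qed (use Z(1) q0 e0 U0 in auto)
  have "U \<le> norm x + norm y" unfolding U_def xy(1) by (rule norm_Pair_le)
  then have "U \<le> 2 * (N * e) + 8 * (q * N * e) + U / 4" using nx ny by simp
  moreover have "0 \<le> N * e" "0 \<le> q * N * e" using Z(1) e0 q0 by auto
  ultimately have "U \<le> 4 * (N * e) + 16 * (q * N * e)" by linarith
  then show ?thesis by (simp add: U_def e_def algebra_simps)
qed

text \<open>
  The set of real \<open>t\<close> with \<open>\<i> t\<close> in the resolvent set is not empty, because the relative bound is below
  \<open>1\<close> far out, and it is open and closed, because the lower bound for \<open>T - \<i> t\<close> is uniform in \<open>t\<close>.
\<close>

lemma imag_axis_estimates:
  obtains K c where "K \<ge> 0" "c \<ge> 0"
    "\<And>t. \<i> * complex_of_real t \<in> resolvent_set_on UNIV T"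
    "\<And>t u. u \<in> op_dom T \<Longrightarrow> (1 + \<bar>t\<bar>) * norm u \<le> K * norm (op_app T u - (\<i> * complex_of_real t) *\<^sub>C u)"
    "\<And>t. relative_bound (\<i> * complex_of_real t) (c * (1 + \<bar>t\<bar>) powr (p - 1))"
proof -
  obtain M where M: "M \<ge> 0" "\<And>t. bounded_inverse (\<i> * complex_of_real t) (M / (1 + \<bar>t\<bar>))"
    using bounded_inverse_imag by blast
  obtain c0 where c0: "c0 \<ge> 0" "\<And>z N M. bounded_inverse z N \<Longrightarrow> cmod z * N \<le> M \<Longrightarrow>
    relative_bound z (c0 * rpow N (1 - p) * rpow (1 + M) p)"
    using relative_bound_subordinate by blast
  define c where "c = c0 * M powr (1 - p) * rpow (1 + M) p"
  have c: "c \<ge> 0" using c0(1) by (simp add: c_def rpow_nonneg)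
  have pos1: "1 + \<bar>t\<bar> > 0" for t :: real by simp
  have rel: "relative_bound (\<i> * complex_of_real t) (c * (1 + \<bar>t\<bar>) powr (p - 1))" for t
  proof -
    have "cmod (\<i> * complex_of_real t) * (M / (1 + \<bar>t\<bar>)) = (\<bar>t\<bar> / (1 + \<bar>t\<bar>)) * M"
      by (simp add: norm_mult)
    also have "\<dots> \<le> 1 * M" using M(1) by (intro mult_right_mono) auto
    finally have "relative_bound (\<i> * complex_of_real t) (c0 * rpow (M / (1 + \<bar>t\<bar>)) (1 - p) * rpow (1 + M) p)"
      by (intro c0(2)[OF M(2)]) simp
    moreover have "rpow (M / (1 + \<bar>t\<bar>)) (1 - p) = M powr (1 - p) * (1 + \<bar>t\<bar>) powr (p - 1)"
    proof -
      have "rpow (M / (1 + \<bar>t\<bar>)) (1 - p) = (M / (1 + \<bar>t\<bar>)) powr (1 - p)" using p by (simp add: rpow_def)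
      also have "\<dots> = M powr (1 - p) / (1 + \<bar>t\<bar>) powr (1 - p)" using M(1) by (simp add: powr_divide)
      also have "\<dots> = M powr (1 - p) * (1 + \<bar>t\<bar>) powr - (1 - p)" by (simp only: powr_minus divide_inverse)
      finally show ?thesis by simp
    qed
    ultimately show ?thesis by (simp add: c_def mult_ac)
  qed
  have small: "(1 + \<bar>t\<bar>) powr (p - 1) \<le> 1" for t :: real
    using p powr_mono[of "p - 1" 0 "1 + \<bar>t\<bar>"] pos1[of t] by (simp split: if_splits)
  define K where "K = M * (4 + 16 * c)"
  have K: "K \<ge> 0" using M(1) c by (simp add: K_def)
  have dec: "(1 + \<bar>t\<bar>) * norm u \<le> K * norm (op_app T u - (\<i> * complex_of_real t) *\<^sub>C u)" if u: "u \<in> op_dom T" for t u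
  proof -
    let ?n = "norm (op_app T u - (\<i> * complex_of_real t) *\<^sub>C u)"
    have "norm u \<le> M / (1 + \<bar>t\<bar>) * (4 + 16 * (c * (1 + \<bar>t\<bar>) powr (p - 1))) * ?n"
      by (rule lower_bound_T[OF M(2) _ rel u]) simp
    also have "\<dots> \<le> M / (1 + \<bar>t\<bar>) * (4 + 16 * c) * ?n"
      using M(1) mult_left_mono[OF small c] by (intro mult_right_mono mult_left_mono) auto
    finally have "norm u \<le> K * ?n / (1 + \<bar>t\<bar>)" by (simp add: K_def)
    then show ?thesis using pos1[of t] by (simp add: pos_le_divide_eq mult.commute)
  qed
  have lb: "norm u \<le> K * norm (op_app T u - (\<i> * complex_of_real t) *\<^sub>C u)" if u: "u \<in> op_dom T" for t u
    using dec[OF u, of t] mult_right_mono[of 1 "1 + \<bar>t\<bar>" "norm u"] by simp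
  define Q where "Q = {t. \<i> * complex_of_real t \<in> resolvent_set_on UNIV T}"
  define \<delta> where "\<delta> = 1 / (2 * (K + 1))"
  have \<delta>: "\<delta> > 0" using K by (simp add: \<delta>_def)
  have near: "s \<in> Q" if t: "t \<in> Q" and "dist s t < \<delta>" for s t
  proof -
    have eq: "cmod (\<i> * complex_of_real s - \<i> * complex_of_real t) = dist s t"
      by (simp add: dist_norm right_diff_distrib[symmetric] of_real_diff[symmetric] norm_mult del: of_real_diff)
    have "dist s t * K \<le> \<delta> * K" using that(2) K by (intro mult_right_mono) auto
    also have "\<dots> \<le> 1/2" using K by (simp add: \<delta>_def field_simps)
    finally have "cmod (\<i> * complex_of_real s - \<i> * complex_of_real t) * K \<le> 1/2" unfolding eq .
    then show ?thesis
      using resolvent_set_neighbour(1)[OF lin_T _ K lb] t by (simp add: Q_def)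
  qed
  have "open Q" unfolding open_dist using near \<delta> by blast
  moreover have "open (- Q)" unfolding open_dist
    using near \<delta> by (metis ComplD ComplI dist_commute)
  then have "closed Q" by (simp add: closed_def)
  moreover have "Q \<noteq> {}"
  proof -
    have "((\<lambda>t. c * (1 + t) powr (p - 1)) \<longlongrightarrow> c * 0) at_top"
    proof (intro tendsto_intros tendsto_neg_powr)
      show "filterlim (\<lambda>t::real. 1 + t) at_top at_top"
        by (rule filterlim_tendsto_add_at_top[OF tendsto_const filterlim_ident])
    qed (use p in simp)
    then have "\<forall>\<^sub>F t in at_top. c * (1 + t) powr (p - 1) < 1"
      by (rule order_tendstoD) simp
    then have "\<forall>\<^sub>F t in at_top. c * (1 + t) powr (p - 1) < 1 \<and> t \<ge> 0"
      using eventually_ge_at_top[of 0] by (rule eventually_conj)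
    then obtain t where t: "c * (1 + t) powr (p - 1) < 1" "t \<ge> 0"
      using eventually_happens'[OF trivial_limit_at_top_linorder] by blast
    then have "t \<in> Q" using resolvent_set_T[OF M(2) rel, of t] by (simp add: Q_def)
    then show ?thesis by blast
  qed
  ultimately have "Q = UNIV" using clopen[of Q] by blast
  then have mem: "\<And>t. \<i> * complex_of_real t \<in> resolvent_set_on UNIV T" by (auto simp: Q_def)
  show ?thesis by (rule that[OF K c mem dec rel])
qed

lemma imag_integral_D_bounded:
  obtains L where "L \<ge> 0" "\<And>\<rho> x. \<rho> > 0 \<Longrightarrow> norm (imag_integral \<rho> (\<lambda>z. resolvent D z x)) \<le> L * norm x"
proof -
  obtain L where L: "L \<ge> 0" "\<And>\<rho> x. \<rho> > 0 \<Longrightarrow> norm (imag_integral \<rho> (\<lambda>z. resolvent A z x)) \<le> L * norm x"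
    using sectorially_dichotomousD(4)[OF A] by blast
  obtain K where N: "\<And>t. bounded_inverse (\<i> * complex_of_real t) K"
    using bounded_inverse_imag_uniform by blast
  note Z = bounded_inverseD[OF N] and ZD = bounded_inverse_D[OF N]
  have K: "0 \<le> K" by (rule Z(1))
  have bA: "norm x \<le> K * norm (op_app A x - (\<i> * complex_of_real t) *\<^sub>C x)" if "x \<in> op_dom A" for x t
    by (rule Z(4)[OF that])
  have bD: "norm u \<le> K * norm (op_app D u - z *\<^sub>C u)" if zu: "z \<in> range (\<lambda>t. \<i> * complex_of_real t)" "u \<in> op_dom D" for u z
  proof -
    obtain t where t: "z = \<i> * complex_of_real t" using zu(1) by blast
    show ?thesis unfolding t by (rule ZD(2)[OF zu(2)])
  qed
  have U: "range (\<lambda>t. \<i> * complex_of_real t) \<subseteq> resolvent_set_on UNIV D" using ZD(1) by auto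
  have "norm (imag_integral \<rho> (\<lambda>z. resolvent D z x)) \<le> L * norm x" if \<rho>: "\<rho> > 0" for \<rho> x
  proof -
    obtain f g where x: "x = (f, g)" by (cases x)
    let ?F = "\<lambda>t. \<i> *\<^sub>C resolvent D (\<i> * complex_of_real t) x"
    have int: "?F integrable_on {-\<rho>..\<rho>}"
      by (intro integrable_continuous_real continuous_intros
          continuous_on_compose2[OF continuous_on_resolvent[OF lin_D U UNIV_I K bD]]) auto
    have "fst (integral {-\<rho>..\<rho>} ?F) = imag_integral \<rho> (\<lambda>z. resolvent A z f)"
      using integral_linear[OF int bounded_linear_fst] by (simp add: o_def x ZD(3))
    then have 1: "norm (fst (integral {-\<rho>..\<rho>} ?F)) \<le> L * norm f" using L(2)[OF \<rho>] by simp
    have "snd (integral {-\<rho>..\<rho>} ?F) = - imag_integral \<rho> (\<lambda>z. resolvent A' (- z) g)"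
      using integral_linear[OF int bounded_linear_snd] by (simp add: o_def x ZD(3))
    moreover have "norm (imag_integral \<rho> (\<lambda>z. resolvent A' (- z) g)) \<le> L * norm g"
      by (rule imag_integral_adjoint_resolvent_le[OF dense_A imag_A K bA L(1) L(2)[OF \<rho>]])
    ultimately have 2: "norm (snd (integral {-\<rho>..\<rho>} ?F)) \<le> L * norm g" by simp
    show ?thesis using norm_Pair_mono[OF 1 2 L(1)] by (simp add: x)
  qed
  then show ?thesis using that L(1) by blast
qed

text \<open>
  The truncated integrals for \<open>T\<close> and \<open>D\<close> differ by those of
  \<open>(T - z)\<inverse> - (D - z)\<inverse> = - (T - z)\<inverse> (T - D) (D - z)\<inverse>\<close>, which is of order \<open>\<bar>z\<bar> powr (p - 2)\<close> with
  \<open>p - 2 < - 1\<close>.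
\<close>

lemma bisectorial_T: "\<exists>h K L. bisectorial_resolvent T h K L"
proof -
  obtain K c where K: "K \<ge> 0" and c: "c \<ge> 0"
    and mem: "\<And>t. \<i> * complex_of_real t \<in> resolvent_set_on UNIV T"
    and dec: "\<And>t u. u \<in> op_dom T \<Longrightarrow> (1 + \<bar>t\<bar>) * norm u \<le> K * norm (op_app T u - (\<i> * complex_of_real t) *\<^sub>C u)"
    and rel: "\<And>t. relative_bound (\<i> * complex_of_real t) (c * (1 + \<bar>t\<bar>) powr (p - 1))"
    by (rule imag_axis_estimates) blast
  obtain K' where inv: "\<And>t. bounded_inverse (\<i> * complex_of_real t) K'"
    using bounded_inverse_imag_uniform by blast
  obtain L where L: "L \<ge> 0" "\<And>\<rho> x. \<rho> > 0 \<Longrightarrow> norm (imag_integral \<rho> (\<lambda>z. resolvent D z x)) \<le> L * norm x"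
    using imag_integral_D_bounded by blast
  have lb: "norm u \<le> K * norm (op_app T u - (\<i> * complex_of_real t) *\<^sub>C u)" if u: "u \<in> op_dom T" for t u
    using dec[OF u, of t] mult_right_mono[of 1 "1 + \<bar>t\<bar>" "norm u"] by simp
  define h where "h = 1 / (2 * (K + 1))"
  have h: "h > 0" using K by (simp add: h_def)
  have strip: "z \<in> resolvent_set_on UNIV T" if z: "\<bar>Re z\<bar> < h" for z
  proof (rule resolvent_set_neighbour(1)[OF lin_T mem[of "Im z"] K lb])
    have eq: "cmod (z - \<i> * complex_of_real (Im z)) = \<bar>Re z\<bar>" by (simp add: cmod_def)
    have "\<bar>Re z\<bar> * K \<le> h * K" using z K by (intro mult_right_mono) auto
    also have "\<dots> \<le> 1/2" using K by (simp add: h_def field_simps)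
    finally show "cmod (z - \<i> * complex_of_real (Im z)) * K \<le> 1/2" unfolding eq .
  qed
  have decR: "(1 + \<bar>t\<bar>) * norm (resolvent T (\<i> * complex_of_real t) x) \<le> K * norm x" for t x
    using dec[OF resolvent_in_dom[OF mem UNIV_I], of t t x] unfolding resolvent_right[OF mem UNIV_I] .
  have memD: "\<i> * complex_of_real t \<in> resolvent_set_on UNIV D" for t
    by (rule bounded_inverse_D(1)[OF inv])
  let ?U = "range (\<lambda>t. \<i> * complex_of_real t)"
  have bT: "norm u \<le> K * norm (op_app T u - z *\<^sub>C u)" if zu: "z \<in> ?U" "u \<in> op_dom T" for u z
  proof -
    obtain t where t: "z = \<i> * complex_of_real t" using zu(1) by blast
    show ?thesis unfolding t by (rule lb[OF zu(2)])
  qed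
  have bD: "norm u \<le> K' * norm (op_app D u - z *\<^sub>C u)" if zu: "z \<in> ?U" "u \<in> op_dom D" for u z
  proof -
    obtain t where t: "z = \<i> * complex_of_real t" using zu(1) by blast
    show ?thesis unfolding t by (rule bounded_inverse_D(2)[OF inv zu(2)])
  qed
  have UT: "?U \<subseteq> resolvent_set_on UNIV T" and UD: "?U \<subseteq> resolvent_set_on UNIV D" using mem memD by auto
  have domTD: "op_dom T = op_dom D" by (simp add: dom_T)
  have diff: "norm (\<i> *\<^sub>C resolvent T (\<i> * complex_of_real t) x - \<i> *\<^sub>C resolvent D (\<i> * complex_of_real t) x)
      \<le> K * c * norm x * (1 + \<bar>t\<bar>) powr (p - 2)" for t x
  proof -
    let ?z = "\<i> * complex_of_real t"
    let ?v = "resolvent D ?z x"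
    have vD: "?v \<in> op_dom D" by (rule resolvent_in_dom[OF memD UNIV_I])
    have vT: "?v \<in> op_dom T" using vD by (simp only: domTD)
    let ?w = "op_app T ?v - op_app D ?v"
    have "op_app T ?v - ?z *\<^sub>C ?v = (op_app D ?v - ?z *\<^sub>C ?v) + ?w" by simp
    also have "op_app D ?v - ?z *\<^sub>C ?v = x" by (rule resolvent_right[OF memD UNIV_I])
    finally have "resolvent T ?z (x + ?w) = ?v" by (rule resolvent_eqI[OF mem vT])
    then have "?v = resolvent T ?z x + resolvent T ?z ?w"
      by (simp only: resolvent_add[OF lin_T mem UNIV_I UNIV_I])
    then have "resolvent T ?z x - ?v = - resolvent T ?z ?w" by (metis add_diff_cancel_left' minus_diff_eq)
    then have "norm (resolvent T ?z x - ?v) = norm (resolvent T ?z (op_app T ?v - op_app D ?v))" by simp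
    also have "\<dots> \<le> K / (1 + \<bar>t\<bar>) * norm (op_app T ?v - op_app D ?v)"
      using decR[of t "op_app T ?v - op_app D ?v"] by (simp add: pos_le_divide_eq mult.commute)
    also have "\<dots> \<le> K / (1 + \<bar>t\<bar>) * (c * (1 + \<bar>t\<bar>) powr (p - 1) * norm x)"
    proof (rule mult_left_mono)
      show "norm (op_app T ?v - op_app D ?v) \<le> c * (1 + \<bar>t\<bar>) powr (p - 1) * norm x"
        using norm_T_diff_D[OF rel[of t] vD] unfolding resolvent_right[OF memD UNIV_I] .
    qed (use K in simp)
    also have "\<dots> = K * c * norm x * ((1 + \<bar>t\<bar>) powr (p - 1) / (1 + \<bar>t\<bar>))" by simp
    also have "(1 + \<bar>t\<bar>) powr (p - 1) / (1 + \<bar>t\<bar>) = (1 + \<bar>t\<bar>) powr (p - 2)"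
    proof -
      have "(1 + \<bar>t\<bar>) powr (p - 2) = (1 + \<bar>t\<bar>) powr ((p - 1) - 1)" by simp
      also have "\<dots> = (1 + \<bar>t\<bar>) powr (p - 1) / (1 + \<bar>t\<bar>) powr 1" by (rule powr_diff)
      finally show ?thesis by simp
    qed
    finally show ?thesis by (simp add: scaleC_diff_right[symmetric] norm_scaleC)
  qed
  define L' where "L' = L + K * c * (2 / (1 - p))"
  have trunc: "norm (imag_integral \<rho> (\<lambda>z. resolvent T z x)) \<le> L' * norm x" if \<rho>: "\<rho> > 0" for \<rho> x
  proof -
    have iT: "(\<lambda>t. \<i> *\<^sub>C resolvent T (\<i> * complex_of_real t) x) integrable_on {-\<rho>..\<rho>}"
      by (intro integrable_continuous_real continuous_intros
          continuous_on_compose2[OF continuous_on_resolvent[OF lin_T UT UNIV_I K bT]]) auto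
    have iD: "(\<lambda>t. \<i> *\<^sub>C resolvent D (\<i> * complex_of_real t) x) integrable_on {-\<rho>..\<rho>}"
      by (intro integrable_continuous_real continuous_intros
          continuous_on_compose2[OF continuous_on_resolvent[OF lin_D UD UNIV_I bounded_inverseD(1)[OF inv] bD]]) auto
    have ip: "(\<lambda>t. K * c * norm x * (1 + \<bar>t\<bar>) powr (p - 2)) integrable_on {-\<rho>..\<rho>}"
      by (intro integrable_continuous_real continuous_intros) (auto simp: add_nonneg_eq_0_iff)
    have "norm (imag_integral \<rho> (\<lambda>z. resolvent T z x) - imag_integral \<rho> (\<lambda>z. resolvent D z x))
        \<le> integral {-\<rho>..\<rho>} (\<lambda>t. K * c * norm x * (1 + \<bar>t\<bar>) powr (p - 2))"
      unfolding integral_diff[OF iT iD, symmetric]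
      by (rule Henstock_Kurzweil_Integration.integral_norm_bound_integral[OF integrable_diff[OF iT iD] ip diff])
    also have "\<dots> = K * c * norm x * integral {-\<rho>..\<rho>} (\<lambda>t. (1 + \<bar>t\<bar>) powr (p - 2))" by simp
    also have "\<dots> \<le> K * c * norm x * (2 / (1 - p))"
      using integral_powr_tail_le[OF p(2), of \<rho>] \<rho> K c by (intro mult_left_mono) auto
    finally have "norm (imag_integral \<rho> (\<lambda>z. resolvent T z x) - imag_integral \<rho> (\<lambda>z. resolvent D z x))
        \<le> K * c * norm x * (2 / (1 - p))" .
    then have "norm (imag_integral \<rho> (\<lambda>z. resolvent T z x)) \<le> L * norm x + K * c * norm x * (2 / (1 - p))"
      using L(2)[OF \<rho>, of x] norm_triangle_sub[of "imag_integral \<rho> (\<lambda>z. resolvent T z x)" "imag_integral \<rho> (\<lambda>z. resolvent D z x)"]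
      by linarith
    then show ?thesis by (simp add: L'_def algebra_simps)
  qed
  have "bisectorial_resolvent T h K L'"
    by unfold_locales (use dense_T h strip K decR trunc in auto)
  then show ?thesis by blast
qed

lemma double_sector_T:
  assumes "\<theta> < \<theta>'"
  shows "\<exists>r>0. double_sector \<theta>' r \<subseteq> resolvent_set_on UNIV T"
proof -
  obtain M where M: "M \<ge> 0"
    "\<And>z. z \<noteq> 0 \<Longrightarrow> \<theta>' \<le> \<bar>Arg z\<bar> \<Longrightarrow> \<bar>Arg z\<bar> \<le> pi - \<theta>' \<Longrightarrow> bounded_inverse z (M / cmod z)"
    using bounded_inverse_bisector[OF assms] by blast
  obtain c where c: "c \<ge> 0" "\<And>z N M. bounded_inverse z N \<Longrightarrow> cmod z * N \<le> M \<Longrightarrow>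
    relative_bound z (c * rpow N (1 - p) * rpow (1 + M) p)"
    using relative_bound_subordinate by blast
  define k where "k = c * rpow (1 + M) p + 1"
  have k: "k > 0" using c(1) rpow_nonneg[of "1 + M" p] by (simp add: k_def add_nonneg_pos)
  \<comment> \<open>The value at which \<open>\<eta> powr (1 - p) = 1 / k\<close>; for \<open>\<bar>z\<bar> > r\<close> the inverse is bounded by \<open>\<eta>\<close>, and the relative bound is below \<open>1\<close>.\<close>
  define \<eta> where "\<eta> = (1 / k) powr (1 / (1 - p))"
  have \<eta>: "\<eta> > 0" using k by (simp add: \<eta>_def)
  have \<eta>k: "rpow \<eta> (1 - p) = 1 / k"
    using p k by (simp add: \<eta>_def rpow_def powr_powr)
  define r where "r = M / \<eta> + 1"
  have r: "r > 0" using M(1) \<eta> by (simp add: r_def add_nonneg_pos)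
  have "z \<in> resolvent_set_on UNIV T" if "z \<in> double_sector \<theta>' r" for z
  proof -
    have z: "z \<noteq> 0" "\<theta>' \<le> \<bar>Arg z\<bar>" "\<bar>Arg z\<bar> \<le> pi - \<theta>'" "r < cmod z"
      using that r by (auto simp: double_sector_def)
    have inv: "bounded_inverse z (M / cmod z)" by (rule M(2)[OF z(1-3)])
    have rel: "relative_bound z (c * rpow (M / cmod z) (1 - p) * rpow (1 + M) p)"
      by (rule c(2)[OF inv]) (use z(1) in simp)
    have "M / \<eta> \<le> cmod z" using z(4) by (simp add: r_def)
    then have "M / cmod z \<le> \<eta>" using z(1) \<eta> by (simp add: field_simps)
    then have "rpow (M / cmod z) (1 - p) \<le> 1 / k"
      unfolding \<eta>k[symmetric] using M(1) p by (intro rpow_mono) auto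
    then have "c * rpow (M / cmod z) (1 - p) * rpow (1 + M) p \<le> c * (1 / k) * rpow (1 + M) p"
      using c(1) by (intro mult_right_mono mult_left_mono rpow_nonneg)
    also have "\<dots> < 1" using k by (simp add: k_def)
    finally show ?thesis by (rule resolvent_set_T[OF inv rel])
  qed
  then show ?thesis using r by blast
qed

end

lemma abs_Re_le_double_sector:
  assumes "0 \<le> \<phi>" "\<phi> \<le> \<bar>Arg z\<bar>" "\<bar>Arg z\<bar> \<le> pi - \<phi>"
  shows "\<bar>Re z\<bar> \<le> cmod z * cos \<phi>"
proof (cases "z = 0")
  case False
  have "cos \<bar>Arg z\<bar> \<le> cos \<phi>"
    using assms by (intro cos_monotone_0_pi_le) auto
  moreover have "cos (pi - \<phi>) \<le> cos \<bar>Arg z\<bar>"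
    using assms by (intro cos_monotone_0_pi_le) auto
  ultimately have "\<bar>cos (Arg z)\<bar> \<le> cos \<phi>" by (simp add: abs_le_iff)
  then have "cmod z * \<bar>cos (Arg z)\<bar> \<le> cmod z * cos \<phi>" by (rule mult_left_mono) simp
  moreover have "cmod z * \<bar>cos (Arg z)\<bar> = \<bar>Re z\<bar>" using False by (simp add: cos_Arg)
  ultimately show ?thesis by simp
qed simp

theorem theorem4p6:
  fixes A B C :: "'a::complex_hilbert operator" and T :: "('a \<times> 'a) operator"
    and p \<theta> :: real
  assumes T: "T = hamiltonian A B C"
    and nonneg: "nonnegative_hamiltonian A B C"
    and p: "0 \<le> p" "p < 1"
    and dominant: "diagonally_dominant p A B C"
    and \<theta>: "0 \<le> \<theta>" "\<theta> < pi / 2"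
    and A: "sectorially_dichotomous A \<theta>"
  shows "dichotomous T \<and>
    (\<exists>Vp Vm. dichotomous_wrt T Vp Vm \<and>
      (\<forall>x. \<exists>I. has_pv_integral_imag_axis (\<lambda>z. resolvent T z x) I \<and>
        (1 / (complex_of_real pi * \<i>)) *\<^sub>C I
          = projection_along Vp Vm x - projection_along Vm Vp x)) \<and>
    (\<exists>h>0. \<exists>\<theta>''. \<theta> < \<theta>'' \<and> \<theta>'' < pi / 2 \<and>
      (\<forall>\<theta>'. \<theta> < \<theta>' \<and> \<theta>' < pi / 2 \<longrightarrow>
        (\<exists>r'>0. {z. \<bar>Re z\<bar> < h} \<union> double_sector \<theta>'' 0 \<union> double_sector \<theta>' r'
          \<subseteq> resolvent_set_on UNIV T)))"
proof -
  interpret ham: sectorial_hamiltonian A B C p \<theta>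
    by unfold_locales (use nonneg p dominant \<theta> A in auto)
  obtain h K L where "bisectorial_resolvent (hamiltonian A B C) h K L"
    using ham.bisectorial_T by blast
  then interpret bi: bisectorial_resolvent T h K L unfolding T .
  have dich: "dichotomous_wrt T (bi.V 1) (bi.V (-1))" by (rule bi.dichotomous_V(1))
  have pv: "\<exists>I. has_pv_integral_imag_axis (\<lambda>z. resolvent T z x) I \<and>
      (1 / (complex_of_real pi * \<i>)) *\<^sub>C I
        = projection_along (bi.V 1) (bi.V (-1)) x - projection_along (bi.V (-1)) (bi.V 1) x" for x
    by (intro exI[of _ "(complex_of_real pi * \<i>) *\<^sub>C bi.J x"] conjI bi.dichotomous_V(2))
      (simp add: scaleC_scaleC bi.dichotomous_V(3)[symmetric])
  define \<theta>1 where "\<theta>1 = (\<theta> + pi / 2) / 2"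
  have \<theta>1: "\<theta> < \<theta>1" "\<theta>1 < pi / 2" "0 \<le> \<theta>1" using \<theta> by (auto simp: \<theta>1_def)
  obtain r where r: "r > 0" "double_sector \<theta>1 r \<subseteq> resolvent_set_on UNIV T"
    using ham.double_sector_T[OF \<theta>1(1)] T by blast
  \<comment> \<open>Inside the disc of radius \<open>r\<close> the bisector within angle \<open>\<eta>\<close> of the axis stays in the strip of width \<open>h\<close>,\<close>
  \<comment> \<open>outside of it the bisector with angle \<open>\<theta>1\<close> takes over.\<close>
  define \<eta> where "\<eta> = min (h / (2 * r)) (pi / 4)"
  have \<eta>: "0 < \<eta>" "\<eta> \<le> pi / 4" "r * \<eta> < h"
  proof -
    show "0 < \<eta>" "\<eta> \<le> pi / 4" using bi.h r by (auto simp: \<eta>_def)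
    have "r * \<eta> \<le> r * (h / (2 * r))" using r by (intro mult_left_mono) (auto simp: \<eta>_def)
    also have "\<dots> < h" using r bi.h by simp
    finally show "r * \<eta> < h" .
  qed
  define \<theta>'' where "\<theta>'' = max \<theta>1 (pi / 2 - \<eta>)"
  have \<theta>'': "\<theta> < \<theta>''" "\<theta>'' < pi / 2" "\<theta>1 \<le> \<theta>''" "0 \<le> \<theta>''" "pi / 2 - \<eta> \<le> \<theta>''"
    using \<theta>1 \<eta> unfolding \<theta>''_def by (simp_all add: max_def)
  have cos: "cos \<theta>'' \<le> \<eta>"
  proof -
    have "cos \<theta>'' \<le> cos (pi / 2 - \<eta>)"
      using \<theta>'' \<eta> by (intro cos_monotone_0_pi_le) auto
    also have "\<dots> = sin \<eta>" by (simp add: cos_diff)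
    also have "\<dots> \<le> \<eta>" using \<eta> by (intro sin_x_le_x) auto
    finally show ?thesis .
  qed
  have sector: "z \<in> resolvent_set_on UNIV T" if z: "z \<in> double_sector \<theta>'' 0" for z
  proof (cases "cmod z \<le> r")
    case True
    have "\<bar>Re z\<bar> \<le> cmod z * cos \<theta>''"
      using z \<theta>'' by (intro abs_Re_le_double_sector) (auto simp: double_sector_def)
    also have "\<dots> \<le> r * \<eta>"
      using True cos r \<theta>'' by (intro mult_mono cos_ge_zero) auto
    finally show ?thesis using \<eta>(3) by (intro bi.strip_mem) simp
  next
    case False
    then have "z \<in> double_sector \<theta>1 r" using z \<theta>'' by (auto simp: double_sector_def)
    then show ?thesis using r(2) by blast
  qed
  have sectors: "\<exists>r'>0. {z. \<bar>Re z\<bar> < h} \<union> double_sector \<theta>'' 0 \<union> double_sector \<theta>' r' \<subseteq> resolvent_set_on UNIV T"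
    if \<theta>': "\<theta> < \<theta>'" for \<theta>'
  proof -
    obtain r' where "r' > 0" "double_sector \<theta>' r' \<subseteq> resolvent_set_on UNIV T"
      using ham.double_sector_T[OF \<theta>'] T by blast
    then show ?thesis using bi.strip sector by (intro exI[of _ r']) auto
  qed
  show ?thesis
    unfolding dichotomous_def using dich pv bi.h \<theta>'' sectors by blast
qed

end
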